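(* Let $I=(-1,1)$ and let $f$ be analytic on $[-1,1]$ with positive constants $C_f,K_f$ such that $\|f^{(n)}\|_{L^\infty(I)}\le C_fK_f^nn!$ for all $n\in\mathbb N_0$. Let the reaction coefficient be $b(x)=1$ for all $x\in I$. For $\varepsilon\in(0,1]$ let $u_\varepsilon\in H^1_0(I)$ be the solution of $$\int_{-1}^1\{\varepsilon^2u_\varepsilon'v'+u_\varepsilon v\}\,dx=\int_{-1}^1fv\,dx\qquad\text{for all }v\in H_0^1(I).$$ Then there exist positive constants $C,\beta$, independent of $\varepsilon\in(0,1]$ and of $p\ge1$, such that for all $p\in\mathbb N$ and $\varepsilon\in(0,1]$ there exists a sigmoid NN $\Phi^{u_\varepsilon,p}_\varepsilon$ (activation $\sigma(x)=\frac{1}{1+\exp(-x)}$) with $$\|u_\varepsilon-\mathrm R(\Phi^{u_\varepsilon,p}_\varepsilon)\|_{W^{1,\infty}(I)}\le Ce^{-\beta p},$$ which implies that $$\varepsilon^{1/2}\|u_\varepsilon'-\mathrm R(\Phi^{u_\varepsilon,p}_\varepsilon)'\|_{L^2(I)}+\|u_\varepsilon-\mathrm R(\Phi^{u_\varepsilon,p}_\varepsilon)\|_{L^2(I)}\le Ce^{-\beta p},\qquad\|u_\varepsilon-\mathrm R(\Phi^{u_\varepsilon,p}_\varepsilon)\|_{L^\infty(I)}\le Ce^{-\beta p}.$$ For a constant $\tilde C>0$ independent of $f,p,\varepsilon,C$ and $\beta$, the network depth and size satisfy $$L(\Phi^{u_\varepsilon,p}_\varepsilon)=\lceil\log_2(p)\rceil+1,\qquad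 M(\Phi^{u_\varepsilon,p}_\varepsilon)\le\tilde Cp.$$ The weights and biases in the hidden layers are independent of $u_\varepsilon$ and depend only on $p,\varepsilon$ and $\beta$.
   Context: Neural networks (NNs): for $d,L\in\mathbb N$, a NN with input dimension $d$ and $L$ layers is a finite sequence $\Phi=((A_1,b_1),\dots,(A_L,b_L))$ with $N_0=d$, $N_1,\dots,N_L\in\mathbb N$, $A_\ell\in\mathbb R^{N_\ell\times N_{\ell-1}}$, $b_\ell\in\mathbb R^{N_\ell}$. For an activation $\varrho:\mathbb R\to\mathbb R$ (applied componentwise) its realization is $\mathrm R(\Phi):\mathbb R^d\to\mathbb R^{N_L}$, $x\mapsto x_L$, where $x_0=x$, $x_\ell=\varrho(A_\ell x_{\ell-1}+b_\ell)$ for $\ell=1,\dots,L-1$, and $x_L=A_Lx_{L-1}+b_L$. Layers $1,\dots,L-1$ are the hidden layers, layer $L$ is the output layer. The depth is $L(\Phi)=L$ and the size is $M(\Phi)=\sum_{\ell=1}^L(\|A_\ell\|_0+\|b_\ell\|_0)$, where $\|\cdot\|_0$ counts nonzero entries. A sigmoid NN uses only the activation $\sigma$; NNs of depth 1 (affine maps) are included. The norm is $\|F\|_{W^{1,\infty}(I)}=\max\{\|F\|_{L^\infty(I)},\|F'\|_{L^\infty(I)}\}$.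
   Formalization: For p=1 the network depth is 2 instead of ⌈log₂(p)⌉+1=1: an affine network cannot satisfy the W^{1,∞} bound uniformly in ε (f=1 gives |u_ε'| near ±1 of size tanh(1/ε)/ε with opposite signs); for all p≥2 the printed depth is kept. *)

theory Defs
  imports
    "HOL-Analysis.Analysis"
    "HOL-Probability.Essential_Supremum"
    "Jordan_Normal_Form.Matrix"
begin

text \<open>\<^bold>\<open>Neural networks.\<close> A network lists its layers \<open>(A\<^sub>1, b\<^sub>1), \<dots>, (A\<^sub>L, b\<^sub>L)\<close> in order,
  so layer \<open>l\<close> sits at list position \<open>l - 1\<close>.\<close>

type_synonym nn = "(real Matrix.mat \<times> real Matrix.vec) list"

definition is_nn :: "nat \<Rightarrow> nat \<Rightarrow> nn \<Rightarrow> bool" where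
  "is_nn d m \<Phi> \<longleftrightarrow> \<Phi> \<noteq> [] \<and>
     (\<exists>N :: nat \<Rightarrow> nat. N 0 = d \<and> N (length \<Phi>) = m \<and> (\<forall>l\<le>length \<Phi>. 1 \<le> N l) \<and>
        (\<forall>l<length \<Phi>. fst (\<Phi> ! l) \<in> carrier_mat (N (Suc l)) (N l) \<and>
                      snd (\<Phi> ! l) \<in> carrier_vec (N (Suc l))))"

fun realization :: "(real \<Rightarrow> real) \<Rightarrow> nn \<Rightarrow> real Matrix.vec \<Rightarrow> real Matrix.vec" where
  "realization \<rho> [] x = x"
| "realization \<rho> [(A, b)] x = A *\<^sub>v x + b"
| "realization \<rho> ((A, b) # layer # \<Phi>) x =
     realization \<rho> (layer # \<Phi>) (map_vec \<rho> (A *\<^sub>v x + b))"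

text \<open>The realization of a network with one input and one output, as a function on the reals.\<close>

definition realization1 :: "(real \<Rightarrow> real) \<Rightarrow> nn \<Rightarrow> real \<Rightarrow> real" where
  "realization1 \<rho> \<Phi> x = vec_index (realization \<rho> \<Phi> (Matrix.vec 1 (\<lambda>_. x))) 0"

definition depth :: "nn \<Rightarrow> nat" where
  "depth \<Phi> = length \<Phi>"

definition mat_nnz :: "real Matrix.mat \<Rightarrow> nat" where
  "mat_nnz A = card {(i, j). i < dim_row A \<and> j < dim_col A \<and> A $$ (i, j) \<noteq> 0}"

definition vec_nnz :: "real Matrix.vec \<Rightarrow> nat" where
  "vec_nnz b = card {i. i < dim_vec b \<and> vec_index b i \<noteq> 0}"

definition nn_size :: "nn \<Rightarrow> nat" where
  "nn_size \<Phi> = (\<Sum>(A, b)\<leftarrow>\<Phi>. mat_nnz A + vec_nnz b)"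

definition hidden_layers :: "nn \<Rightarrow> nn" where
  "hidden_layers \<Phi> = butlast \<Phi>"

definition sigmoid :: "real \<Rightarrow> real" where
  "sigmoid x = 1 / (1 + exp (- x))"


text \<open>\<^bold>\<open>Function spaces on \<open>I = (-1, 1)\<close>.\<close> Elements of Lebesgue and Sobolev spaces are
  represented by arbitrary functions on the reals; every notion below depends only on the
  restriction to \<open>I\<close> up to null sets.\<close>

abbreviation leb_I :: "real measure" where
  "leb_I \<equiv> lebesgue_on {-1<..<1}"

definition in_L2 :: "(real \<Rightarrow> real) \<Rightarrow> bool" where
  "in_L2 v \<longleftrightarrow> v \<in> borel_measurable leb_I \<and> integrable leb_I (\<lambda>x. (v x)\<^sup>2)"

definition L2_norm :: "(real \<Rightarrow> real) \<Rightarrow> ereal" where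
  "L2_norm v = (if in_L2 v then ereal (sqrt (\<integral>x. (v x)\<^sup>2 \<partial>leb_I)) else \<infinity>)"

definition Linf_norm :: "(real \<Rightarrow> real) \<Rightarrow> ereal" where
  "Linf_norm v = esssup leb_I (\<lambda>x. ereal \<bar>v x\<bar>)"

text \<open>The second argument is the (weak) derivative of the first.\<close>

definition W1inf_norm :: "(real \<Rightarrow> real) \<Rightarrow> (real \<Rightarrow> real) \<Rightarrow> ereal" where
  "W1inf_norm v v' = max (Linf_norm v) (Linf_norm v')"

text \<open>Continuously differentiable functions with compact support in \<open>I\<close>, the usual test
  functions for Sobolev spaces on intervals.\<close>

definition test_function :: "(real \<Rightarrow> real) \<Rightarrow> bool" where
  "test_function \<phi> \<longleftrightarrow> \<phi> C1_differentiable_on UNIV \<and> closure {x. \<phi> x \<noteq> 0} \<subseteq> {-1<..<1}"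

definition weak_deriv :: "(real \<Rightarrow> real) \<Rightarrow> (real \<Rightarrow> real) \<Rightarrow> bool" where
  "weak_deriv v v' \<longleftrightarrow>
     (\<forall>\<phi>. test_function \<phi> \<longrightarrow>
        (\<integral>x. v x * deriv \<phi> x \<partial>leb_I) = - (\<integral>x. v' x * \<phi> x \<partial>leb_I))"

text \<open>\<open>in_H1 v v'\<close>: \<open>v\<close> lies in \<open>H\<^sup>1(I)\<close> and \<open>v'\<close> is its weak derivative.\<close>

definition in_H1 :: "(real \<Rightarrow> real) \<Rightarrow> (real \<Rightarrow> real) \<Rightarrow> bool" where
  "in_H1 v v' \<longleftrightarrow> in_L2 v \<and> in_L2 v' \<and> weak_deriv v v'"

text \<open>The trace at the end points is that of the continuous representative.\<close>

definition in_H10 :: "(real \<Rightarrow> real) \<Rightarrow> (real \<Rightarrow> real) \<Rightarrow> bool" where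
  "in_H10 v v' \<longleftrightarrow> in_H1 v v' \<and>
     (\<exists>w. continuous_on {-1..1} w \<and> (AE x in leb_I. v x = w x) \<and> w (-1) = 0 \<and> w 1 = 0)"

text \<open>\<open>weak_solution \<epsilon> f u u'\<close>: \<open>u\<close>, with weak derivative \<open>u'\<close>, solves the reaction-diffusion
  problem \<open>- \<epsilon>\<^sup>2 u'' + b u = f\<close> with reaction coefficient \<open>b = 1\<close> and homogeneous Dirichlet
  boundary conditions.\<close>

definition weak_solution ::
    "real \<Rightarrow> (real \<Rightarrow> real) \<Rightarrow> (real \<Rightarrow> real) \<Rightarrow> (real \<Rightarrow> real) \<Rightarrow> bool" where
  "weak_solution \<epsilon> f u u' \<longleftrightarrow> in_H10 u u' \<and>
     (\<forall>v v'. in_H10 v v' \<longrightarrow>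
        (\<integral>x. \<epsilon>\<^sup>2 * u' x * v' x + u x * v x \<partial>leb_I) = (\<integral>x. f x * v x \<partial>leb_I))"


text \<open>\<^bold>\<open>Real analyticity.\<close> The expansions are only required on the set itself: at an end
  point of an interval the expansion is one-sided, and values of \<open>f\<close> outside are irrelevant.\<close>

definition real_analytic_on :: "(real \<Rightarrow> real) \<Rightarrow> real set \<Rightarrow> bool" where
  "real_analytic_on f S \<longleftrightarrow>
     (\<forall>x0\<in>S. \<exists>r>0. \<exists>a :: nat \<Rightarrow> real.
        \<forall>x\<in>S. \<bar>x - x0\<bar> < r \<longrightarrow> (\<lambda>n. a n * (x - x0) ^ n) sums f x)"

end

(* All weights are unconstrained, so a sigmoid far to the left of the origin is, up to an
   arbitrarily small C^1 error, an exponential: exp T * sigmoid (a x - T) ~ exp (a x).  One hidden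
   layer therefore yields the boundary layers exp (x/eps), exp (-x/eps) and, through
   ((exp (h x) - 1) / h)^i ~ x^i with h small, all monomials of degree at most p.  The remaining
   hidden layers have a single neuron and carry x through an approximate identity.

   On polynomials of degree at most p the operator 1 - eps^2 D^2 is invertible.  Hence if g is the
   Chebyshev partial sum of f, the solution u is an element of span {x^i, exp (x/eps), exp (-x/eps)}
   up to a particular solution v of -eps^2 v'' + v = f - g.  Convolution with the kernel
   exp (-|t|/eps) / (2 eps) bounds v by the sup norm and v' by the Lipschitz constant of f - g, both
   exponentially small in p and independent of eps; no regularity theory for u is needed.  The
   boundary values of v are absorbed by the coefficients of the two exponentials.

   The Chebyshev coefficients decay geometrically because integration by parts turns
   int f(cos t) cos(l t) into (1/2l) int f'(cos t) (cos((l-1)t) - cos((l+1)t)). *)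

theory Submission
  imports Defs "HOL-Computational_Algebra.Polynomial"
begin

section \<open>Chebyshev expansions\<close>

text \<open>The hidden layers may not depend on \<open>f\<close>, while the error constants may
  depend neither on \<open>p\<close> nor on \<epsilon>. The output weights on monomials and
  exponentials come with no bound uniform in \<open>p\<close> and \<epsilon>, since inverting 1 -
  \<epsilon>^2 D^2 on polynomials of degree \<open>p\<close> can produce very large coefficients.
  They depend linearly on the Chebyshev coefficients of \<open>f\<close>, however, so their absolute
  sum is at most an \<open>f\<close>-dependent factor times a quantity of \<open>p\<close> and
  \<epsilon> alone. Hidden layers that are accurate relative to that quantity leave only the
  \<open>f\<close>-dependent factor, which becomes part of \<open>C\<close>.

  The Lipschitz constant of f - g enters because the sup norm alone would not do: the derivative of
  the kernel has mass 1/\<epsilon>, so a sup bound \<delta> on f - g yields only \<delta>/\<epsilon>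
  for v'. One order of regularity buys back the factor \<epsilon>. Hence the Chebyshev series has to
  converge geometrically in the Lipschitz seminorm as well.\<close>

fun cheb :: "nat \<Rightarrow> real poly" where
  "cheb 0 = 1"
| "cheb (Suc 0) = [:0, 1:]"
| "cheb (Suc (Suc n)) = [:0, 2:] * cheb (Suc n) - cheb n"

lemma poly_cheb_cos: "poly (cheb k) (cos t) = cos (real k * t)"
proof (induction k rule: cheb.induct)
  case (3 n)
  have "cos (real (Suc (Suc n)) * t) + cos (real n * t) = 2 * cos t * cos (real (Suc n) * t)"
    using cos_times_cos[of t "real (Suc n) * t"] cos_minus[of "t - real (Suc n) * t"]
    by (simp add: algebra_simps)
  then show ?case
    using 3 by simp
qed auto

lemma degree_cheb_le: "degree (cheb k) \<le> k"
proof (induction k rule: cheb.induct)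
  case (3 n)
  have "degree ([:0, 2:] * cheb (Suc n)) \<le> Suc (Suc n)"
    using degree_mult_le[of "[:0, 2:]" "cheb (Suc n)"] 3 by simp
  then show ?case
    using 3 by (auto intro!: degree_diff_le)
qed auto

lemma poly_cheb_arccos: "x \<in> {-1..1} \<Longrightarrow> poly (cheb k) x = cos (real k * arccos x)"
  using poly_cheb_cos[of k "arccos x"] by simp

lemma abs_cheb_le_1: "x \<in> {-1..1} \<Longrightarrow> \<bar>poly (cheb k) x\<bar> \<le> 1"
  by (simp add: poly_cheb_arccos)

lemma abs_sin_mult_le: "\<bar>sin (real k * t)\<bar> \<le> real k * \<bar>sin t\<bar>"
proof (induction k)
  case (Suc k)
  have "\<bar>sin (real (Suc k) * t)\<bar> = \<bar>sin (real k * t) * cos t + cos (real k * t) * sin t\<bar>"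
    by (simp add: algebra_simps sin_add)
  also have "\<dots> \<le> \<bar>sin (real k * t)\<bar> * \<bar>cos t\<bar> + \<bar>cos (real k * t)\<bar> * \<bar>sin t\<bar>"
    using abs_triangle_ineq by (metis abs_mult)
  also have "\<dots> \<le> \<bar>sin (real k * t)\<bar> * 1 + 1 * \<bar>sin t\<bar>"
    by (intro add_mono mult_mono) auto
  finally show ?case
    using Suc by (simp add: algebra_simps)
qed auto

text \<open>This is Markov's constant k^2, obtained without differentiating: sum-to-product turns
  both differences into products of two sines, at the half sum and the half difference of the
  angles, and \<open>abs_sin_mult_le\<close> contributes one factor \<open>k\<close> for each
  sine.\<close>

lemma cheb_lipschitz:
  assumes "x \<in> {-1..1}" "y \<in> {-1..1}"
  shows "\<bar>poly (cheb k) x - poly (cheb k) y\<bar> \<le> (real k)\<^sup>2 * \<bar>x - y\<bar>"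
proof -
  let ?a = "(arccos x + arccos y) / 2" and ?b = "(arccos y - arccos x) / 2"
  have xy: "x - y = 2 * sin ?a * sin ?b"
    using cos_diff_cos[of "arccos x" "arccos y"] assms by simp
  have eq: "poly (cheb k) x - poly (cheb k) y = 2 * sin (real k * ?a) * sin (real k * ?b)"
    using cos_diff_cos[of "real k * arccos x" "real k * arccos y"] assms
    by (simp add: poly_cheb_arccos ring_distribs flip: distrib_left right_diff_distrib)
  have "\<bar>poly (cheb k) x - poly (cheb k) y\<bar> = 2 * (\<bar>sin (real k * ?a)\<bar> * \<bar>sin (real k * ?b)\<bar>)"
    unfolding eq by (simp add: abs_mult)
  also have "\<dots> \<le> 2 * ((real k * \<bar>sin ?a\<bar>) * (real k * \<bar>sin ?b\<bar>))"
    by (intro mult_left_mono mult_mono abs_sin_mult_le) auto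
  also have "\<dots> = (real k)\<^sup>2 * \<bar>x - y\<bar>"
    unfolding xy by (simp add: abs_mult power2_eq_square)
  finally show ?thesis .
qed

section \<open>Cosine coefficients and their geometric decay\<close>

text \<open>The unnormalised Chebyshev coefficient. The substitution x = cos t has absorbed the
  weight 1 / sqrt (1 - x^2), so that all integrands are continuous on a compact interval.\<close>

definition cosint :: "(real \<Rightarrow> real) \<Rightarrow> nat \<Rightarrow> real" where
  "cosint f k = integral {0..pi} (\<lambda>t. f (cos t) * cos (real k * t))"

lemma abs_cosint_le:
  assumes "continuous_on {-1..1} f" "\<And>x. x \<in> {-1..1} \<Longrightarrow> \<bar>f x\<bar> \<le> B"
  shows "\<bar>cosint f k\<bar> \<le> pi * B"
proof -
  have "norm (integral {0..pi} (\<lambda>t. f (cos t) * cos (real k * t))) \<le> B * (pi - 0)"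
  proof (rule integral_bound)
    show "continuous_on {0..pi} (\<lambda>t. f (cos t) * cos (real k * t))"
      by (intro continuous_intros continuous_on_compose2[OF assms(1)]) auto
    fix t assume "t \<in> {0..pi}"
    have "\<bar>f (cos t)\<bar> * \<bar>cos (real k * t)\<bar> \<le> B * 1"
      by (intro mult_mono assms(2)) (use assms(2)[of "cos t"] in auto)
    then show "norm (f (cos t) * cos (real k * t)) \<le> B"
      by (simp add: abs_mult)
  qed auto
  then show ?thesis
    by (simp add: cosint_def mult.commute)
qed

text \<open>The boundary terms carry \<open>sin (real l * t)\<close>, which vanishes at 0 and pi, so
  \<open>g\<close> need not satisfy any boundary condition. The inner derivative - sin t combines
  with this sine into a difference of cosines, so the result is again made of values of
  \<open>cosint\<close> and the step can be repeated.\<close>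

lemma cosint_by_parts:
  assumes D: "\<And>x. x \<in> {-1..1} \<Longrightarrow> (g has_real_derivative g' x) (at x)"
    and cont: "continuous_on {-1..1} g'" and l: "0 < l"
  shows "cosint g l = (cosint g' (l - 1) - cosint g' (l + 1)) / (2 * real l)"
proof -
  have contg: "continuous_on {-1..1} g"
    by (rule DERIV_continuous_on) (blast intro: D has_field_derivative_at_within)
  have deriv: "((\<lambda>t. g (cos t) * sin (real l * t) / real l) has_real_derivative
     (g (cos t) * cos (real l * t)
      - (g' (cos t) * cos (real (l - 1) * t) - g' (cos t) * cos (real (l + 1) * t)) / (2 * real l)))
     (at t)" for t
  proof -
    have "((\<lambda>t. g (cos t) * sin (real l * t) / real l) has_real_derivative
       ((g' (cos t) * (- sin t)) * sin (real l * t) + (cos (real l * t) * real l) * g (cos t)) / real l) (at t)"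
      by (rule derivative_eq_intros DERIV_chain2[OF D] refl | use l in force)+
    moreover have "((g' (cos t) * (- sin t)) * sin (real l * t) + (cos (real l * t) * real l) * g (cos t)) / real l
      = g (cos t) * cos (real l * t)
      - (g' (cos t) * cos (real (l - 1) * t) - g' (cos t) * cos (real (l + 1) * t)) / (2 * real l)"
    proof -
      have "cos (real (l - 1) * t) - cos (real (l + 1) * t) = 2 * (sin t * sin (real l * t))"
        using sin_times_sin[of "real l * t" t] l by (simp add: of_nat_diff algebra_simps)
      then have "g' (cos t) * cos (real (l - 1) * t) - g' (cos t) * cos (real (l + 1) * t)
          = g' (cos t) * (2 * (sin t * sin (real l * t)))"
        by (simp only: flip: right_diff_distrib)
      then show ?thesis
        using l by (simp add: add_divide_distrib diff_divide_distrib)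
    qed
    ultimately show ?thesis
      by simp
  qed
  have "((\<lambda>t. g (cos t) * cos (real l * t)
      - (g' (cos t) * cos (real (l - 1) * t) - g' (cos t) * cos (real (l + 1) * t)) / (2 * real l)) has_integral
      (g (cos pi) * sin (real l * pi) / real l - g (cos 0) * sin (real l * 0) / real l)) {0..pi}"
    using deriv[THEN has_field_derivative_at_within, of _ "{0..pi}"]
    unfolding has_real_derivative_iff_has_vector_derivative
    by (intro fundamental_theorem_of_calculus) simp_all
  then have 0: "((\<lambda>t. g (cos t) * cos (real l * t)
      - (g' (cos t) * cos (real (l - 1) * t) - g' (cos t) * cos (real (l + 1) * t)) / (2 * real l)) has_integral 0) {0..pi}"
    by simp
  have int: "(\<lambda>t. h (cos t) * cos (real k * t)) integrable_on {0..pi}" if "continuous_on {-1..1} h" for h :: "real \<Rightarrow> real" and k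
    by (intro integrable_continuous_interval continuous_intros continuous_on_compose2[OF that]) auto
  have "((\<lambda>t. g (cos t) * cos (real l * t)
      - (g' (cos t) * cos (real (l - 1) * t) - g' (cos t) * cos (real (l + 1) * t)) / (2 * real l)) has_integral
      cosint g l - (cosint g' (l - 1) - cosint g' (l + 1)) / (2 * real l)) {0..pi}"
    unfolding cosint_def
    by (intro has_integral_diff has_integral_divide integrable_integral int contg cont)
  then show ?thesis
    using has_integral_unique[OF 0] by fastforce
qed

text \<open>Each integration by parts costs one derivative, gains a factor 1/l and moves the index
  by one. Starting at \<open>N + m\<close> or above, the index stays at least \<open>N\<close>
  during \<open>m\<close> steps, so each of them gains at least 1/N.\<close>

lemma cosint_decay:
  assumes D: "\<And>n x. x \<in> {-1..1} \<Longrightarrow> (D n has_real_derivative D (Suc n) x) (at x)"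
    and B: "\<And>n x. x \<in> {-1..1} \<Longrightarrow> \<bar>D n x\<bar> \<le> B n"
    and N: "0 < N" and l: "N + m \<le> l"
  shows "\<bar>cosint (D j) l\<bar> \<le> pi * B (j + m) / real N ^ m"
  using l
proof (induction m arbitrary: j l)
  have cont: "continuous_on {-1..1} (D n)" for n
    by (rule DERIV_continuous_on) (blast intro: D has_field_derivative_at_within)
  {
    case 0
    show ?case
      using abs_cosint_le[OF cont B] by simp
  next
    case (Suc m)
    let ?b = "pi * B (Suc j + m) / real N ^ m"
    have "cosint (D j) l = (cosint (D (Suc j)) (l - 1) - cosint (D (Suc j)) (l + 1)) / (2 * real l)"
      by (rule cosint_by_parts[OF D cont]) (use Suc.prems N in auto)
    moreover have "\<bar>cosint (D (Suc j)) (l - 1)\<bar> \<le> ?b" "\<bar>cosint (D (Suc j)) (l + 1)\<bar> \<le> ?b"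
      using Suc.prems by (intro Suc.IH; linarith)+
    then have "\<bar>cosint (D (Suc j)) (l - 1) - cosint (D (Suc j)) (l + 1)\<bar> \<le> ?b + ?b"
      by linarith
    ultimately have "\<bar>cosint (D j) l\<bar> \<le> (?b + ?b) / (2 * real l)"
      using divide_right_mono[of "\<bar>cosint (D (Suc j)) (l - 1) - cosint (D (Suc j)) (l + 1)\<bar>" "?b + ?b" "2 * real l"]
      by (simp only: abs_divide abs_mult abs_of_nat abs_numeral)
    also have "\<dots> = ?b / real l"
      by simp
    also have "\<dots> \<le> ?b / real N"
      using order.trans[OF abs_ge_zero B[of 0 "Suc j + m"]] Suc.prems N
      by (intro divide_left_mono) auto
    finally show ?case
      by (simp add: mult.commute)
  }
qed

text \<open>Rounding \<open>l / q\<close> down loses less than one in the exponent of 1/2, hence the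
  factor 2.\<close>

lemma half_power_div_le:
  assumes "0 < q"
  shows "(1/2) ^ (l div q) \<le> (2::real) * ((1/2) powr (1 / real q)) ^ l"
proof -
  have "real l / real q - 1 \<le> real (l div q)"
  proof -
    have "l < q * (l div q) + q"
      using assms by (metis add.commute dividend_less_times_div)
    then have "real l < real (q * (l div q) + q)"
      by (rule less_imp_of_nat_less)
    then have "real l < real q * (real (l div q) + 1)"
      by (simp add: distrib_left)
    then show ?thesis
      using assms by (simp add: field_simps)
  qed
  then have "(1/2::real) powr real (l div q) \<le> (1/2) powr (real l / real q - 1)"
    by (intro powr_mono') auto
  also have "\<dots> = 2 * (1/2) powr (real l / real q)"
    by (simp add: powr_diff)
  also have "(1/2::real) powr (real l / real q) = ((1/2) powr (1 / real q)) ^ l"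
    by (simp add: powr_power)
  finally show ?thesis
    by (simp only: powr_realpow[of "1/2" "l div q"] zero_less_divide_1_iff zero_less_numeral)
qed

text \<open>The number of integrations by parts is taken proportional to \<open>l\<close>. With m =
  l div q and N = (q - 1) m, the bound m! \<le> m^m turns K^m m! / N^m into at most (K / (q - 1))^m,
  and 2 K + 1 \<le> q makes this at most 2^(-m). The case m = 0 is separate because \<open>N\<close>
  must be positive.\<close>

lemma cosint_geometric_decay:
  assumes D: "\<And>n x. x \<in> {-1..1} \<Longrightarrow> (D n has_real_derivative D (Suc n) x) (at x)"
    and B: "\<And>n x. x \<in> {-1..1} \<Longrightarrow> \<bar>D n x\<bar> \<le> C * K ^ n * fact n"
    and q: "0 < K" "2 * K + 1 \<le> real q"
  shows "\<bar>cosint (D 0) l\<bar> \<le> 2 * pi * C * ((1/2) powr (1 / real q)) ^ l"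
proof -
  define m where "m = l div q"
  have C: "0 \<le> C"
    using order.trans[OF abs_ge_zero B[of 0 0]] by simp
  have q1: "1 < q"
    using q by auto
  have "\<bar>cosint (D 0) l\<bar> \<le> pi * C * (1/2) ^ m"
  proof (cases "m = 0")
    case True
    have "continuous_on {-1..1} (D 0)"
      by (rule DERIV_continuous_on) (blast intro: D has_field_derivative_at_within)
    from abs_cosint_le[OF this B] True show ?thesis
      by simp
  next
    case False
    have "(q - 1) * m + m \<le> l"
      using q1 by (simp add: m_def diff_mult_distrib)
    with False q1 have "\<bar>cosint (D 0) l\<bar> \<le> pi * (C * K ^ (0 + m) * fact (0 + m)) / real ((q - 1) * m) ^ m"
      by (intro cosint_decay[of D "\<lambda>n. C * K ^ n * fact n"] D B) auto
    also have "\<dots> \<le> pi * (C * K ^ m * real m ^ m) / real ((q - 1) * m) ^ m"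
      using C q fact_le_power[of m, where 'a = real] by (intro divide_right_mono mult_left_mono mult_mono) auto
    also have "\<dots> = pi * C * (K / real (q - 1)) ^ m"
      using False by (simp add: power_mult_distrib power_divide)
    also have "\<dots> \<le> pi * C * (1/2) ^ m"
      using C q q1 by (intro mult_left_mono power_mono) (auto simp: field_simps of_nat_diff)
    finally show ?thesis .
  qed
  also have "\<dots> \<le> pi * C * (2 * ((1/2) powr (1 / real q)) ^ l)"
    using C q1 unfolding m_def by (intro mult_left_mono half_power_div_le) auto
  finally show ?thesis
    by simp
qed

section \<open>Completeness of the cosines and the Chebyshev series\<close>

lemma integral_cos_mult:
  "integral {0..pi} (\<lambda>t. cos (real n * t)) = (if n = 0 then pi else 0)"
proof (cases "n = 0")
  case False
  have "((\<lambda>t. cos (real n * t)) has_integral sin (real n * pi) / real n - sin (real n * 0) / real n) {0..pi}"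
    by (rule fundamental_theorem_of_calculus)
       (use False in \<open>auto intro!: derivative_eq_intros simp flip: has_real_derivative_iff_has_vector_derivative\<close>)
  with False show ?thesis
    by (simp add: integral_unique)
qed simp

lemma cosint_cheb:
  "cosint (poly (cheb j)) k = (if j \<noteq> k then 0 else if k = 0 then pi else pi / 2)"
proof -
  define d where "d = (if j \<le> k then k - j else j - k)"
  have "cos (real j * t) * cos (real k * t) = cos (real d * t) / 2 + cos (real (j + k) * t) / 2" for t
    using cos_times_cos[of "real j * t" "real k * t"] cos_minus[of "real j * t - real k * t"]
    by (simp add: d_def of_nat_diff algebra_simps add_divide_distrib)
  then have "cosint (poly (cheb j)) k
      = integral {0..pi} (\<lambda>t. cos (real d * t) / 2 + cos (real (j + k) * t) / 2)"
    by (simp add: cosint_def poly_cheb_cos)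
  also have "\<dots> = integral {0..pi} (\<lambda>t. cos (real d * t)) / 2 + integral {0..pi} (\<lambda>t. cos (real (j + k) * t)) / 2"
    by (subst integral_add) (auto intro!: integrable_continuous_interval continuous_intros)
  finally show ?thesis
    by (auto simp: integral_cos_mult d_def simp del: of_nat_add)
qed

text \<open>Multiplication by cos t maps cosines to combinations of neighbouring cosines, so h(cos
  t) is orthogonal to every polynomial in cos t. Approximating \<open>h\<close> uniformly by
  polynomials then forces the integral of h(cos t)^2 to vanish.\<close>

lemma cosint_complete:
  assumes cont: "continuous_on {-1..1} h" and zero: "\<And>k. cosint h k = 0" and x: "x \<in> {-1..1}"
  shows "h x = 0"
proof -
  have conth: "continuous_on {0..pi} (\<lambda>t. h (cos t))"
    by (intro continuous_on_compose2[OF cont] continuous_intros) auto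
  have step: "integral {0..pi} (\<lambda>t. h (cos t) * cos t ^ j * cos (real k * t)) = 0" for j k
  proof (induction j arbitrary: k)
    case 0
    then show ?case
      using zero[of k] by (simp add: cosint_def)
  next
    case (Suc j)
    show ?case
    proof (cases "k = 0")
      case True
      with Suc.IH[of 1] show ?thesis
        by (simp add: mult_ac)
    next
      case False
      have prod: "cos t * cos (real k * t) = cos (real (k - 1) * t) / 2 + cos (real (k + 1) * t) / 2" for t
        using cos_times_cos[of "real k * t" t] False
        by (simp add: of_nat_diff algebra_simps add_divide_distrib)
      have "h (cos t) * cos t ^ Suc j * cos (real k * t) =
          h (cos t) * cos t ^ j * cos (real (k - 1) * t) / 2 + h (cos t) * cos t ^ j * cos (real (k + 1) * t) / 2" for t
      proof -
        have "h (cos t) * cos t ^ Suc j * cos (real k * t) = (h (cos t) * cos t ^ j) * (cos t * cos (real k * t))"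
          by simp
        also have "\<dots> = (h (cos t) * cos t ^ j) * (cos (real (k - 1) * t) / 2 + cos (real (k + 1) * t) / 2)"
          by (simp only: prod)
        finally show ?thesis
          by (simp only: distrib_left times_divide_eq_right)
      qed
      then have "integral {0..pi} (\<lambda>t. h (cos t) * cos t ^ Suc j * cos (real k * t)) =
          integral {0..pi} (\<lambda>t. h (cos t) * cos t ^ j * cos (real (k - 1) * t) / 2
            + h (cos t) * cos t ^ j * cos (real (k + 1) * t) / 2)"
        by simp
      also have "\<dots> = integral {0..pi} (\<lambda>t. h (cos t) * cos t ^ j * cos (real (k - 1) * t)) / 2
          + integral {0..pi} (\<lambda>t. h (cos t) * cos t ^ j * cos (real (k + 1) * t)) / 2"
        by (subst integral_add)
           (auto intro!: integrable_continuous_interval continuous_intros conth)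
      finally show ?thesis
        by (simp only: Suc.IH)
    qed
  qed
  have ortho: "integral {0..pi} (\<lambda>t. h (cos t) * g (cos t)) = 0" if g: "real_polynomial_function g" for g
  proof -
    obtain a n where "g = (\<lambda>x. \<Sum>i\<le>n. a i * x ^ i)"
      using g real_polynomial_function_imp_sum by blast
    then have "integral {0..pi} (\<lambda>t. h (cos t) * g (cos t))
        = integral {0..pi} (\<lambda>t. \<Sum>i\<le>n. a i * (h (cos t) * cos t ^ i * cos (real 0 * t)))"
      by (simp add: sum_distrib_left mult_ac)
    also have "\<dots> = (\<Sum>i\<le>n. a i * integral {0..pi} (\<lambda>t. h (cos t) * cos t ^ i * cos (real 0 * t)))"
      by (subst integral_sum)
         (auto intro!: integrable_continuous_interval continuous_intros conth)
    finally show ?thesis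
      by (simp only: step) simp
  qed
  have "compact (h ` {-1..1})"
    by (intro compact_continuous_image cont) auto
  then obtain M where M: "0 < M" "\<And>x. x \<in> {-1..1} \<Longrightarrow> \<bar>h x\<bar> \<le> M"
    using compact_imp_bounded[of "h ` {-1..1}"] by (auto simp: bounded_pos)
  have "integral {0..pi} (\<lambda>t. (h (cos t))\<^sup>2) \<le> 0 + e" if e: "0 < e" for e
  proof -
    \<comment> \<open>Chosen so that M * d * pi = e, the bound for the integral of h (h - g) over an
      interval of length pi.\<close>
    define d where "d = e / (M * pi)"
    have "0 < d"
      using e M by (simp add: d_def)
    then obtain g where g: "real_polynomial_function g" "\<And>x. x \<in> {-1..1} \<Longrightarrow> \<bar>h x - g x\<bar> < d"
      using Stone_Weierstrass_real_polynomial_function[OF _ cont] by blast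
    have contg: "continuous_on {0..pi} (\<lambda>t. g (cos t))"
    proof (rule continuous_on_compose2[of UNIV g])
      show "continuous_on UNIV g"
        using g(1) by (intro continuous_on_polymonial_function) (simp add: real_polynomial_function_eq)
    qed (auto intro: continuous_intros)
    have "integral {0..pi} (\<lambda>t. (h (cos t))\<^sup>2)
        = integral {0..pi} (\<lambda>t. h (cos t) * (h (cos t) - g (cos t)) + h (cos t) * g (cos t))"
      by (simp add: right_diff_distrib power2_eq_square)
    also have "\<dots> = integral {0..pi} (\<lambda>t. h (cos t) * (h (cos t) - g (cos t)))"
      using ortho[OF g(1)]
      by (subst integral_add) (auto intro!: integrable_continuous_interval continuous_intros conth contg)
    also have "norm \<dots> \<le> (M * d) * (pi - 0)"
    proof (rule integral_bound)
      fix t assume "t \<in> {0..pi}"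
      have "\<bar>h (cos t)\<bar> * \<bar>h (cos t) - g (cos t)\<bar> \<le> M * d"
        using M(2)[of "cos t"] g(2)[of "cos t"] by (intro mult_mono) auto
      then show "norm (h (cos t) * (h (cos t) - g (cos t))) \<le> M * d"
        by (simp add: abs_mult)
    qed (auto intro!: continuous_intros conth contg)
    also have "(M * d) * (pi - 0) = e"
      using M by (simp add: d_def)
    finally show ?thesis
      by simp
  qed
  then have "integral {0..pi} (\<lambda>t. (h (cos t))\<^sup>2) \<le> 0"
    by (rule field_le_epsilon)
  moreover have "0 \<le> integral {0..pi} (\<lambda>t. (h (cos t))\<^sup>2)"
    by (intro integral_nonneg integrable_continuous_interval continuous_intros conth) auto
  ultimately have "\<forall>t\<in>{0..pi}. (h (cos t))\<^sup>2 = 0"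
    by (subst integral_eq_0_iff[symmetric]) (auto intro!: continuous_intros conth)
  then have "(h (cos (arccos x)))\<^sup>2 = 0"
    using x arccos_bounded[of x] by (metis atLeastAtMost_iff)
  then show ?thesis
    using x by simp
qed

definition cheb_coeff :: "(real \<Rightarrow> real) \<Rightarrow> nat \<Rightarrow> real" where
  "cheb_coeff f k = (if k = 0 then 1 else 2) / pi * cosint f k"

text \<open>Absolute summability makes the series converge uniformly to some continuous
  \<open>S\<close>, but says nothing about its limit being \<open>f\<close>. By orthogonality
  \<open>S\<close> has the same coefficients as \<open>f\<close>, and \<open>cosint_complete\<close>
  applied to f - S identifies the two.\<close>

lemma cheb_expansion:
  assumes cont: "continuous_on {-1..1} f" and sum: "summable (\<lambda>k. \<bar>cheb_coeff f k\<bar>)"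
    and x: "x \<in> {-1..1}"
  shows "(\<lambda>k. cheb_coeff f k * poly (cheb k) x) sums f x"
proof -
  define S where "S x = (\<Sum>k. cheb_coeff f k * poly (cheb k) x)" for x
  define P where "P n x = (\<Sum>k<n. cheb_coeff f k * poly (cheb k) x)" for n x
  have le: "norm (cheb_coeff f k * poly (cheb k) x) \<le> \<bar>cheb_coeff f k\<bar>" if "x \<in> {-1..1}" for k x
    using mult_left_mono[OF abs_cheb_le_1[OF that, of k], of "\<bar>cheb_coeff f k\<bar>"] by (simp add: abs_mult)
  have ul: "uniform_limit {-1..1} P S sequentially"
    unfolding P_def S_def by (rule Weierstrass_m_test[OF le sum])
  have contP: "continuous_on A (P n)" for A n
    unfolding P_def by (intro continuous_intros)
  have contS: "continuous_on {-1..1} S"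
    by (rule uniform_limit_theorem[OF _ ul]) (simp_all add: contP)
  have "cosint S k = cosint f k" for k
  proof -
    have "uniform_limit {0..pi} (\<lambda>n t. P n (cos t)) (\<lambda>t. S (cos t)) sequentially"
      using uniform_limit_compose'[OF ul, of cos "{0..pi}"] by auto
    then have "uniform_limit {0..pi} (\<lambda>n t. P n (cos t) * cos (real k * t)) (\<lambda>t. S (cos t) * cos (real k * t)) sequentially"
    proof (rule uniform_lim_mult)
      show "uniform_limit {0..pi} (\<lambda>n t. cos (real k * t)) (\<lambda>t. cos (real k * t)) sequentially"
        by (rule uniform_limit_const)
      have "continuous_on {0..pi} (\<lambda>t. S (cos t))"
        by (intro continuous_on_compose2[OF contS] continuous_intros) auto
      then show "bounded ((\<lambda>t. S (cos t)) ` {0..pi})"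
        by (intro compact_imp_bounded compact_continuous_image) auto
      show "bounded ((\<lambda>t. cos (real k * t)) ` {0..pi})"
        by (intro boundedI[of _ 1]) auto
    qed
    then obtain I J where IJ: "\<And>n. ((\<lambda>t. P n (cos t) * cos (real k * t)) has_integral I n) {0..pi}"
        "((\<lambda>t. S (cos t) * cos (real k * t)) has_integral J) {0..pi}" "I \<longlonglongrightarrow> J"
      by (rule uniform_limit_integral) (auto intro!: continuous_intros continuous_on_compose2[OF contP[of UNIV]])
    have "I n = cosint f k" if "k < n" for n
    proof -
      have "I n = integral {0..pi} (\<lambda>t. \<Sum>j<n. cheb_coeff f j * (poly (cheb j) (cos t) * cos (real k * t)))"
        unfolding integral_unique[OF IJ(1), symmetric] P_def by (simp add: sum_distrib_right mult.assoc)
      also have "\<dots> = (\<Sum>j<n. cheb_coeff f j * cosint (poly (cheb j)) k)"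
        unfolding cosint_def
        by (subst integral_sum) (auto intro!: integrable_continuous_interval continuous_intros)
      also have "\<dots> = (\<Sum>j<n. if j = k then cosint f k else 0)"
        by (intro sum.cong) (auto simp: cosint_cheb cheb_coeff_def)
      finally show ?thesis
        using that by simp
    qed
    then have "I \<longlonglongrightarrow> cosint f k"
      by (intro tendsto_eventually) (auto simp: eventually_sequentially intro!: exI[of _ "Suc k"])
    then show ?thesis
      using IJ(2,3) LIMSEQ_unique unfolding cosint_def by (metis integral_unique)
  qed
  moreover have "cosint (\<lambda>x. f x - S x) k = cosint f k - cosint S k" for k
    unfolding cosint_def left_diff_distrib
    by (intro integral_diff integrable_continuous_interval continuous_intros
         continuous_on_compose2[OF cont] continuous_on_compose2[OF contS]) auto
  ultimately have "f x - S x = 0"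
    by (intro cosint_complete[where h = "\<lambda>x. f x - S x", OF _ _ x]) (auto intro!: continuous_intros cont contS)
  moreover have "summable (\<lambda>k. cheb_coeff f k * poly (cheb k) x)"
    by (rule summable_comparison_test'[OF sum]) (use le[OF x] in auto)
  ultimately show ?thesis
    unfolding S_def using summable_sums by fastforce
qed

section \<open>Real analyticity on the closed interval\<close>

lemma real_analytic_on_imp_continuous_on:
  assumes "real_analytic_on f {-1..1}"
  shows "continuous_on {-1..1} f"
  unfolding continuous_on_eq_continuous_within
proof
  fix x0 :: real assume x0: "x0 \<in> {-1..1}"
  with assms obtain r a where r: "0 < r"
    and sums: "\<And>x. x \<in> {-1..1} \<Longrightarrow> \<bar>x - x0\<bar> < r \<Longrightarrow> (\<lambda>n. a n * (x - x0) ^ n) sums f x"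
    unfolding real_analytic_on_def by metis
  \<comment> \<open>A displacement towards the interior, so that x0 + d stays in the interval even
    when \<open>x0\<close> is an end point. Convergence at this one point gives the power series a
    positive radius and thereby two-sided continuity at \<open>x0\<close>.\<close>
  define d where "d = (if x0 \<le> 0 then min (r/2) 1 else - min (r/2) 1)"
  have d: "x0 + d \<in> {-1..1}" "\<bar>d\<bar> < r" "0 < \<bar>d\<bar>"
    using r x0 by (auto simp: d_def)
  have "summable (\<lambda>n. a n * d ^ n)"
    using sums[of "x0 + d"] d by (auto simp: sums_iff)
  then have "isCont (\<lambda>x. \<Sum>n. a n * (x - x0) ^ n) x0"
    by (rule isCont_powser'[rotated]) (use d in \<open>auto intro: continuous_intros\<close>)
  then have "continuous (at x0 within {-1..1}) (\<lambda>x. \<Sum>n. a n * (x - x0) ^ n)"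
    by (rule continuous_at_imp_continuous_at_within)
  then show "continuous (at x0 within {-1..1}) f"
  proof (rule continuous_transform_within[OF _ r x0])
    fix x assume "x \<in> {-1..1}" "dist x x0 < r"
    then show "(\<Sum>n. a n * (x - x0) ^ n) = f x"
      using sums[of x] by (simp add: sums_iff dist_real_def)
  qed
qed

text \<open>The second conclusion has the shape of the assumption, with \<open>deriv g\<close> and
  \<open>diffs c\<close> in place of \<open>g\<close> and \<open>c\<close>, so the lemma can be
  iterated.\<close>

lemma powser_has_deriv:
  fixes g :: "real \<Rightarrow> real"
  assumes sums: "\<And>x. \<bar>x - x0\<bar> < r \<Longrightarrow> (\<lambda>n. c n * (x - x0) ^ n) sums g x" and x: "\<bar>x - x0\<bar> < r"
  shows "(g has_real_derivative deriv g x) (at x)" "(\<lambda>n. diffs c n * (x - x0) ^ n) sums deriv g x"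
proof -
  have sm: "summable (\<lambda>n. c n * z ^ n)" if "norm z < r" for z
    using sums[of "x0 + z"] that by (auto simp: sums_iff)
  have "((\<lambda>z. \<Sum>n. c n * z ^ n) has_field_derivative (\<Sum>n. diffs c n * (x - x0) ^ n)) (at (x - x0))"
    by (rule termdiffs_strong'[OF sm]) (use x in auto)
  then have "((\<lambda>y. \<Sum>n. c n * (y - x0) ^ n) has_field_derivative (\<Sum>n. diffs c n * (x - x0) ^ n)) (at x)"
    using DERIV_shift[of "\<lambda>z. \<Sum>n. c n * z ^ n" _ x "- x0"] by simp
  then have D: "(g has_real_derivative (\<Sum>n. diffs c n * (x - x0) ^ n)) (at x)"
    by (rule has_field_derivative_transform_within_open[of _ _ _ "ball x0 r"])
       (use x sums in \<open>auto simp: sums_iff dist_real_def abs_minus_commute\<close>)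
  then show "(g has_real_derivative deriv g x) (at x)"
    using DERIV_imp_deriv by metis
  have "summable (\<lambda>n. diffs c n * (x - x0) ^ n)"
    by (rule termdiff_converges[OF _ sm]) (use x in auto)
  then show "(\<lambda>n. diffs c n * (x - x0) ^ n) sums deriv g x"
    using DERIV_imp_deriv[OF D] by (simp add: summable_sums)
qed

lemma real_analytic_on_deriv_iterate:
  assumes "real_analytic_on f {-1..1}" and x: "x \<in> {-1<..<1}"
  shows "((deriv ^^ n) f has_real_derivative (deriv ^^ Suc n) f x) (at x)"
proof -
  from assms obtain r a where r: "0 < r"
    and sums: "\<And>y. y \<in> {-1..1} \<Longrightarrow> \<bar>y - x\<bar> < r \<Longrightarrow> (\<lambda>n. a n * (y - x) ^ n) sums f y"
    unfolding real_analytic_on_def by (metis atLeastAtMost_iff greaterThanLessThan_iff less_imp_le)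
  \<comment> \<open>Small enough for the expansion to hold on a full two-sided neighbourhood of
    \<open>x\<close> inside the interval, where \<open>deriv\<close> sees only values of
    \<open>f\<close> that the hypothesis controls.\<close>
  define s where "s = min r (min (1 - x) (1 + x))"
  have s: "0 < s"
    using r x by (auto simp: s_def)
  have "(\<lambda>k. (diffs ^^ n) a k * (y - x) ^ k) sums (deriv ^^ n) f y" if "\<bar>y - x\<bar> < s" for y
    using that
  proof (induction n arbitrary: y)
    case 0
    then show ?case
      using sums[of y] by (simp add: s_def) linarith
  next
    case (Suc n)
    show ?case
      using powser_has_deriv(2)[OF Suc.IH Suc.prems] by simp
  qed
  from powser_has_deriv(1)[of x s, OF this] s show ?thesis
    by simp
qed

text \<open>For continuous \<open>g\<close> the set where the bound fails is open, and a null open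
  set is empty.\<close>

lemma Linf_norm_le_imp_abs_le:
  assumes cont: "continuous_on {-1<..<1} g" and "Linf_norm g \<le> ereal B" and x: "x \<in> {-1<..<1}"
  shows "\<bar>g x\<bar> \<le> B"
proof (rule ccontr)
  assume "\<not> \<bar>g x\<bar> \<le> B"
  define U where "U = {-1<..<1} \<inter> (\<lambda>x. \<bar>g x\<bar>) -` {B<..}"
  have "open U"
    unfolding U_def by (intro continuous_open_preimage continuous_on_rabs cont) auto
  have "AE y in leb_I. ereal \<bar>g y\<bar> \<le> Linf_norm g"
    unfolding Linf_norm_def by (rule esssup_AE)
  then have "AE y in leb_I. \<bar>g y\<bar> \<le> B"
    by eventually_elim (use assms(2) in \<open>auto dest: order_trans\<close>)
  then have "AE y in lebesgue. y \<in> {-1<..<1} \<longrightarrow> \<bar>g y\<bar> \<le> B"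
    by (subst (asm) AE_restrict_space_iff) auto
  then have "AE y in lebesgue. y \<notin> U"
    by eventually_elim (auto simp: U_def)
  then have "negligible U"
    by (simp add: negligible_iff_null_sets AE_iff_null_sets \<open>open U\<close> lborelD)
  then show False
    using open_not_negligible[OF \<open>open U\<close>] \<open>\<not> \<bar>g x\<bar> \<le> B\<close> x unfolding U_def
    by (metis IntI empty_iff greaterThan_iff not_le vimageI2)
qed

text \<open>Iterated derivatives of \<open>f\<close> are meaningless at the end points, so integration by parts is only
  applied to \<open>f (s x)\<close> with \<open>s < 1\<close>; this lemma passes to the limit.\<close>

lemma cosint_scaled_tendsto:
  assumes cont: "continuous_on {-1..1} f"
  shows "(\<lambda>n. cosint (\<lambda>x. f (real n / real (Suc n) * x)) k) \<longlonglongrightarrow> cosint f k"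
proof -
  have in1: "real n / real (Suc n) * cos t \<in> {-1..1}" for n t
  proof -
    have "\<bar>real n / real (Suc n)\<bar> * \<bar>cos t\<bar> \<le> 1 * 1"
      by (intro mult_mono) (auto simp: field_simps)
    then show ?thesis
      by (simp only: atLeastAtMost_iff abs_le_iff flip: abs_mult) simp
  qed
  obtain M where "\<forall>x\<in>{-1..1}. \<bar>f x\<bar> \<le> M"
    using compact_imp_bounded[OF compact_continuous_image[OF cont compact_Icc]] by (auto simp: bounded_iff)
  then have M: "\<bar>f x\<bar> \<le> M" if "x \<in> {-1..1}" for x
    using that by blast
  show ?thesis
    unfolding cosint_def
  proof (rule dominated_convergence(2))
    show "(\<lambda>t. f (real n / real (Suc n) * cos t) * cos (real k * t)) integrable_on {0..pi}" for n
      by (intro integrable_continuous_interval continuous_intros continuous_on_compose2[OF cont])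
         (use in1[of n] in auto)
    show "(\<lambda>t::real. M) integrable_on {0..pi}"
      by auto
    show "norm (f (real n / real (Suc n) * cos t) * cos (real k * t)) \<le> M" for n t
      using mult_mono[OF M[OF in1[of n t]] abs_cos_le_one[of "real k * t"]]
      by (simp add: abs_mult order.trans[OF abs_ge_zero M[OF in1[of n t]]])
    have lim: "(\<lambda>n. real n / real (Suc n) * cos t) \<longlonglongrightarrow> 1 * cos t" for t
      by (intro tendsto_intros LIMSEQ_n_over_Suc_n)
    show "(\<lambda>n. f (real n / real (Suc n) * cos t) * cos (real k * t)) \<longlonglongrightarrow> f (cos t) * cos (real k * t)" for t
      using continuous_on_tendsto_compose[OF cont lim[of t]] in1[of _ t]
      by (intro tendsto_intros) simp
  qed
qed

text \<open>For s < 1 the dilated function f(s x) is smooth on a neighbourhood of each point of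
  [-1,1], and the chain rule factors s^n only improve the derivative bounds. The estimate is
  therefore uniform in \<open>s\<close> and survives the limit s = n / (n + 1) tending to 1.\<close>

lemma analytic_cosint_decay:
  assumes an: "real_analytic_on f {-1..1}" and K: "0 < K" and C: "0 < C"
    and bound: "\<And>n. Linf_norm ((deriv ^^ n) f) \<le> ereal (C * K ^ n * fact n)"
    and q: "2 * K + 1 \<le> real q"
  shows "\<bar>cosint f l\<bar> \<le> 2 * pi * C * ((1/2) powr (1 / real q)) ^ l"
proof (rule LIMSEQ_le_const2)
  note D = real_analytic_on_deriv_iterate[OF an]
  show "(\<lambda>n. \<bar>cosint (\<lambda>x. f (real n / real (Suc n) * x)) l\<bar>) \<longlonglongrightarrow> \<bar>cosint f l\<bar>"
    by (intro tendsto_rabs cosint_scaled_tendsto real_analytic_on_imp_continuous_on an)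
  have B: "\<bar>(deriv ^^ n) f x\<bar> \<le> C * K ^ n * fact n" if "x \<in> {-1<..<1}" for n x
    using that D by (intro Linf_norm_le_imp_abs_le bound DERIV_continuous_on)
      (auto intro: has_field_derivative_at_within)
  have scaled: "\<bar>cosint (\<lambda>x. f (s * x)) l\<bar> \<le> 2 * pi * C * ((1/2) powr (1 / real q)) ^ l"
    if s: "0 \<le> s" "s < 1" for s
  proof -
    define E where "E n x = s ^ n * (deriv ^^ n) f (s * x)" for n x
    have sx: "s * x \<in> {-1<..<1}" if "x \<in> {-1..1}" for x
    proof -
      have "\<bar>s\<bar> * \<bar>x\<bar> \<le> s * 1"
        using s that by (intro mult_mono) auto
      with s have "\<bar>s * x\<bar> < 1"
        by (simp add: abs_mult)
      then show ?thesis
        by auto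
    qed
    have "\<bar>cosint (E 0) l\<bar> \<le> 2 * pi * C * ((1/2) powr (1 / real q)) ^ l"
    proof (rule cosint_geometric_decay[OF _ _ K q])
      fix n x assume x: "x \<in> {-1..1::real}"
      have "((deriv ^^ n) f has_real_derivative (deriv ^^ Suc n) f (s * x)) (at (s * x))"
        by (rule D[OF sx[OF x]])
      moreover have "((\<lambda>x. s * x) has_real_derivative s) (at x)"
        by (auto intro!: derivative_eq_intros)
      ultimately have "((\<lambda>x. (deriv ^^ n) f (s * x)) has_real_derivative (deriv ^^ Suc n) f (s * x) * s) (at x)"
        by (rule DERIV_chain2)
      from DERIV_cmult[OF this, of "s ^ n"]
      show "(E n has_real_derivative E (Suc n) x) (at x)"
        unfolding E_def by (simp add: mult_ac)
      have "\<bar>s ^ n\<bar> * \<bar>(deriv ^^ n) f (s * x)\<bar> \<le> 1 * (C * K ^ n * fact n)"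
        using s by (intro mult_mono B sx x) (auto simp: power_le_one)
      then show "\<bar>E n x\<bar> \<le> C * K ^ n * fact n"
        by (simp add: E_def abs_mult)
    qed
    moreover have "E 0 = (\<lambda>x. f (s * x))"
      by (simp add: E_def fun_eq_iff)
    ultimately show ?thesis
      by simp
  qed
  have "\<bar>cosint (\<lambda>x. f (real n / real (Suc n) * x)) l\<bar> \<le> 2 * pi * C * ((1/2) powr (1 / real q)) ^ l" for n
    by (rule scaled) simp_all
  then show "\<exists>N. \<forall>n\<ge>N. \<bar>cosint (\<lambda>x. f (real n / real (Suc n) * x)) l\<bar>
      \<le> 2 * pi * C * ((1/2) powr (1 / real q)) ^ l"
    by blast
qed

section \<open>Convergence rate of the Chebyshev partial sums\<close>

lemma square_mult_power_bounded:
  fixes \<tau> :: real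
  assumes "0 \<le> \<tau>" "\<tau> < 1"
  obtains M where "0 < M" "\<And>k. (real k)\<^sup>2 * \<tau> ^ k \<le> M"
proof -
  have "norm (sqrt \<tau>) < 1"
    using assms by simp
  from powser_times_n_limit_0[OF this] have "Bseq (\<lambda>k. real k * sqrt \<tau> ^ k)"
    by (intro convergent_imp_Bseq) (auto simp: convergent_def)
  then obtain M where M: "0 < M" "\<And>k. norm (real k * sqrt \<tau> ^ k) \<le> M"
    by (auto simp: Bseq_def)
  show ?thesis
  proof (rule that)
    show "0 < M\<^sup>2"
      using M by simp
    fix k
    have "(real k)\<^sup>2 * \<tau> ^ k = (norm (real k * sqrt \<tau> ^ k))\<^sup>2"
      using assms by (simp add: power_mult_distrib power2_eq_square flip: real_sqrt_power)
    also have "\<dots> \<le> M\<^sup>2"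
      by (intro power_mono M) auto
    finally show "(real k)\<^sup>2 * \<tau> ^ k \<le> M\<^sup>2" .
  qed
qed

lemma geometric_tail_le:
  fixes b :: "nat \<Rightarrow> real"
  assumes sums: "b sums s" and le: "\<And>k. \<bar>b k\<bar> \<le> B * \<tau> ^ k" and \<tau>: "0 < \<tau>" "\<tau> < 1"
  shows "\<bar>s - (\<Sum>k\<le>p. b k)\<bar> \<le> B / (1 - \<tau>) * \<tau> ^ p"
proof -
  have B: "0 \<le> B"
    using order.trans[OF abs_ge_zero le[of 0]] by simp
  have "(\<lambda>k. b (k + Suc p)) sums (s - (\<Sum>k<Suc p. b k))"
    using sums by (rule sums_split_initial_segment)
  then have eq: "s - (\<Sum>k\<le>p. b k) = (\<Sum>k. b (k + Suc p))"
    by (simp add: sums_iff lessThan_Suc_atMost)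
  have g: "(\<lambda>k. B * \<tau> ^ Suc p * \<tau> ^ k) sums (B * \<tau> ^ Suc p * (1 / (1 - \<tau>)))"
    using \<tau> by (intro sums_mult geometric_sums) auto
  have "norm (b (k + Suc p)) \<le> B * \<tau> ^ Suc p * \<tau> ^ k" for k
    using le[of "k + Suc p"] by (simp add: power_add mult_ac)
  then have "norm (\<Sum>k. b (k + Suc p)) \<le> (\<Sum>k. B * \<tau> ^ Suc p * \<tau> ^ k)"
    by (rule norm_suminf_le) (use g in \<open>simp add: sums_iff\<close>)
  also have "\<dots> = B / (1 - \<tau>) * \<tau> ^ p * \<tau>"
    using g by (simp add: sums_iff mult_ac)
  also have "\<dots> \<le> B / (1 - \<tau>) * \<tau> ^ p * 1"
    using B \<tau> by (intro mult_left_mono) auto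
  finally show ?thesis
    unfolding eq by simp
qed

text \<open>The coefficients decay like \<rho>^k, and \<rho> = \<tau>^2. One factor \<tau>^k is kept
  as the rate, the other absorbs the k^2 from \<open>cheb_lipschitz\<close>. Thus the same
  \<open>A\<close> and \<beta> = - ln \<tau> serve the coefficients, the sup norm and the Lipschitz
  seminorm.\<close>

lemma analytic_cheb_approx:
  assumes an: "real_analytic_on f {-1..1}" and K: "0 < K" and C: "0 < C"
    and bound: "\<And>n. Linf_norm ((deriv ^^ n) f) \<le> ereal (C * K ^ n * fact n)"
  obtains A \<beta> where "0 < A" "0 < \<beta>" "\<And>k. \<bar>cheb_coeff f k\<bar> \<le> A"
    "\<And>p x. x \<in> {-1..1} \<Longrightarrow>
       \<bar>f x - (\<Sum>k\<le>p. cheb_coeff f k * poly (cheb k) x)\<bar> \<le> A * exp (- \<beta> * real p)"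
    "\<And>p x y. x \<in> {-1..1} \<Longrightarrow> y \<in> {-1..1} \<Longrightarrow>
       \<bar>(f x - (\<Sum>k\<le>p. cheb_coeff f k * poly (cheb k) x)) -
        (f y - (\<Sum>k\<le>p. cheb_coeff f k * poly (cheb k) y))\<bar> \<le> A * exp (- \<beta> * real p) * \<bar>x - y\<bar>"
proof -
  define q where "q = nat \<lceil>2 * K + 1\<rceil>"
  have q: "2 * K + 1 \<le> real q" "0 < q"
    using K unfolding q_def by linarith+
  define \<rho> \<tau> where "\<rho> = (1/2::real) powr (1 / real q)" and "\<tau> = sqrt \<rho>"
  have \<rho>: "0 < \<rho>" "\<rho> < 1"
    using q powr_less_mono'[of "1/2::real" 0 "1 / real q"] by (auto simp: \<rho>_def)
  then have \<tau>: "0 < \<tau>" "\<tau> < 1"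
    by (auto simp: \<tau>_def)
  let ?a = "cheb_coeff f"
  have a: "\<bar>?a k\<bar> \<le> 4 * C * \<rho> ^ k" for k
  proof -
    have "\<bar>?a k\<bar> \<le> 2 / pi * \<bar>cosint f k\<bar>"
      by (auto simp: cheb_coeff_def abs_mult intro!: divide_right_mono)
    also have "\<dots> \<le> 2 / pi * (2 * pi * C * \<rho> ^ k)"
      unfolding \<rho>_def by (intro mult_left_mono analytic_cosint_decay[OF an K C bound q(1)]) auto
    finally show ?thesis
      by simp
  qed
  obtain M where M: "0 < M" "\<And>k. (real k)\<^sup>2 * \<tau> ^ k \<le> M"
    using square_mult_power_bounded[of \<tau>] \<tau> by auto
  have a\<tau>: "\<bar>?a k\<bar> \<le> 4 * C * \<tau> ^ k" and ak: "\<bar>?a k\<bar> * (real k)\<^sup>2 \<le> 4 * C * M * \<tau> ^ k" for k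
  proof -
    have pw: "\<rho> ^ k = \<tau> ^ k * \<tau> ^ k"
      using \<rho> by (simp add: \<tau>_def flip: power_mult_distrib)
    have "\<tau> ^ k * \<tau> ^ k \<le> \<tau> ^ k * 1"
      using \<tau> by (intro mult_left_mono) (auto simp: power_le_one)
    then have "4 * C * \<rho> ^ k \<le> 4 * C * \<tau> ^ k"
      using C by (simp add: pw)
    with a[of k] show "\<bar>?a k\<bar> \<le> 4 * C * \<tau> ^ k"
      by linarith
    have "\<bar>?a k\<bar> * (real k)\<^sup>2 \<le> 4 * C * \<rho> ^ k * (real k)\<^sup>2"
      by (intro mult_right_mono a) auto
    also have "\<dots> = 4 * C * \<tau> ^ k * ((real k)\<^sup>2 * \<tau> ^ k)"
      by (simp add: pw)
    also have "\<dots> \<le> 4 * C * \<tau> ^ k * M"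
      using C \<tau> by (intro mult_left_mono M) auto
    finally show "\<bar>?a k\<bar> * (real k)\<^sup>2 \<le> 4 * C * M * \<tau> ^ k"
      by (simp add: mult_ac)
  qed
  have "summable (\<lambda>k. \<bar>?a k\<bar>)"
    by (rule summable_comparison_test'[of "\<lambda>k. 4 * C * \<tau> ^ k" 0])
       (use \<tau> a\<tau> in \<open>auto intro!: summable_mult summable_geometric\<close>)
  then have sums: "(\<lambda>k. ?a k * poly (cheb k) x) sums f x" if "x \<in> {-1..1}" for x
    using cheb_expansion real_analytic_on_imp_continuous_on an that by blast
  define A where "A = 4 * C * (1 + M) / (1 - \<tau>)"
  have A: "4 * C / (1 - \<tau>) \<le> A" "4 * C * M / (1 - \<tau>) \<le> A"
    unfolding A_def by (rule divide_right_mono; use C M \<tau> in \<open>simp add: algebra_simps\<close>)+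
  have exp: "exp (- (- ln \<tau>) * real p) = \<tau> ^ p" for p
    using \<tau> exp_of_nat_mult[of p "ln \<tau>"] by (simp add: mult.commute)
  show ?thesis
  proof (rule that[of A "- ln \<tau>"])
    show "0 < A" "0 < - ln \<tau>"
      using C M \<tau> by (auto simp: A_def)
    show "\<bar>?a k\<bar> \<le> A" for k
    proof -
      have "\<tau> ^ k * (1 - \<tau>) \<le> 1 * 1"
        using \<tau> by (intro mult_mono) (auto simp: power_le_one)
      then have "4 * C * (\<tau> ^ k * (1 - \<tau>)) \<le> 4 * C * 1"
        using C by (intro mult_left_mono) auto
      then have "4 * C * \<tau> ^ k \<le> 4 * C / (1 - \<tau>)"
        using \<tau> by (simp add: pos_le_divide_eq mult.assoc)
      then show ?thesis
        using a\<tau>[of k] A(1) by linarith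
    qed
    show "\<bar>f x - (\<Sum>k\<le>p. ?a k * poly (cheb k) x)\<bar> \<le> A * exp (- (- ln \<tau>) * real p)" if x: "x \<in> {-1..1}" for p x
    proof -
      have "\<bar>?a k * poly (cheb k) x\<bar> \<le> 4 * C * \<tau> ^ k" for k
        using mult_mono[OF a\<tau>[of k] abs_cheb_le_1[OF x, of k]] C \<tau> by (simp add: abs_mult)
      from geometric_tail_le[OF sums[OF x] this \<tau>, of p] show ?thesis
        using mult_right_mono[OF A(1), of "\<tau> ^ p"] \<tau> unfolding exp by simp
    qed
    show "\<bar>(f x - (\<Sum>k\<le>p. ?a k * poly (cheb k) x)) - (f y - (\<Sum>k\<le>p. ?a k * poly (cheb k) y))\<bar>
        \<le> A * exp (- (- ln \<tau>) * real p) * \<bar>x - y\<bar>" if x: "x \<in> {-1..1}" and y: "y \<in> {-1..1}" for p x y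
    proof -
      have "\<bar>?a k * poly (cheb k) x - ?a k * poly (cheb k) y\<bar> \<le> 4 * C * M * \<bar>x - y\<bar> * \<tau> ^ k" for k
      proof -
        have "\<bar>?a k * poly (cheb k) x - ?a k * poly (cheb k) y\<bar> = \<bar>?a k\<bar> * \<bar>poly (cheb k) x - poly (cheb k) y\<bar>"
          by (simp add: abs_mult flip: right_diff_distrib)
        also have "\<dots> \<le> \<bar>?a k\<bar> * ((real k)\<^sup>2 * \<bar>x - y\<bar>)"
          by (intro mult_left_mono cheb_lipschitz x y) auto
        also have "\<dots> \<le> 4 * C * M * \<tau> ^ k * \<bar>x - y\<bar>"
          using mult_right_mono[OF ak[of k], of "\<bar>x - y\<bar>"] by (simp add: mult_ac)
        finally show ?thesis
          by (simp add: mult_ac)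
      qed
      from geometric_tail_le[OF sums_diff[OF sums[OF x] sums[OF y]] this \<tau>, of p]
      have "\<bar>(f x - (\<Sum>k\<le>p. ?a k * poly (cheb k) x)) - (f y - (\<Sum>k\<le>p. ?a k * poly (cheb k) y))\<bar>
          \<le> 4 * C * M / (1 - \<tau>) * (\<tau> ^ p * \<bar>x - y\<bar>)"
        by (simp add: sum_subtractf algebra_simps)
      also have "\<dots> \<le> A * (\<tau> ^ p * \<bar>x - y\<bar>)"
        using A(2) \<tau> by (intro mult_right_mono) auto
      finally show ?thesis
        unfolding exp by (simp add: mult.assoc)
    qed
  qed
qed

section \<open>Particular solutions\<close>

text \<open>Both g - f and g + f are nondecreasing. This comparison replaces estimates of
  convolution integrals: it suffices to know an explicit antiderivative \<open>g\<close> of the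
  majorant and its initial value.\<close>

lemma abs_le_by_deriv:
  fixes f g :: "real \<Rightarrow> real"
  assumes "a \<le> b" and f: "\<And>t. t \<in> {a..b} \<Longrightarrow> (f has_real_derivative f' t) (at t)"
    and g: "\<And>t. t \<in> {a..b} \<Longrightarrow> (g has_real_derivative g' t) (at t)"
    and le: "\<And>t. t \<in> {a..b} \<Longrightarrow> \<bar>f' t\<bar> \<le> g' t" and init: "\<bar>f a\<bar> \<le> g a"
  shows "\<bar>f b\<bar> \<le> g b"
proof -
  have "g a - f a \<le> g b - f b"
  proof (rule DERIV_nonneg_imp_nondecreasing[OF \<open>a \<le> b\<close>])
    fix t assume "a \<le> t" "t \<le> b"
    then show "\<exists>y. ((\<lambda>x. g x - f x) has_real_derivative y) (at t) \<and> 0 \<le> y"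
      using f g le[of t] by (intro exI[of _ "g' t - f' t"]) (auto intro!: derivative_eq_intros)
  qed
  moreover have "g a + f a \<le> g b + f b"
  proof (rule DERIV_nonneg_imp_nondecreasing[OF \<open>a \<le> b\<close>])
    fix t assume "a \<le> t" "t \<le> b"
    then show "\<exists>y. ((\<lambda>x. g x + f x) has_real_derivative y) (at t) \<and> 0 \<le> y"
      using f g le[of t] by (intro exI[of _ "g' t + f' t"]) (auto intro!: derivative_eq_intros)
  qed
  ultimately show ?thesis
    using init by linarith
qed

text \<open>\<open>A\<close> is the left half of the convolution with \<open>exp (- \<bar>t\<bar> / \<epsilon>)\<close>, i.e. the integral of
  \<open>exp ((t - x) / \<epsilon>) * r t\<close> over \<open>t \<le> x\<close>, where \<open>r\<close> is continued by \<open>r (-1)\<close> to the left of \<open>-1\<close>.\<close>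

lemma first_order_layer_solution:
  fixes r :: "real \<Rightarrow> real"
  assumes cont: "continuous_on UNIV r" and \<epsilon>: "0 < \<epsilon>"
    and bd: "\<And>x. x \<in> {-1..1} \<Longrightarrow> \<bar>r x\<bar> \<le> \<delta>"
    and lip: "\<And>x y. x \<in> {-1..1} \<Longrightarrow> y \<in> {-1..1} \<Longrightarrow> \<bar>r x - r y\<bar> \<le> \<delta> * \<bar>x - y\<bar>"
  obtains A where "\<And>x. (A has_real_derivative r x - A x / \<epsilon>) (at x)"
    "\<And>x. x \<in> {-1..1} \<Longrightarrow> \<bar>A x\<bar> \<le> \<epsilon> * \<delta>"
    "\<And>x. x \<in> {-1..1} \<Longrightarrow> \<bar>A x - \<epsilon> * r x\<bar> \<le> \<epsilon>\<^sup>2 * \<delta>"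
proof -
  have \<delta>: "0 \<le> \<delta>"
    using order.trans[OF abs_ge_zero bd[of 0]] by simp
  have "\<exists>G. \<forall>x. -\<infinity> < ereal x \<longrightarrow> ereal x < \<infinity> \<longrightarrow> (G has_vector_derivative exp (x / \<epsilon>) * r x) (at x)"
    using cont \<epsilon> by (intro einterval_antiderivative) (auto intro!: continuous_intros simp: continuous_on_eq_continuous_at)
  then obtain G where G: "\<And>x. (G has_real_derivative exp (x / \<epsilon>) * r x) (at x)"
    by (auto simp: has_real_derivative_iff_has_vector_derivative)
  \<comment> \<open>The constant added to G x - G (-1) is the integral of
    \<open>exp (t / \<epsilon>) * r (-1)\<close> over t \<le> -1. With this initial value the
    majorants below already hold at -1.\<close>
  define F where "F x = G x - G (-1) + \<epsilon> * exp (-1 / \<epsilon>) * r (-1)" for x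
  define A where "A x = exp (- (x / \<epsilon>)) * F x" for x
  have F: "(F has_real_derivative exp (x / \<epsilon>) * r x) (at x)" for x
    unfolding F_def by (auto intro!: derivative_eq_intros G)
  have eF: "F x = exp (x / \<epsilon>) * A x" for x
    by (simp add: A_def flip: exp_add mult.assoc)
  show ?thesis
  proof (rule that)
    show "(A has_real_derivative r x - A x / \<epsilon>) (at x)" for x
      unfolding A_def using \<epsilon>
      by (auto intro!: derivative_eq_intros F simp: field_simps simp flip: exp_add)
  next
    fix x :: real assume x: "x \<in> {-1..1}"
    have "\<bar>F x\<bar> \<le> \<epsilon> * \<delta> * exp (x / \<epsilon>)"
    proof (rule abs_le_by_deriv[where a = "-1" and f = F and g = "\<lambda>t. \<epsilon> * \<delta> * exp (t / \<epsilon>)"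
          and f' = "\<lambda>t. exp (t / \<epsilon>) * r t" and g' = "\<lambda>t. \<delta> * exp (t / \<epsilon>)"])
      show "\<bar>F (-1)\<bar> \<le> \<epsilon> * \<delta> * exp (-1 / \<epsilon>)"
        using bd[of "-1"] \<epsilon> by (simp add: F_def abs_mult mult_ac)
      show "\<bar>exp (t / \<epsilon>) * r t\<bar> \<le> \<delta> * exp (t / \<epsilon>)" if "t \<in> {-1..x}" for t
        using bd[of t] that x by (simp add: abs_mult mult_ac)
    qed (use x \<epsilon> in \<open>auto intro!: derivative_eq_intros F\<close>)
    then show "\<bar>A x\<bar> \<le> \<epsilon> * \<delta>"
      by (simp add: eF abs_mult mult.commute)
    \<comment> \<open>Here \<open>x\<close> is fixed and \<open>t\<close> runs from -1 to
      \<open>x\<close>. The difference at t = x is the integral of exp (t/\<epsilon>) (r t - r x),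
      where \<open>r\<close> is constant to the left of -1. The majorant is an antiderivative of
      \<delta> exp (t/\<epsilon>) (x - t), and only its \<epsilon>^2 term is left at t = x.\<close>
    have "\<bar>F x - \<epsilon> * exp (x / \<epsilon>) * r x\<bar> \<le> \<delta> * (\<epsilon> * exp (x / \<epsilon>) * (x - x) + \<epsilon>\<^sup>2 * exp (x / \<epsilon>))"
    proof (rule abs_le_by_deriv[where a = "-1" and f = "\<lambda>t. F t - \<epsilon> * exp (t / \<epsilon>) * r x"
          and g = "\<lambda>t. \<delta> * (\<epsilon> * exp (t / \<epsilon>) * (x - t) + \<epsilon>\<^sup>2 * exp (t / \<epsilon>))"
          and f' = "\<lambda>t. exp (t / \<epsilon>) * (r t - r x)" and g' = "\<lambda>t. \<delta> * (exp (t / \<epsilon>) * (x - t))"])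
      show "((\<lambda>t. F t - \<epsilon> * exp (t / \<epsilon>) * r x) has_real_derivative exp (t / \<epsilon>) * (r t - r x)) (at t)" for t
        using \<epsilon> by (auto intro!: derivative_eq_intros F simp: algebra_simps)
      show "((\<lambda>t. \<delta> * (\<epsilon> * exp (t / \<epsilon>) * (x - t) + \<epsilon>\<^sup>2 * exp (t / \<epsilon>))) has_real_derivative
          \<delta> * (exp (t / \<epsilon>) * (x - t))) (at t)" for t
        using \<epsilon> by (auto intro!: derivative_eq_intros simp: field_simps power2_eq_square)
      show "\<bar>exp (t / \<epsilon>) * (r t - r x)\<bar> \<le> \<delta> * (exp (t / \<epsilon>) * (x - t))" if "t \<in> {-1..x}" for t
        using mult_left_mono[OF lip[of t x], of "exp (t / \<epsilon>)"] that x by (simp add: abs_mult mult_ac)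
      have "F (-1) - \<epsilon> * exp (-1 / \<epsilon>) * r x = \<epsilon> * exp (-1 / \<epsilon>) * (r (-1) - r x)"
        by (simp add: F_def algebra_simps)
      then have "\<bar>F (-1) - \<epsilon> * exp (-1 / \<epsilon>) * r x\<bar> = \<epsilon> * exp (-1 / \<epsilon>) * \<bar>r (-1) - r x\<bar>"
        using \<epsilon> by (simp add: abs_mult)
      also have "\<dots> \<le> \<epsilon> * exp (-1 / \<epsilon>) * (\<delta> * \<bar>-1 - x\<bar>)"
        using x \<epsilon> by (intro mult_left_mono lip) auto
      also have "\<dots> = \<delta> * (\<epsilon> * exp (-1 / \<epsilon>) * (x - (-1)))"
        using x by (simp add: mult_ac)
      also have "\<dots> \<le> \<delta> * (\<epsilon> * exp (-1 / \<epsilon>) * (x - (-1)) + \<epsilon>\<^sup>2 * exp (-1 / \<epsilon>))"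
        using \<delta> by (intro mult_left_mono) auto
      finally show "\<bar>F (-1) - \<epsilon> * exp (-1 / \<epsilon>) * r x\<bar>
          \<le> \<delta> * (\<epsilon> * exp (-1 / \<epsilon>) * (x - (-1)) + \<epsilon>\<^sup>2 * exp (-1 / \<epsilon>))" .
    qed (use x in auto)
    also have "F x - \<epsilon> * exp (x / \<epsilon>) * r x = exp (x / \<epsilon>) * (A x - \<epsilon> * r x)"
      by (simp add: eF algebra_simps)
    finally show "\<bar>A x - \<epsilon> * r x\<bar> \<le> \<epsilon>\<^sup>2 * \<delta>"
      by (simp add: abs_mult mult_ac)
  qed
qed

text \<open>\<open>A\<close> and the reflected \<open>B\<close> are the two halves of the
  convolution, so v = (A + B) / (2 \<epsilon>) and v' = (B - A) / (2 \<epsilon>^2). Each half equals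
  \<epsilon> r x up to \<epsilon>^2 \<delta>. In the difference the terms \<epsilon> r x cancel, and
  this is what keeps v' bounded independently of \<epsilon>.\<close>

lemma lipschitz_particular_solution:
  fixes r :: "real \<Rightarrow> real"
  assumes cont: "continuous_on UNIV r" and \<epsilon>: "0 < \<epsilon>"
    and bd: "\<And>x. x \<in> {-1..1} \<Longrightarrow> \<bar>r x\<bar> \<le> \<delta>"
    and lip: "\<And>x y. x \<in> {-1..1} \<Longrightarrow> y \<in> {-1..1} \<Longrightarrow> \<bar>r x - r y\<bar> \<le> \<delta> * \<bar>x - y\<bar>"
  obtains v v' where "\<And>x. (v has_real_derivative v' x) (at x)"
    "\<And>x. (v' has_real_derivative (v x - r x) / \<epsilon>\<^sup>2) (at x)"
    "\<And>x. x \<in> {-1..1} \<Longrightarrow> \<bar>v x\<bar> \<le> \<delta>" "\<And>x. x \<in> {-1..1} \<Longrightarrow> \<bar>v' x\<bar> \<le> \<delta>"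
proof -
  obtain A where A: "\<And>x. (A has_real_derivative r x - A x / \<epsilon>) (at x)"
    "\<And>x. x \<in> {-1..1} \<Longrightarrow> \<bar>A x\<bar> \<le> \<epsilon> * \<delta>" "\<And>x. x \<in> {-1..1} \<Longrightarrow> \<bar>A x - \<epsilon> * r x\<bar> \<le> \<epsilon>\<^sup>2 * \<delta>"
    using first_order_layer_solution[OF cont \<epsilon> bd lip] by blast
  have contm: "continuous_on UNIV (\<lambda>x. r (- x))"
    by (intro continuous_on_compose2[OF cont] continuous_intros) auto
  obtain B where B: "\<And>x. (B has_real_derivative r (- x) - B x / \<epsilon>) (at x)"
    "\<And>x. x \<in> {-1..1} \<Longrightarrow> \<bar>B x\<bar> \<le> \<epsilon> * \<delta>" "\<And>x. x \<in> {-1..1} \<Longrightarrow> \<bar>B x - \<epsilon> * r (- x)\<bar> \<le> \<epsilon>\<^sup>2 * \<delta>"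
  proof (rule first_order_layer_solution[OF contm \<epsilon>])
    fix x y :: real assume "x \<in> {-1..1}" "y \<in> {-1..1}"
    then show "\<bar>r (- x) - r (- y)\<bar> \<le> \<delta> * \<bar>x - y\<bar>"
      using lip[of "- x" "- y"] by (simp add: abs_minus_commute)
  qed (use bd in auto)
  have Bm: "((\<lambda>x. B (- x)) has_real_derivative B (- x) / \<epsilon> - r x) (at x)" for x
    using DERIV_chain2[OF B(1) DERIV_minus[OF DERIV_ident]] by simp
  show ?thesis
  proof (rule that)
    show "((\<lambda>x. (A x + B (- x)) / (2 * \<epsilon>)) has_real_derivative (B (- x) - A x) / (2 * \<epsilon>\<^sup>2)) (at x)" for x
      using \<epsilon> by (auto intro!: derivative_eq_intros A(1) Bm simp: field_simps power2_eq_square)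
    show "((\<lambda>x. (B (- x) - A x) / (2 * \<epsilon>\<^sup>2)) has_real_derivative
        ((A x + B (- x)) / (2 * \<epsilon>) - r x) / \<epsilon>\<^sup>2) (at x)" for x
      using \<epsilon> by (auto intro!: derivative_eq_intros A(1) Bm simp: field_simps power2_eq_square)
  next
    fix x :: real assume x: "x \<in> {-1..1}"
    then have mx: "- x \<in> {-1..1}"
      by auto
    have "\<bar>A x + B (- x)\<bar> \<le> \<delta> * (2 * \<epsilon>)"
      using A(2)[OF x] B(2)[OF mx] by (simp add: mult_ac)
    then show "\<bar>(A x + B (- x)) / (2 * \<epsilon>)\<bar> \<le> \<delta>"
      using \<epsilon> by (simp add: pos_divide_le_eq)
    have "\<bar>B (- x) - A x\<bar> \<le> \<delta> * (2 * \<epsilon>\<^sup>2)"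
      using A(3)[OF x] B(3)[OF mx] by (simp add: mult_ac)
    then show "\<bar>(B (- x) - A x) / (2 * \<epsilon>\<^sup>2)\<bar> \<le> \<delta>"
      using \<epsilon> by (simp add: pos_divide_le_eq)
  qed
qed

text \<open>The Neumann series of 1 - c D^2 is finite, because D^2 lowers the degree. The induction
  hypothesis for q'' yields \<open>w\<close>, and q + c w solves the equation for \<open>q\<close>.
  Since the degree does not grow, monomials up to degree \<open>p\<close> suffice later.\<close>

lemma poly_particular_solution:
  fixes q :: "real poly"
  shows "\<exists>w. degree w \<le> degree q \<and> w - Polynomial.smult c (pderiv (pderiv w)) = q"
proof (induction "degree q" arbitrary: q rule: less_induct)
  case less
  show ?case
  proof (cases "degree q = 0")
    case True
    then show ?thesis
      by (intro exI[of _ q]) (simp add: pderiv_eq_0_iff[THEN iffD2])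
  next
    case False
    let ?q2 = "pderiv (pderiv q)"
    have lt: "degree ?q2 < degree q"
      using False by (simp add: degree_pderiv)
    then obtain w where w: "degree w \<le> degree ?q2" "w - Polynomial.smult c (pderiv (pderiv w)) = ?q2"
      using less by blast
    define W where "W = q + Polynomial.smult c w"
    have "W - Polynomial.smult c (pderiv (pderiv W)) = q + Polynomial.smult c (w - ?q2 - Polynomial.smult c (pderiv (pderiv w)))"
      by (simp add: W_def pderiv_add pderiv_smult smult_diff_right smult_add_right)
    also have "\<dots> = q"
      using w(2) by (simp add: algebra_simps)
    finally have "W - Polynomial.smult c (pderiv (pderiv W)) = q" .
    moreover have "degree W \<le> degree q"
      unfolding W_def using w(1) lt by (intro degree_add_le order.trans[OF Polynomial.degree_smult_le]) auto
    ultimately show ?thesis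
      by blast
  qed
qed

section \<open>Weak solutions\<close>

lemma Ioo_lebesgue: "{-1<..<1::real} \<in> sets lebesgue"
  by simp


lemma finite_measure_leb_I: "finite_measure leb_I"
  by (rule finite_measureI) (simp add: emeasure_restrict_space)

lemma AE_leb_I_Ioo: "AE x in leb_I. x \<in> {-1<..<1}"
  by (rule AE_I2) simp

lemma measurable_leb_I_continuous:
  "continuous_on {-1<..<1} g \<Longrightarrow> g \<in> borel_measurable leb_I"
  by (intro continuous_imp_measurable_on_sets_lebesgue Ioo_lebesgue)

lemma integrable_leb_I_bounded:
  fixes g :: "real \<Rightarrow> real"
  assumes "g \<in> borel_measurable leb_I" "AE x in leb_I. \<bar>g x\<bar> \<le> B"
  shows "integrable leb_I g"
  by (rule finite_measure.integrable_const_bound[OF finite_measure_leb_I]) (use assms in auto)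

lemma continuous_on_bounded_obtain:
  fixes g :: "real \<Rightarrow> real"
  assumes "continuous_on {-1..1} g"
  obtains B where "0 < B" "\<And>x. x \<in> {-1..1} \<Longrightarrow> \<bar>g x\<bar> \<le> B"
proof -
  have "bounded (g ` {-1..1})"
    by (intro compact_imp_bounded compact_continuous_image assms compact_Icc)
  then obtain B where "0 < B" "\<forall>y\<in>g ` {-1..1}. norm y \<le> B"
    unfolding bounded_pos by blast
  then show thesis
    by (intro that[of B]) auto
qed

lemma integrable_leb_I_mult_continuous:
  fixes d g :: "real \<Rightarrow> real"
  assumes d: "integrable leb_I d" and g: "continuous_on {-1..1} g"
  shows "integrable leb_I (\<lambda>x. d x * g x)"
proof -
  obtain B where B: "0 < B" "\<And>x. x \<in> {-1..1} \<Longrightarrow> \<bar>g x\<bar> \<le> B"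
    using continuous_on_bounded_obtain[OF g] by blast
  have [measurable]: "g \<in> borel_measurable leb_I"
    by (intro measurable_leb_I_continuous continuous_on_subset[OF g]) auto
  have [measurable]: "d \<in> borel_measurable leb_I"
    using d by auto
  show ?thesis
  proof (rule Bochner_Integration.integrable_bound[of _ "\<lambda>x. B * d x"])
    show "AE x in leb_I. norm (d x * g x) \<le> norm (B * d x)"
    proof (rule AE_I2)
      fix x assume "x \<in> space leb_I"
      then have "\<bar>g x\<bar> \<le> B"
        by (intro B) auto
      then show "norm (d x * g x) \<le> norm (B * d x)"
        using B(1) mult_right_mono[of "\<bar>g x\<bar>" B "\<bar>d x\<bar>"] by (simp add: abs_mult mult.commute)
    qed
  qed (use d in auto)
qed

lemma integrable_leb_I_const: "integrable leb_I (\<lambda>_. c :: real)"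
  by (rule integrable_leb_I_bounded[of _ "\<bar>c\<bar>"]) auto

lemma integrable_leb_I_continuous:
  assumes "continuous_on {-1..1} (g :: real \<Rightarrow> real)"
  shows "integrable leb_I g"
  using integrable_leb_I_mult_continuous[OF integrable_leb_I_const[of 1] assms] by simp

lemma integral_leb_I_eq:
  assumes "continuous_on {-1..1} (g :: real \<Rightarrow> real)"
  shows "integral\<^sup>L leb_I g = integral {-1..1} g"
proof -
  have "integral\<^sup>L leb_I g = integral {-1<..<1} g"
    by (rule lebesgue_integral_eq_integral[OF integrable_leb_I_continuous[OF assms] Ioo_lebesgue])
  also have "\<dots> = integral {-1..1} g"
    by (rule integral_open_interval_real[symmetric])
  finally show ?thesis .
qed

lemma in_L2_continuous:
  assumes "continuous_on {-1..1} g"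
  shows "in_L2 g"
  unfolding in_L2_def
proof
  have "continuous_on {-1<..<1} g"
    by (rule continuous_on_subset[OF assms]) auto
  then show "g \<in> borel_measurable leb_I"
    by (rule measurable_leb_I_continuous)
  show "integrable leb_I (\<lambda>x. (g x)\<^sup>2)"
    by (intro integrable_leb_I_continuous continuous_intros assms)
qed

lemma in_L2_imp_integrable:
  assumes "in_L2 v"
  shows "integrable leb_I v"
proof (rule Bochner_Integration.integrable_bound[of _ "\<lambda>x. 1 + (v x)\<^sup>2"])
  show "integrable leb_I (\<lambda>x. 1 + (v x)\<^sup>2)"
    using assms integrable_leb_I_bounded[of "\<lambda>_. 1" 1] by (auto simp: in_L2_def)
  have "\<bar>v x\<bar> \<le> 1 + (v x)\<^sup>2" for x
    using zero_le_power2[of "\<bar>v x\<bar> - 1"] abs_ge_zero[of "v x"] unfolding power2_diff by simp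
  then show "AE x in leb_I. norm (v x) \<le> norm (1 + (v x)\<^sup>2)"
    by (auto intro!: AE_I2 simp: abs_of_nonneg)
qed (use assms in \<open>simp add: in_L2_def\<close>)

lemma in_L2_diff:
  assumes "in_L2 v" "in_L2 w"
  shows "in_L2 (\<lambda>x. v x - w x)"
  unfolding in_L2_def
proof
  show [measurable]: "(\<lambda>x. v x - w x) \<in> borel_measurable leb_I"
    using assms unfolding in_L2_def by (intro borel_measurable_diff) auto
  show "integrable leb_I (\<lambda>x. (v x - w x)\<^sup>2)"
  proof (rule Bochner_Integration.integrable_bound[of _ "\<lambda>x. 2 * (v x)\<^sup>2 + 2 * (w x)\<^sup>2"])
    show "integrable leb_I (\<lambda>x. 2 * (v x)\<^sup>2 + 2 * (w x)\<^sup>2)"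
      using assms by (simp add: in_L2_def)
    have "(v x - w x)\<^sup>2 \<le> 2 * (v x)\<^sup>2 + 2 * (w x)\<^sup>2" for x
      using zero_le_power2[of "v x + w x"] by (simp add: power2_eq_square algebra_simps)
    then show "AE x in leb_I. norm ((v x - w x)\<^sup>2) \<le> norm (2 * (v x)\<^sup>2 + 2 * (w x)\<^sup>2)"
      by (auto intro!: AE_I2)
  qed simp
qed

lemma test_function_facts:
  assumes "test_function \<phi>"
  shows "continuous_on A \<phi>" "continuous_on A (deriv \<phi>)"
    "(\<phi> has_real_derivative deriv \<phi> x) (at x)" "\<phi> 1 = 0" "\<phi> (-1) = 0"
proof -
  obtain D where D: "\<And>x. (\<phi> has_vector_derivative D x) (at x)" "continuous_on UNIV D"
    using assms unfolding test_function_def C1_differentiable_on_def by auto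
  then have D': "(\<phi> has_real_derivative D x) (at x)" for x
    by (simp add: has_real_derivative_iff_has_vector_derivative)
  then have "deriv \<phi> = D"
    by (auto intro!: DERIV_imp_deriv)
  with D D' show "continuous_on A (deriv \<phi>)" "(\<phi> has_real_derivative deriv \<phi> x) (at x)"
    by (auto intro: continuous_on_subset)
  show "continuous_on A \<phi>"
    by (rule DERIV_continuous_on[of _ _ D]) (blast intro: D' has_field_derivative_at_within)
  have "{x. \<phi> x \<noteq> 0} \<subseteq> {-1<..<1}"
    using assms closure_subset unfolding test_function_def by fast
  then show "\<phi> 1 = 0" "\<phi> (-1) = 0"
    by auto
qed

lemma in_H10_classical:
  assumes U: "\<And>x. (U has_real_derivative U1 x) (at x)" and cont: "continuous_on UNIV U1"
    and bc: "U (-1) = 0" "U 1 = 0"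
  shows "in_H10 U U1"
proof -
  have contU: "continuous_on A U" and contU1: "continuous_on A U1" for A
    using DERIV_continuous_on[of UNIV U U1] U cont
    by (auto intro: continuous_on_subset has_field_derivative_at_within)
  have "weak_deriv U U1"
    unfolding weak_deriv_def
  proof (intro allI impI)
    fix \<phi> assume \<phi>: "test_function \<phi>"
    note F = test_function_facts[OF \<phi>]
    have i1: "integrable leb_I (\<lambda>x. U x * deriv \<phi> x)" and i2: "integrable leb_I (\<lambda>x. U1 x * \<phi> x)"
      by (intro integrable_leb_I_continuous continuous_intros contU contU1 F)+
    have "((\<lambda>x. U x * deriv \<phi> x + U1 x * \<phi> x) has_integral (U 1 * \<phi> 1 - U (-1) * \<phi> (-1))) {-1..1}"
    proof (rule fundamental_theorem_of_calculus)
      fix x :: real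
      have "((\<lambda>x. U x * \<phi> x) has_real_derivative (U x * deriv \<phi> x + U1 x * \<phi> x)) (at x)"
        using DERIV_mult[OF U F(3)] by (simp add: algebra_simps)
      then show "((\<lambda>x. U x * \<phi> x) has_vector_derivative (U x * deriv \<phi> x + U1 x * \<phi> x)) (at x within {-1..1})"
        by (simp add: has_real_derivative_iff_has_vector_derivative has_vector_derivative_at_within)
    qed simp
    then have "integral\<^sup>L leb_I (\<lambda>x. U x * deriv \<phi> x + U1 x * \<phi> x) = 0"
      by (subst integral_leb_I_eq)
         (auto intro!: continuous_intros contU contU1 F simp: integral_unique bc)
    then show "(\<integral>x. U x * deriv \<phi> x \<partial>leb_I) = - (\<integral>x. U1 x * \<phi> x \<partial>leb_I)"
      using i1 i2 by simp
  qed
  then show ?thesis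
    unfolding in_H10_def in_H1_def
    using bc contU contU1 by (auto intro!: in_L2_continuous exI[of _ U])
qed

lemma in_H10_diff:
  assumes "in_H10 v v'" "in_H10 w w'"
  shows "in_H10 (\<lambda>x. v x - w x) (\<lambda>x. v' x - w' x)"
proof -
  have L2: "in_L2 v" "in_L2 v'" "in_L2 w" "in_L2 w'" and wd: "weak_deriv v v'" "weak_deriv w w'"
    using assms by (auto simp: in_H10_def in_H1_def)
  have "weak_deriv (\<lambda>x. v x - w x) (\<lambda>x. v' x - w' x)"
    unfolding weak_deriv_def
  proof (intro allI impI)
    fix \<phi> assume \<phi>: "test_function \<phi>"
    note F = test_function_facts[OF \<phi>]
    have [simp]: "integrable leb_I (\<lambda>x. f x * deriv \<phi> x)" "integrable leb_I (\<lambda>x. f x * \<phi> x)" if "in_L2 f" for f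
      by (intro integrable_leb_I_mult_continuous in_L2_imp_integrable that F)+
    show "(\<integral>x. (v x - w x) * deriv \<phi> x \<partial>leb_I) = - (\<integral>x. (v' x - w' x) * \<phi> x \<partial>leb_I)"
      using wd \<phi> L2 by (simp add: left_diff_distrib weak_deriv_def)
  qed
  moreover obtain a b where "continuous_on {-1..1} a" "AE x in leb_I. v x = a x" "a (-1) = 0" "a 1 = 0"
    "continuous_on {-1..1} b" "AE x in leb_I. w x = b x" "b (-1) = 0" "b 1 = 0"
    using assms unfolding in_H10_def by auto
  then have "\<exists>c. continuous_on {-1..1} c \<and> (AE x in leb_I. v x - w x = c x) \<and> c (-1) = 0 \<and> c 1 = 0"
    by (intro exI[of _ "\<lambda>x. a x - b x"]) (auto intro!: continuous_intros)
  ultimately show ?thesis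
    using L2 by (simp add: in_H10_def in_H1_def in_L2_diff)
qed

section \<open>Cutoff functions\<close>

lemma DERIV_pos_part_square: "((\<lambda>x::real. (max 0 x)\<^sup>2) has_real_derivative 2 * max 0 x) (at x)"
proof (cases "x = 0")
  case True
  have "((\<lambda>h::real. (max 0 h)\<^sup>2 / h) \<longlongrightarrow> 0) (at 0)"
  proof (rule Lim_null_comparison[of _ "\<lambda>h. \<bar>h\<bar>"])
    show "\<forall>\<^sub>F h in at (0::real). norm ((max 0 h)\<^sup>2 / h) \<le> \<bar>h\<bar>"
      by (auto simp: max_def power2_eq_square intro!: always_eventually)
  qed (auto intro!: tendsto_eq_intros)
  with True show ?thesis
    by (simp add: DERIV_def)
next
  case False
  show ?thesis
  proof (cases "0 < x")
    case True
    have "((\<lambda>x. x\<^sup>2) has_real_derivative 2 * max 0 x) (at x)"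
      using True by (auto intro!: derivative_eq_intros)
    then show ?thesis
      by (rule has_field_derivative_transform_within_open[of _ _ _ "{0<..}"]) (use True in auto)
  next
    case False
    with \<open>x \<noteq> 0\<close> have "((\<lambda>x. 0) has_real_derivative 2 * max 0 x) (at x)"
      by auto
    then show ?thesis
      by (rule has_field_derivative_transform_within_open[of _ _ _ "{..<0}"])
         (use False \<open>x \<noteq> 0\<close> in auto)
  qed
qed

text \<open>The integral of the hat function on \<open>[0, 1]\<close>: a \<open>C\<^sup>1\<close> transition from 0 to 1.\<close>

definition ramp :: "real \<Rightarrow> real" where
  "ramp s = 2 * ((max 0 s)\<^sup>2 - 2 * (max 0 (s - 1/2))\<^sup>2 + (max 0 (s - 1))\<^sup>2)"

definition ramp_deriv :: "real \<Rightarrow> real" where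
  "ramp_deriv s = 4 * (max 0 s - 2 * max 0 (s - 1/2) + max 0 (s - 1))"

lemma DERIV_ramp: "(ramp has_real_derivative ramp_deriv s) (at s)"
proof -
  have shift: "((\<lambda>x. (max 0 (x - c))\<^sup>2) has_real_derivative 2 * max 0 (s - c)) (at s)" for c
    using DERIV_shift[of "\<lambda>x. (max 0 x)\<^sup>2" "2 * max 0 (s - c)" s "- c"] DERIV_pos_part_square[of "s - c"]
    by simp
  show ?thesis
    unfolding ramp_def ramp_deriv_def
    by (rule derivative_eq_intros DERIV_pos_part_square shift refl)+ simp
qed

lemma ramp_eq_0: "s \<le> 0 \<Longrightarrow> ramp s = 0" and ramp_eq_1: "1 \<le> s \<Longrightarrow> ramp s = 1"
  and ramp_deriv_eq_0: "s \<le> 0 \<or> 1 \<le> s \<Longrightarrow> ramp_deriv s = 0"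
  and abs_ramp_deriv_le: "\<bar>ramp_deriv s\<bar> \<le> 2"
  by (auto simp: ramp_def ramp_deriv_def max_def power2_eq_square field_simps)

lemma continuous_ramp_deriv: "continuous_on A ramp_deriv"
  unfolding ramp_deriv_def by (intro continuous_intros)

lemma ramp_bounds: "0 \<le> ramp s" "ramp s \<le> 1"
proof -
  have mono: "ramp a \<le> ramp b" if "a \<le> b" for a b
  proof (rule DERIV_nonneg_imp_nondecreasing[OF that])
    show "\<exists>y. (ramp has_real_derivative y) (at x) \<and> 0 \<le> y" for x
      by (intro exI[of _ "ramp_deriv x"] conjI DERIV_ramp) (auto simp: ramp_deriv_def max_def)
  qed
  show "0 \<le> ramp s" "ramp s \<le> 1"
    using mono[of "min s 0" s] mono[of s "max s 1"] by (auto simp: ramp_eq_0 ramp_eq_1)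
qed

text \<open>It vanishes where 1 - x^2 \<le> 1/n, so its support is compact in the open interval, and
  it is 1 where 1 - x^2 \<ge> 2/n. The expression 1 - x^2 is smooth at 0, unlike the distance 1 -
  |x| to the boundary.\<close>

definition cutoff :: "nat \<Rightarrow> real \<Rightarrow> real" where
  "cutoff n x = ramp (real n * (1 - x\<^sup>2) - 1)"

definition cutoff_deriv :: "nat \<Rightarrow> real \<Rightarrow> real" where
  "cutoff_deriv n x = - 2 * real n * x * ramp_deriv (real n * (1 - x\<^sup>2) - 1)"

lemma DERIV_cutoff: "(cutoff n has_real_derivative cutoff_deriv n x) (at x)"
proof -
  have "((\<lambda>x. real n * (1 - x\<^sup>2) - 1) has_real_derivative (- 2 * real n * x)) (at x)"
    by (auto intro!: derivative_eq_intros)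
  from DERIV_chain2[OF DERIV_ramp this] show ?thesis
    unfolding cutoff_def cutoff_deriv_def by (simp add: mult_ac)
qed

lemma continuous_cutoff: "continuous_on A (cutoff n)"
  by (rule DERIV_continuous_on) (blast intro: DERIV_cutoff has_field_derivative_at_within)

lemma continuous_cutoff_deriv: "continuous_on A (cutoff_deriv n)"
  unfolding cutoff_deriv_def
  by (intro continuous_intros continuous_on_compose2[OF continuous_ramp_deriv]) auto

lemma cutoff_deriv_le:
  assumes "x \<in> {-1..1}"
  shows "\<bar>cutoff_deriv n x\<bar> \<le> 4 * real n"
proof -
  have "2 * real n * \<bar>x\<bar> * \<bar>ramp_deriv (real n * (1 - x\<^sup>2) - 1)\<bar> \<le> 2 * real n * 1 * 2"
    using assms by (intro mult_mono abs_ramp_deriv_le) auto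
  then show ?thesis
    by (simp add: cutoff_deriv_def abs_mult)
qed

lemma cutoff_deriv_eq_0:
  assumes "x \<in> {-1..1}" "2 \<le> real n * (1 - \<bar>x\<bar>)"
  shows "cutoff_deriv n x = 0"
proof -
  have "\<bar>x\<bar>\<^sup>2 \<le> \<bar>x\<bar>"
    unfolding power2_eq_square using assms by (intro mult_left_le) auto
  then have "real n * (1 - \<bar>x\<bar>) \<le> real n * (1 - x\<^sup>2)"
    by (intro mult_left_mono) auto
  then show ?thesis
    using assms by (simp add: cutoff_deriv_def ramp_deriv_eq_0)
qed

lemma cutoff_tendsto: "x \<in> {-1<..<1} \<Longrightarrow> (\<lambda>n. cutoff n x) \<longlonglongrightarrow> 1"
proof (rule tendsto_eventually)
  assume x: "x \<in> {-1<..<1}"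
  then have "\<bar>x\<bar> * \<bar>x\<bar> < 1 * 1"
    by (intro mult_strict_mono') auto
  then have pos: "0 < 1 - x\<^sup>2"
    by (simp add: power2_eq_square)
  have "\<forall>\<^sub>F n in sequentially. 2 / (1 - x\<^sup>2) \<le> real n"
    by (rule eventually_sequentiallyI[of "nat \<lceil>2 / (1 - x\<^sup>2)\<rceil>"]) linarith
  then show "\<forall>\<^sub>F n in sequentially. cutoff n x = 1"
    by eventually_elim (use pos in \<open>simp add: cutoff_def ramp_eq_1 pos_divide_le_eq\<close>)
qed

lemma test_function_cutoff:
  assumes \<psi>: "\<And>x. (\<psi> has_real_derivative \<psi>' x) (at x)" and cont: "continuous_on UNIV \<psi>'"
  shows "test_function (\<lambda>x. cutoff n x * \<psi> x)"
    "deriv (\<lambda>x. cutoff n x * \<psi> x) x = cutoff_deriv n x * \<psi> x + cutoff n x * \<psi>' x"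
proof -
  have D: "((\<lambda>x. cutoff n x * \<psi> x) has_real_derivative (cutoff_deriv n x * \<psi> x + cutoff n x * \<psi>' x)) (at x)" for x
    using DERIV_mult[OF DERIV_cutoff \<psi>] by (simp add: algebra_simps)
  then show "deriv (\<lambda>x. cutoff n x * \<psi> x) x = cutoff_deriv n x * \<psi> x + cutoff n x * \<psi>' x"
    by (rule DERIV_imp_deriv)
  have cont\<psi>: "continuous_on UNIV \<psi>"
    by (rule DERIV_continuous_on[of _ _ \<psi>']) (simp add: \<psi>)
  have sub: "{x. cutoff n x * \<psi> x \<noteq> 0} \<subseteq> {x. 1 \<le> real n * (1 - x\<^sup>2)}"
    using ramp_eq_0 by (auto simp: cutoff_def) (meson diff_le_0_iff_le linorder_le_cases)
  have "closed {x. 1 \<le> real n * (1 - x\<^sup>2)}"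
    by (intro closed_Collect_le continuous_intros)
  with sub have "closure {x. cutoff n x * \<psi> x \<noteq> 0} \<subseteq> {x. 1 \<le> real n * (1 - x\<^sup>2)}"
    by (rule closure_minimal)
  also have "\<dots> \<subseteq> {-1<..<1}"
  proof
    fix x assume "x \<in> {x. 1 \<le> real n * (1 - x\<^sup>2)}"
    then have "0 < 1 - x\<^sup>2"
      by (smt (verit) mem_Collect_eq mult_nonneg_nonpos of_nat_0_le_iff)
    then have "\<bar>x\<bar> < 1"
      by (simp add: abs_square_less_1)
    then show "x \<in> {-1<..<1}"
      by auto
  qed
  finally show "test_function (\<lambda>x. cutoff n x * \<psi> x)"
    unfolding test_function_def C1_differentiable_on_def using D
    by (intro conjI exI[of _ "\<lambda>x. cutoff_deriv n x * \<psi> x + cutoff n x * \<psi>' x"])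
       (auto simp: has_real_derivative_iff_has_vector_derivative
             intro!: continuous_intros continuous_cutoff continuous_cutoff_deriv cont cont\<psi>)
qed

section \<open>Integration by parts up to the boundary and uniqueness\<close>

lemma integral_boundary_layer_indicator:
  assumes "0 \<le> h"
  shows "integrable leb_I (\<lambda>x. indicator {x. 1 - h \<le> \<bar>x\<bar>} x :: real)"
    "(\<integral>x. indicator {x. 1 - h \<le> \<bar>x\<bar>} x \<partial>leb_I) \<le> 2 * h"
proof -
  define S where "S = {-1<..<1::real} \<inter> {x. 1 - h \<le> \<bar>x\<bar>}"
  have "closed {x::real. 1 - h \<le> \<bar>x\<bar>}"
    by (intro closed_Collect_le continuous_intros)
  then have "{x::real. 1 - h \<le> \<bar>x\<bar>} \<in> sets lebesgue"
    by simp
  then have S: "S \<in> sets leb_I" "S \<in> sets lebesgue"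
    unfolding S_def sets_restrict_space by (auto intro!: sets.Int)
  have eq: "indicator {x. 1 - h \<le> \<bar>x\<bar>} x = (indicator S x :: real)" if "x \<in> space leb_I" for x
    using that by (auto simp: S_def indicator_def)
  have fin: "emeasure leb_I S < \<infinity>"
    using finite_measure.emeasure_finite[OF finite_measure_leb_I] by (simp add: less_top)
  have "integrable leb_I (\<lambda>x. indicator S x :: real)"
    using S fin by (intro integrable_real_indicator)
  then show "integrable leb_I (\<lambda>x. indicator {x. 1 - h \<le> \<bar>x\<bar>} x :: real)"
    by (subst Bochner_Integration.integrable_cong[OF refl, of _ _ "indicator S"]) (use eq in auto)
  have "(\<integral>x. indicator {x. 1 - h \<le> \<bar>x\<bar>} x \<partial>leb_I) = (\<integral>x. (indicator S x :: real) \<partial>leb_I)"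
    by (rule Bochner_Integration.integral_cong[OF refl]) (rule eq)
  also have "\<dots> = measure leb_I S"
    using S(1) by (subst Bochner_Integration.integral_indicator) (simp add: S_def Int_ac)
  also have "\<dots> = measure lebesgue S"
    by (rule measure_restrict_space) (auto simp: S_def)
  also have "\<dots> \<le> measure lebesgue ({-1..-1 + h} \<union> {1 - h..1})"
    by (rule measure_mono_fmeasurable) (use S in \<open>auto simp: S_def\<close>)
  also have "\<dots> \<le> measure lebesgue {-1..-1 + h} + measure lebesgue {1 - h..1}"
    by (rule measure_Un_le) auto
  also have "\<dots> = 2 * h"
    using assms by simp
  finally show "(\<integral>x. indicator {x. 1 - h \<le> \<bar>x\<bar>} x \<partial>leb_I) \<le> 2 * h" .
qed

lemma small_near_boundary:
  fixes w :: "real \<Rightarrow> real"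
  assumes w: "continuous_on {-1..1} w" "w (-1) = 0" "w 1 = 0" and e: "0 < e"
  obtains \<eta> where "0 < \<eta>" "\<And>x. x \<in> {-1..1} \<Longrightarrow> 1 - \<eta> \<le> \<bar>x\<bar> \<Longrightarrow> \<bar>w x\<bar> \<le> e"
proof -
  have "uniformly_continuous_on {-1..1} w"
    by (intro compact_uniformly_continuous w compact_Icc)
  then obtain \<eta> where \<eta>: "0 < \<eta>"
    "\<And>x y. x \<in> {-1..1} \<Longrightarrow> y \<in> {-1..1} \<Longrightarrow> dist y x < \<eta> \<Longrightarrow> dist (w y) (w x) < e"
    unfolding uniformly_continuous_on_def using e by metis
  show thesis
  proof (rule that[of "\<eta> / 2"])
    fix x :: real assume x: "x \<in> {-1..1}" "1 - \<eta> / 2 \<le> \<bar>x\<bar>"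
    then have "dist x 1 < \<eta> \<or> dist x (-1) < \<eta>"
      using \<eta>(1) by (auto simp: dist_real_def abs_if split: if_splits)
    then show "\<bar>w x\<bar> \<le> e"
      using \<eta>(2)[of 1 x] \<eta>(2)[of "-1" x] x w by (auto simp: dist_real_def)
  qed (use \<eta> in auto)
qed

text \<open>The weak derivative is tested only with compactly supported functions, whereas \<psi>
  may be nonzero at the end points. Multiplying \<psi> by a cutoff leaves the remainder d * cutoff'
  * \<psi>. It lives on two strips of width 2/n, where |cutoff'| \<le> 4 n, and it tends to 0
  because the continuous representative of \<open>d\<close> is small near the end points. This is
  where the zero trace is used.\<close>

lemma in_H10_integration_by_parts:
  assumes d: "in_H10 d d'"
    and \<psi>: "\<And>x. (\<psi> has_real_derivative \<psi>' x) (at x)" and cont: "continuous_on UNIV \<psi>'"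
  shows "(\<integral>x. d x * \<psi>' x + d' x * \<psi> x \<partial>leb_I) = 0"
proof -
  have int: "integrable leb_I d" "integrable leb_I d'" and wd: "weak_deriv d d'"
    using d by (auto simp: in_H10_def in_H1_def in_L2_imp_integrable)
  obtain w where w: "continuous_on {-1..1} w" "AE x in leb_I. d x = w x" "w (-1) = 0" "w 1 = 0"
    using d by (auto simp: in_H10_def)
  have c\<psi>: "continuous_on A \<psi>" and c\<psi>': "continuous_on A \<psi>'" for A
    using DERIV_continuous_on[of UNIV \<psi> \<psi>'] \<psi> cont
    by (auto intro: continuous_on_subset has_field_derivative_at_within)
  obtain M where M: "0 < M" "\<And>x. x \<in> {-1..1} \<Longrightarrow> \<bar>\<psi> x\<bar> \<le> M"
    using continuous_on_bounded_obtain[OF c\<psi>] by blast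
  let ?g = "\<lambda>x. d x * \<psi>' x + d' x * \<psi> x"
  have intg: "integrable leb_I ?g"
    by (intro Bochner_Integration.integrable_add integrable_leb_I_mult_continuous int c\<psi> c\<psi>')
  have eq: "(\<integral>x. ?g x * cutoff n x \<partial>leb_I) = - (\<integral>x. d x * (cutoff_deriv n x * \<psi> x) \<partial>leb_I)" for n
  proof -
    have i: "integrable leb_I (\<lambda>x. d x * (cutoff_deriv n x * \<psi> x))"
      "integrable leb_I (\<lambda>x. d x * (cutoff n x * \<psi>' x))"
      "integrable leb_I (\<lambda>x. d' x * (cutoff n x * \<psi> x))"
      by (intro integrable_leb_I_mult_continuous int continuous_intros c\<psi> c\<psi>'
            continuous_cutoff continuous_cutoff_deriv)+
    have "(\<integral>x. d x * (cutoff_deriv n x * \<psi> x + cutoff n x * \<psi>' x) \<partial>leb_I)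
        = - (\<integral>x. d' x * (cutoff n x * \<psi> x) \<partial>leb_I)"
      using wd[unfolded weak_deriv_def, rule_format, OF test_function_cutoff(1)[OF \<psi> cont, of n]]
      unfolding test_function_cutoff(2)[OF \<psi> cont] .
    then have "(\<integral>x. d x * (cutoff_deriv n x * \<psi> x) \<partial>leb_I) + (\<integral>x. d x * (cutoff n x * \<psi>' x) \<partial>leb_I)
        = - (\<integral>x. d' x * (cutoff n x * \<psi> x) \<partial>leb_I)"
      using i by (simp only: distrib_left Bochner_Integration.integral_add)
    moreover have "(\<integral>x. ?g x * cutoff n x \<partial>leb_I)
        = (\<integral>x. d x * (cutoff n x * \<psi>' x) + d' x * (cutoff n x * \<psi> x) \<partial>leb_I)"
      by (rule Bochner_Integration.integral_cong[OF refl]) (simp add: algebra_simps)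
    ultimately show ?thesis
      using i by simp
  qed
  have lim1: "(\<lambda>n. \<integral>x. ?g x * cutoff n x \<partial>leb_I) \<longlonglongrightarrow> (\<integral>x. ?g x \<partial>leb_I)"
  proof (rule integral_dominated_convergence[where w = "\<lambda>x. \<bar>?g x\<bar>"])
    show "AE x in leb_I. (\<lambda>n. ?g x * cutoff n x) \<longlonglongrightarrow> ?g x"
    proof (rule AE_I2)
      fix x assume "x \<in> space leb_I"
      then have "(\<lambda>n. ?g x * cutoff n x) \<longlonglongrightarrow> ?g x * 1"
        by (intro tendsto_intros cutoff_tendsto) simp
      then show "(\<lambda>n. ?g x * cutoff n x) \<longlonglongrightarrow> ?g x"
        by simp
    qed
    show "AE x in leb_I. norm (?g x * cutoff n x) \<le> \<bar>?g x\<bar>" for n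
      using ramp_bounds by (auto simp: abs_mult cutoff_def intro!: AE_I2 mult_left_le)
    show "(\<lambda>x. ?g x * cutoff n x) \<in> borel_measurable leb_I" for n
      using integrable_leb_I_mult_continuous[OF intg continuous_cutoff] by auto
  qed (use intg in auto)
  have lim2: "(\<lambda>n. \<integral>x. d x * (cutoff_deriv n x * \<psi> x) \<partial>leb_I) \<longlonglongrightarrow> 0"
  proof (rule LIMSEQ_I)
    fix e :: real assume e: "0 < e"
    \<comment> \<open>The final estimate is 4 n M e' times the total width 4/n of the strips, that
      is 16 M e' = e/2.\<close>
    define e' where "e' = e / (32 * M)"
    have e': "0 < e'"
      using e M by (simp add: e'_def)
    obtain \<eta> where \<eta>: "0 < \<eta>" "\<And>x. x \<in> {-1..1} \<Longrightarrow> 1 - \<eta> \<le> \<bar>x\<bar> \<Longrightarrow> \<bar>w x\<bar> \<le> e'"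
      using small_near_boundary[OF w(1,3,4) e'] by blast
    have "norm ((\<integral>x. d x * (cutoff_deriv n x * \<psi> x) \<partial>leb_I) - 0) < e" if n: "nat \<lceil>2 / \<eta>\<rceil> + 1 \<le> n" for n
    proof -
      have n0: "0 < real n" and nh: "2 / real n \<le> \<eta>"
      proof -
        show "0 < real n"
          using n by simp
        have "2 / \<eta> \<le> real n"
          using n by linarith
        with \<open>0 < real n\<close> show "2 / real n \<le> \<eta>"
          using \<eta>(1) by (simp add: field_simps)
      qed
      let ?i = "\<lambda>x. indicator {x. 1 - 2 / real n \<le> \<bar>x\<bar>} x :: real"
      have h: "0 \<le> 2 / real n"
        by simp
      have "norm (\<integral>x. d x * (cutoff_deriv n x * \<psi> x) \<partial>leb_I) \<le> (\<integral>x. (4 * real n * M * e') * ?i x \<partial>leb_I)"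
      proof (rule order.trans[OF integral_norm_bound integral_mono_AE])
        show "integrable leb_I (\<lambda>x. norm (d x * (cutoff_deriv n x * \<psi> x)))"
          by (intro integrable_norm integrable_leb_I_mult_continuous int continuous_intros
              c\<psi> continuous_cutoff_deriv)
        show "integrable leb_I (\<lambda>x. (4 * real n * M * e') * ?i x)"
          using integral_boundary_layer_indicator(1)[OF h] by simp
        show "AE x in leb_I. norm (d x * (cutoff_deriv n x * \<psi> x)) \<le> (4 * real n * M * e') * ?i x"
          using w(2) AE_leb_I_Ioo
        proof eventually_elim
          fix x assume dx: "d x = w x" and "x \<in> {-1<..<1}"
          then have x: "x \<in> {-1..1}"
            by auto
          show "norm (d x * (cutoff_deriv n x * \<psi> x)) \<le> (4 * real n * M * e') * ?i x"
          proof (cases "1 - 2 / real n \<le> \<bar>x\<bar>")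
            case True
            have "\<bar>w x\<bar> * (\<bar>cutoff_deriv n x\<bar> * \<bar>\<psi> x\<bar>) \<le> e' * (4 * real n * M)"
              using True nh x e' by (intro mult_mono cutoff_deriv_le M \<eta>) auto
            with True show ?thesis
              by (simp add: dx abs_mult mult_ac)
          next
            case False
            then have "2 \<le> real n * (1 - \<bar>x\<bar>)"
              using n0 by (simp add: field_simps)
            then show ?thesis
              using False cutoff_deriv_eq_0[OF x] by simp
          qed
        qed
      qed
      also have "\<dots> \<le> (4 * real n * M * e') * (2 * (2 / real n))"
        unfolding Bochner_Integration.integral_mult_right_zero
        by (rule mult_left_mono[OF integral_boundary_layer_indicator(2)[OF h]]) (use M e' in auto)
      also have "\<dots> = e / 2"
        using n0 M by (simp add: e'_def)
      finally show ?thesis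
        using e by simp
    qed
    then show "\<exists>no. \<forall>n\<ge>no. norm ((\<integral>x. d x * (cutoff_deriv n x * \<psi> x) \<partial>leb_I) - 0) < e"
      by blast
  qed
  have "(\<lambda>n. \<integral>x. ?g x * cutoff n x \<partial>leb_I) \<longlonglongrightarrow> - 0"
    unfolding eq by (intro tendsto_minus lim2)
  with lim1 show ?thesis
    using LIMSEQ_unique by fastforce
qed

text \<open>Energy argument with d = u - U as test function. Only first weak derivatives of
  \<open>u\<close> are available, so the equation for \<open>U\<close> is brought into weak form
  instead, by integrating \<open>d\<close> against U2. Here \<psi> is \<open>U1\<close>, which need
  not vanish at the end points.\<close>

lemma weak_solution_unique:
  assumes weak: "weak_solution \<epsilon> f u u'" and \<epsilon>: "0 < \<epsilon>"
    and U: "\<And>x. (U has_real_derivative U1 x) (at x)" "\<And>x. (U1 has_real_derivative U2 x) (at x)"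
    and cont: "continuous_on UNIV U2" and bc: "U (-1) = 0" "U 1 = 0"
    and ode: "\<And>x. x \<in> {-1<..<1} \<Longrightarrow> - (\<epsilon>\<^sup>2 * U2 x) + U x = f x"
  shows "AE x in leb_I. u x = U x \<and> u' x = U1 x"
proof -
  have cU1: "continuous_on A U1" and cU2: "continuous_on A U2" and cU: "continuous_on A U" for A
    using DERIV_continuous_on[of UNIV U1 U2] DERIV_continuous_on[of UNIV U U1] U cont
    by (auto intro: continuous_on_subset has_field_derivative_at_within)
  have H: "in_H10 U U1"
    by (rule in_H10_classical[OF U(1) cU1 bc])
  define d d' where "d x = u x - U x" and "d' x = u' x - U1 x" for x
  have u: "in_H10 u u'"
    using weak by (simp add: weak_solution_def)
  have d: "in_H10 d d'"
    unfolding d_def[abs_def] d'_def[abs_def] by (rule in_H10_diff[OF u H])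
  have L2: "in_L2 d" "in_L2 d'"
    using d by (auto simp: in_H10_def in_H1_def)
  have int: "integrable leb_I d" "integrable leb_I d'" "integrable leb_I (\<lambda>x. (d x)\<^sup>2)" "integrable leb_I (\<lambda>x. (d' x)\<^sup>2)"
    using L2 by (auto simp: in_L2_imp_integrable) (auto simp: in_L2_def)
  have i: "integrable leb_I (\<lambda>x. d x * U2 x)" "integrable leb_I (\<lambda>x. d' x * U1 x)" "integrable leb_I (\<lambda>x. d x * U x)"
    by (intro integrable_leb_I_mult_continuous int cU cU1 cU2)+
  have "(\<integral>x. \<epsilon>\<^sup>2 * u' x * d' x + u x * d x \<partial>leb_I) = (\<integral>x. f x * d x \<partial>leb_I)"
    using weak d by (simp add: weak_solution_def)
  also have "\<dots> = (\<integral>x. d x * U x - \<epsilon>\<^sup>2 * (d x * U2 x) \<partial>leb_I)"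
  proof (rule Bochner_Integration.integral_cong[OF refl])
    fix x assume "x \<in> space leb_I"
    then have "f x = - (\<epsilon>\<^sup>2 * U2 x) + U x"
      using ode[of x] by simp
    then show "f x * d x = d x * U x - \<epsilon>\<^sup>2 * (d x * U2 x)"
      by (simp only:) (simp add: algebra_simps)
  qed
  also have "\<dots> = (\<integral>x. d x * U x \<partial>leb_I) - \<epsilon>\<^sup>2 * (\<integral>x. d x * U2 x \<partial>leb_I)"
    using i by simp
  also have "(\<integral>x. d x * U2 x \<partial>leb_I) = - (\<integral>x. d' x * U1 x \<partial>leb_I)"
    using in_H10_integration_by_parts[OF d U(2) cont] i by simp
  finally have w: "(\<integral>x. \<epsilon>\<^sup>2 * u' x * d' x + u x * d x \<partial>leb_I)
      = (\<integral>x. d x * U x \<partial>leb_I) + \<epsilon>\<^sup>2 * (\<integral>x. d' x * U1 x \<partial>leb_I)"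
    by simp
  have "(\<integral>x. \<epsilon>\<^sup>2 * u' x * d' x + u x * d x \<partial>leb_I)
      = (\<integral>x. (\<epsilon>\<^sup>2 * (d' x)\<^sup>2 + (d x)\<^sup>2) + (d x * U x + \<epsilon>\<^sup>2 * (d' x * U1 x)) \<partial>leb_I)"
    by (rule Bochner_Integration.integral_cong[OF refl]) (simp add: d_def d'_def power2_eq_square algebra_simps)
  also have "\<dots> = (\<integral>x. \<epsilon>\<^sup>2 * (d' x)\<^sup>2 + (d x)\<^sup>2 \<partial>leb_I)
      + ((\<integral>x. d x * U x \<partial>leb_I) + \<epsilon>\<^sup>2 * (\<integral>x. d' x * U1 x \<partial>leb_I))"
    using i int by simp
  finally have 0: "(\<integral>x. \<epsilon>\<^sup>2 * (d' x)\<^sup>2 + (d x)\<^sup>2 \<partial>leb_I) = 0"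
    using w by simp
  have "AE x in leb_I. \<epsilon>\<^sup>2 * (d' x)\<^sup>2 + (d x)\<^sup>2 = 0"
    using 0 int by (subst integral_nonneg_eq_0_iff_AE[symmetric]) auto
  then show ?thesis
    by eventually_elim
       (use \<epsilon> in \<open>auto simp: d_def d'_def add_nonneg_eq_0_iff\<close>)
qed

section \<open>Sigmoid networks\<close>

lemma sigmoid_pos: "0 < sigmoid x" and sigmoid_less_1: "sigmoid x < 1"
  by (simp_all add: sigmoid_def add_pos_pos field_simps)

lemma DERIV_sigmoid: "(sigmoid has_real_derivative sigmoid x * (1 - sigmoid x)) (at x)"
proof -
  have "1 + exp (- x) \<noteq> 0"
    using exp_gt_zero[of "- x"] by linarith
  then have "((\<lambda>x. 1 / (1 + exp (- x))) has_real_derivative exp (- x) / (1 + exp (- x))\<^sup>2) (at x)"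
    by (auto intro!: derivative_eq_intros simp: power2_eq_square)
  moreover have "exp (- x) / (1 + exp (- x))\<^sup>2 = sigmoid x * (1 - sigmoid x)"
    using \<open>1 + exp (- x) \<noteq> 0\<close> by (simp add: sigmoid_def field_simps power2_eq_square)
  ultimately show ?thesis
    unfolding sigmoid_def[abs_def] by simp
qed

lemmas DERIV_sigmoid_comp [derivative_intros] = DERIV_chain2[OF DERIV_sigmoid]

lemma continuous_on_sigmoid [continuous_intros]:
  "continuous_on A f \<Longrightarrow> continuous_on A (\<lambda>x. sigmoid (f x))"
  by (rule continuous_on_compose2[OF DERIV_continuous_on[of UNIV sigmoid]])
     (auto intro: DERIV_sigmoid)

lemma real_derivative_bound:
  fixes f :: "real \<Rightarrow> real"
  assumes "\<And>t. t \<in> {a..b} \<Longrightarrow> (f has_real_derivative f' t) (at t)"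
    and "\<And>t. t \<in> {a..b} \<Longrightarrow> \<bar>f' t\<bar> \<le> B" and "x \<in> {a..b}" "y \<in> {a..b}"
  shows "\<bar>f x - f y\<bar> \<le> B * \<bar>x - y\<bar>"
  using field_differentiable_bound[of "{a..b}" f f' B x y] assms
  by (auto intro: has_field_derivative_at_within)

fun chain_eval :: "(real \<times> real) list \<Rightarrow> real \<Rightarrow> real" where
  "chain_eval [] x = x"
| "chain_eval ((\<alpha>, \<gamma>) # cs) x = chain_eval cs (sigmoid (\<alpha> * x + \<gamma>))"

lemma chain_eval_snoc:
  "chain_eval (cs @ [(\<alpha>, \<gamma>)]) x = sigmoid (\<alpha> * chain_eval cs x + \<gamma>)"
  by (induction cs x rule: chain_eval.induct) auto

text \<open>At the origin the sigmoid is 1/2 + t/4 up to higher order. The quadratic rate comes from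
  4 s (1 - s) - 1 = - (2 s - 1)^2 together with |2 s - 1| \<le> 2 |t|, and the bound on values
  follows by integrating from 0. The range |z| \<le> 2 leaves room for the error that earlier layers
  add to x in [-1,1].\<close>

lemma sigmoid_near_identity:
  assumes h: "0 < h" and z: "\<bar>z\<bar> \<le> 2"
  shows "\<bar>4 * (sigmoid (h * z) * (1 - sigmoid (h * z))) - 1\<bar> \<le> 16 * h\<^sup>2"
    "\<bar>(4 * sigmoid (h * z) - 2) / h - z\<bar> \<le> 32 * h\<^sup>2"
proof -
  have lip: "\<bar>2 * sigmoid t - 1\<bar> \<le> 2 * \<bar>t\<bar>" for t
  proof -
    have "\<bar>sigmoid t - sigmoid 0\<bar> \<le> 1 * \<bar>t - 0\<bar>"
    proof (rule real_derivative_bound[OF DERIV_sigmoid])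
      show "\<bar>sigmoid s * (1 - sigmoid s)\<bar> \<le> 1" for s
        using sigmoid_pos[of s] sigmoid_less_1[of s] mult_mono[of "sigmoid s" 1 "1 - sigmoid s" 1]
        by (simp add: abs_mult)
      show "t \<in> {- \<bar>t\<bar>..\<bar>t\<bar>}" "0 \<in> {- \<bar>t\<bar>..\<bar>t\<bar>}"
        by auto
    qed
    then show ?thesis
      by (simp add: sigmoid_def)
  qed
  have deriv: "\<bar>4 * (sigmoid (h * y) * (1 - sigmoid (h * y))) - 1\<bar> \<le> 16 * h\<^sup>2" if "\<bar>y\<bar> \<le> 2" for y
  proof -
    have "\<bar>2 * sigmoid (h * y) - 1\<bar> \<le> 2 * (h * 2)"
    proof -
      have "\<bar>h * y\<bar> \<le> h * 2"
        unfolding abs_mult using h that by (intro mult_mono) auto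
      then show ?thesis
        using lip[of "h * y"] by linarith
    qed
    then have "\<bar>2 * sigmoid (h * y) - 1\<bar>\<^sup>2 \<le> (2 * (h * 2))\<^sup>2"
      by (rule power_mono) simp
    moreover have "4 * (sigmoid (h * y) * (1 - sigmoid (h * y))) - 1 = - (2 * sigmoid (h * y) - 1)\<^sup>2"
      by (simp add: power2_eq_square algebra_simps)
    ultimately show ?thesis
      by (simp add: power_mult_distrib)
  qed
  then show "\<bar>4 * (sigmoid (h * z) * (1 - sigmoid (h * z))) - 1\<bar> \<le> 16 * h\<^sup>2"
    using z .
  have "\<bar>((4 * sigmoid (h * z) - 2) / h - z) - ((4 * sigmoid (h * 0) - 2) / h - 0)\<bar> \<le> 16 * h\<^sup>2 * \<bar>z - 0\<bar>"
  proof (rule real_derivative_bound[where a = "-2" and b = 2])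
    show "((\<lambda>z. (4 * sigmoid (h * z) - 2) / h - z) has_real_derivative
        4 * (sigmoid (h * t) * (1 - sigmoid (h * t))) - 1) (at t)" for t
      using h by (auto intro!: derivative_eq_intros)
  qed (use z deriv in auto)
  also have "\<dots> \<le> 16 * h\<^sup>2 * 2"
    using z by (intro mult_left_mono) auto
  finally show "\<bar>(4 * sigmoid (h * z) - 2) / h - z\<bar> \<le> 32 * h\<^sup>2"
    by (simp add: sigmoid_def)
qed

section \<open>The identity through layers of one neuron\<close>

text \<open>The affine readout \<alpha> y + \<gamma> is not a layer of its own: it is multiplied
  into the weight and bias of the next neuron, as \<open>h * \<alpha>\<close> and
  \<open>h * \<gamma>\<close>.\<close>

lemma identity_chain:
  assumes "0 < \<delta>"
  shows "\<exists>cs \<alpha> \<gamma> G'. length cs = m \<and> continuous_on UNIV G' \<and>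
    (\<forall>x. ((\<lambda>x. \<alpha> * chain_eval cs x + \<gamma>) has_real_derivative G' x) (at x)) \<and>
    (\<forall>x\<in>{-1..1}. \<bar>\<alpha> * chain_eval cs x + \<gamma> - x\<bar> \<le> \<delta> \<and> \<bar>G' x - 1\<bar> \<le> \<delta>)"
  using assms
proof (induction m arbitrary: \<delta>)
  case 0
  show ?case
    using 0 by (intro exI[of _ "[]"] exI[of _ 1] exI[of _ 0] exI[of _ "\<lambda>_. 1"])
      (auto intro!: derivative_eq_intros)
next
  case (Suc m)
  \<comment> \<open>At most 1/2, so that the previous readout and its derivative stay within [-2,2];
    at most \<delta>/2, so that the old error \<eta> and the new error, at most \<eta>/2, add up to
    less than \<delta>.\<close>
  define \<eta> where "\<eta> = min \<delta> 1 / 2"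
  have \<eta>: "0 < \<eta>" "\<eta> \<le> 1 / 2" "2 * \<eta> \<le> \<delta>"
    using Suc.prems by (auto simp: \<eta>_def)
  from Suc.IH[OF \<eta>(1)] obtain cs \<alpha> \<gamma> G' where IH: "length cs = m" "continuous_on UNIV G'"
    "\<And>x. ((\<lambda>x. \<alpha> * chain_eval cs x + \<gamma>) has_real_derivative G' x) (at x)"
    "\<And>x. x \<in> {-1..1} \<Longrightarrow> \<bar>\<alpha> * chain_eval cs x + \<gamma> - x\<bar> \<le> \<eta>"
    "\<And>x. x \<in> {-1..1} \<Longrightarrow> \<bar>G' x - 1\<bar> \<le> \<eta>"
    by blast
  define G where "G x = \<alpha> * chain_eval cs x + \<gamma>" for x
  have G: "(G has_real_derivative G' x) (at x)" for x
    using IH(3) unfolding G_def .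
  \<comment> \<open>Turns the bounds 16 h^2 and 32 h^2 of \<open>sigmoid_near_identity\<close> into
    \<eta>/4 and \<eta>/2.\<close>
  define h where "h = sqrt (\<eta> / 64)"
  have h: "0 < h" "h\<^sup>2 = \<eta> / 64"
    using \<eta> by (auto simp: h_def)
  define R where "R x = 4 / h * sigmoid (h * G x) + (- 2 / h)" for x
  define R' where "R' x = 4 * (sigmoid (h * G x) * (1 - sigmoid (h * G x))) * G' x" for x
  have chain: "4 / h * chain_eval (cs @ [(h * \<alpha>, h * \<gamma>)]) x + (- 2 / h) = R x" for x
    by (simp add: chain_eval_snoc R_def G_def algebra_simps)
  have R: "(R has_real_derivative R' x) (at x)" for x
    unfolding R_def R'_def using h by (auto intro!: derivative_eq_intros G)
  have contG: "continuous_on UNIV G"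
    by (rule DERIV_continuous_on[of _ _ G']) (simp add: G)
  have "\<bar>R x - x\<bar> \<le> \<delta> \<and> \<bar>R' x - 1\<bar> \<le> \<delta>" if x: "x \<in> {-1..1}" for x
  proof -
    have Gx: "\<bar>G x - x\<bar> \<le> \<eta>" "\<bar>G' x - 1\<bar> \<le> \<eta>"
      using IH(4,5)[OF x] by (auto simp: G_def)
    then have G2: "\<bar>G x\<bar> \<le> 2" "\<bar>G' x\<bar> \<le> 2"
      using x \<eta> by auto
    note near = sigmoid_near_identity[OF h(1) G2(1), unfolded h(2)]
    have "\<bar>R x - G x\<bar> \<le> \<eta> / 2"
      using near(2) by (simp add: R_def diff_divide_distrib)
    with Gx \<eta> have "\<bar>R x - x\<bar> \<le> \<delta>"
      by linarith
    moreover have "\<bar>R' x - G' x\<bar> \<le> \<eta> / 4 * 2"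
    proof -
      have "R' x - G' x = (4 * (sigmoid (h * G x) * (1 - sigmoid (h * G x))) - 1) * G' x"
        by (simp add: R'_def algebra_simps)
      then have "\<bar>R' x - G' x\<bar> = \<bar>4 * (sigmoid (h * G x) * (1 - sigmoid (h * G x))) - 1\<bar> * \<bar>G' x\<bar>"
        by (simp only: abs_mult)
      also have "\<dots> \<le> \<eta> / 4 * 2"
        using near(1) G2 \<eta> by (intro mult_mono) auto
      finally show ?thesis .
    qed
    with Gx \<eta> have "\<bar>R' x - 1\<bar> \<le> \<delta>"
      by linarith
    ultimately show ?thesis ..
  qed
  moreover have "continuous_on UNIV R'"
    unfolding R'_def by (intro continuous_intros contG IH(2))
  ultimately show ?case
    using R IH(1)
    by (intro exI[of _ "cs @ [(h * \<alpha>, h * \<gamma>)]"] exI[of _ "4 / h"] exI[of _ "- 2 / h"] exI[of _ R'])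
       (simp only: chain, simp)
qed

section \<open>Exponentials from one neuron, monomials from exponentials\<close>

text \<open>With s = sigmoid (z - T) one has exp T * s = exp z * (1 - s) exactly, and s \<le> exp (z
  - T) is tiny for large \<open>T\<close>; the derivative brings in a second factor 1 - s. One
  \<open>T\<close> and one tolerance \<eta> serve all slopes |a| \<le> A, and the input
  \<open>g\<close> need only be close to \<open>x\<close>, as the identity chain provides.\<close>

lemma exp_neuron:
  assumes A: "0 \<le> A" and \<delta>: "0 < \<delta>"
  obtains T \<eta> where "0 < \<eta>"
    "\<And>a g g' x. \<bar>a\<bar> \<le> A \<Longrightarrow> x \<in> {-1..1} \<Longrightarrow> \<bar>g - x\<bar> \<le> \<eta> \<Longrightarrow> \<bar>g' - 1\<bar> \<le> \<eta> \<Longrightarrow>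
       \<bar>exp T * sigmoid (a * g - T) - exp (a * x)\<bar> \<le> \<delta> \<and>
       \<bar>exp T * (sigmoid (a * g - T) * (1 - sigmoid (a * g - T)) * (a * g')) - a * exp (a * x)\<bar> \<le> \<delta>"
proof -
  \<comment> \<open>\<open>E\<close> bounds exp z, since |a g| \<le> 2 A. \<open>T\<close> and
    \<eta> are chosen so that saturation and input error each take \<delta>/2, including a factor 1
    + A that covers the multiplication by \<open>a\<close> in the derivative.\<close>
  define E where "E = exp (2 * A)"
  define T where "T = ln (8 * (1 + A) * E\<^sup>2 / \<delta>)"
  define \<eta> where "\<eta> = min 1 (\<delta> / (2 * (1 + A)\<^sup>2 * E))"
  have E: "0 < E" "1 \<le> E"
    using A by (auto simp: E_def)
  have \<eta>: "0 < \<eta>" "\<eta> \<le> 1" "(1 + A) * (E * (1 + A) * \<eta>) \<le> \<delta> / 2"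
  proof -
    show "0 < \<eta>" "\<eta> \<le> 1"
      using \<delta> A E by (auto simp: \<eta>_def)
    have "(2 * (1 + A)\<^sup>2 * E) * \<eta> \<le> (2 * (1 + A)\<^sup>2 * E) * (\<delta> / (2 * (1 + A)\<^sup>2 * E))"
      using E by (intro mult_left_mono) (auto simp: \<eta>_def)
    also have "\<dots> = \<delta>"
      using E A by simp
    finally show "(1 + A) * (E * (1 + A) * \<eta>) \<le> \<delta> / 2"
      by (simp add: power2_eq_square mult_ac)
  qed
  have "0 < 8 * (1 + A) * E\<^sup>2 / \<delta>"
    using E A \<delta> by simp
  then have expT: "exp (- T) = \<delta> / (8 * (1 + A) * E\<^sup>2)"
    by (simp add: T_def exp_minus)
  have T: "(1 + A) * (4 * (E\<^sup>2 * exp (- T))) = \<delta> / 2"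
  proof -
    define q where "q = (1 + A) * E\<^sup>2"
    have "q \<noteq> 0"
      using E A by (simp add: q_def)
    then have "4 * q * (\<delta> / (8 * q)) = \<delta> / 2"
      by simp
    moreover have "exp (- T) = \<delta> / (8 * q)"
      unfolding expT q_def by (simp only: mult.assoc)
    ultimately have "4 * q * exp (- T) = \<delta> / 2"
      by (simp only:)
    then show ?thesis
      by (simp add: q_def mult_ac)
  qed
  show ?thesis
  proof (rule that[OF \<eta>(1), of T])
    fix a g g' x :: real
    assume a: "\<bar>a\<bar> \<le> A" and x: "x \<in> {-1..1}" and g: "\<bar>g - x\<bar> \<le> \<eta>" and g': "\<bar>g' - 1\<bar> \<le> \<eta>"
    define z where "z = a * g"
    define s where "s = sigmoid (z - T)"
    have gx: "\<bar>g\<bar> \<le> 2" "\<bar>g'\<bar> \<le> 2" "\<bar>x\<bar> \<le> 2"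
      using g g' x \<eta> by auto
    have zb: "\<bar>z\<bar> \<le> 2 * A" "\<bar>a * x\<bar> \<le> 2 * A"
      using mult_mono[OF a gx(1)] mult_mono[OF a gx(3)] A by (auto simp: z_def abs_mult)
    have s: "0 < s" "s < 1"
      by (auto simp: s_def sigmoid_pos sigmoid_less_1)
    have eTs: "exp T * s = exp z * (1 - s)"
    proof -
      have "1 + exp (- (z - T)) \<noteq> 0"
        using exp_gt_zero[of "- (z - T)"] by linarith
      then show ?thesis
        by (simp add: s_def sigmoid_def field_simps exp_diff)
    qed
    have ez: "exp z \<le> E"
      using zb by (simp add: E_def)
    have "exp T * s \<le> exp z"
      unfolding eTs using s by (simp add: mult_left_le)
    then have "s \<le> exp (z - T)"
      by (simp add: exp_diff field_simps)
    also have "\<dots> = exp z * exp (- T)"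
      by (simp flip: exp_add)
    finally have "exp z * s \<le> E * (E * exp (- T))"
      using ez s E by (intro mult_mono order.trans[OF _ mult_right_mono[OF ez]]) auto
    then have zs: "exp z * s \<le> E\<^sup>2 * exp (- T)"
      by (simp add: power2_eq_square mult_ac)
    have diff: "\<bar>exp z - exp (a * x)\<bar> \<le> E * A * \<eta>"
    proof -
      have "\<bar>exp z - exp (a * x)\<bar> \<le> E * \<bar>z - a * x\<bar>"
      proof (rule real_derivative_bound)
        show "(exp has_real_derivative exp t) (at t)" for t :: real
          by (rule DERIV_exp)
        show "z \<in> {- 2 * A..2 * A}" "a * x \<in> {- 2 * A..2 * A}"
          using zb by (auto simp: abs_le_iff)
      qed (auto simp: E_def)
      also have "\<bar>z - a * x\<bar> = \<bar>a\<bar> * \<bar>g - x\<bar>"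
        by (simp add: z_def abs_mult flip: right_diff_distrib)
      also have "E * (\<bar>a\<bar> * \<bar>g - x\<bar>) \<le> E * (A * \<eta>)"
        using a g A E by (intro mult_left_mono mult_mono) auto
      finally show ?thesis
        by (simp add: mult_ac)
    qed
    have p1: "E\<^sup>2 * exp (- T) \<le> 4 * (E\<^sup>2 * exp (- T))" "0 \<le> E\<^sup>2 * exp (- T)"
      by auto
    have total: "4 * (E\<^sup>2 * exp (- T)) + E * (1 + A) * \<eta> \<le> \<delta>"
      "A * (4 * (E\<^sup>2 * exp (- T)) + E * (1 + A) * \<eta>) \<le> \<delta>"
    proof -
      let ?X = "4 * (E\<^sup>2 * exp (- T)) + E * (1 + A) * \<eta>"
      have X: "(1 + A) * ?X \<le> \<delta>"
        using T \<eta>(3) by (simp only: distrib_left[of "1 + A"])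
      have "0 \<le> ?X"
        using E A \<eta> by (intro add_nonneg_nonneg) auto
      with X A show "?X \<le> \<delta>" "A * ?X \<le> \<delta>"
        using mult_nonneg_nonneg[of A ?X] unfolding distrib_right[of 1 A ?X] mult_1_left by linarith+
    qed
    have "\<bar>exp T * s - exp z\<bar> = exp z * s"
      unfolding eTs using s by (simp add: algebra_simps abs_mult)
    then have "\<bar>exp T * s - exp (a * x)\<bar> \<le> 4 * (E\<^sup>2 * exp (- T)) + E * A * \<eta>"
      using zs diff p1 by linarith
    also have "\<dots> \<le> \<delta>"
    proof -
      have "E * (1 + A) * \<eta> = E * \<eta> + E * A * \<eta>"
        by (simp add: algebra_simps)
      then show ?thesis
        using total(1) mult_nonneg_nonneg[of E \<eta>] E \<eta> by linarith
    qed
    finally have 1: "\<bar>exp T * s - exp (a * x)\<bar> \<le> \<delta>" .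
    define X where "X = exp T * (s * (1 - s))"
    have "X = exp z * (1 - s) * (1 - s)"
      by (simp only: X_def mult.assoc[symmetric] eTs)
    then have "X - exp z = - (exp z * s * (2 - s))"
      by (simp add: algebra_simps)
    then have "\<bar>X - exp z\<bar> = exp z * s * (2 - s)"
      using s by (simp add: abs_mult)
    also have "\<dots> \<le> exp z * s * 2"
      using s by (intro mult_left_mono) auto
    finally have X: "\<bar>X - exp z\<bar> \<le> 2 * (E\<^sup>2 * exp (- T))"
      using zs by linarith
    have "X * g' - exp (a * x) = (X - exp z) * g' + exp z * (g' - 1) + (exp z - exp (a * x))"
      by (simp add: algebra_simps)
    then have "\<bar>X * g' - exp (a * x)\<bar> \<le> \<bar>X - exp z\<bar> * \<bar>g'\<bar> + exp z * \<bar>g' - 1\<bar> + \<bar>exp z - exp (a * x)\<bar>"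
      using abs_triangle_ineq[of "(X - exp z) * g' + exp z * (g' - 1)" "exp z - exp (a * x)"]
        abs_triangle_ineq[of "(X - exp z) * g'" "exp z * (g' - 1)"]
      unfolding abs_mult abs_exp_cancel by linarith
    also have "\<dots> \<le> 2 * (E\<^sup>2 * exp (- T)) * 2 + E * \<eta> + E * A * \<eta>"
      using X gx ez g' diff E \<eta> by (intro add_mono mult_mono) auto
    also have "\<dots> = 4 * (E\<^sup>2 * exp (- T)) + E * (1 + A) * \<eta>"
      by (simp add: algebra_simps)
    finally have "\<bar>a\<bar> * \<bar>X * g' - exp (a * x)\<bar> \<le> A * (4 * (E\<^sup>2 * exp (- T)) + E * (1 + A) * \<eta>)"
      using a A by (intro mult_mono) auto
    also have "\<bar>a\<bar> * \<bar>X * g' - exp (a * x)\<bar> = \<bar>exp T * (s * (1 - s) * (a * g')) - a * exp (a * x)\<bar>"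
    proof -
      have "exp T * (s * (1 - s) * (a * g')) - a * exp (a * x) = a * (X * g' - exp (a * x))"
        by (simp add: X_def algebra_simps)
      then show ?thesis
        by (simp only: abs_mult)
    qed
    finally show "\<bar>exp T * sigmoid (a * g - T) - exp (a * x)\<bar> \<le> \<delta> \<and>
       \<bar>exp T * (sigmoid (a * g - T) * (1 - sigmoid (a * g - T)) * (a * g')) - a * exp (a * x)\<bar> \<le> \<delta>"
      using 1 total(2) by (auto simp: s_def z_def)
  qed
qed

lemma power_diff_le:
  fixes a b :: real
  assumes "\<bar>a\<bar> \<le> 2" "\<bar>b\<bar> \<le> 2"
  shows "\<bar>a ^ n - b ^ n\<bar> \<le> real n * 2 ^ n * \<bar>a - b\<bar>"
proof (induction n)
  case (Suc n)
  have "a ^ Suc n - b ^ Suc n = a * (a ^ n - b ^ n) + (a - b) * b ^ n"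
    by (simp add: algebra_simps)
  then have "\<bar>a ^ Suc n - b ^ Suc n\<bar> \<le> \<bar>a\<bar> * \<bar>a ^ n - b ^ n\<bar> + \<bar>a - b\<bar> * \<bar>b\<bar> ^ n"
    by (metis abs_mult abs_triangle_ineq power_abs)
  also have "\<dots> \<le> 2 * (real n * 2 ^ n * \<bar>a - b\<bar>) + \<bar>a - b\<bar> * 2 ^ n"
    using assms Suc by (intro add_mono mult_mono power_mono) auto
  also have "\<dots> \<le> 2 * (real n * 2 ^ n * \<bar>a - b\<bar>) + \<bar>a - b\<bar> * 2 ^ Suc n"
    by (intro add_left_mono mult_left_mono) auto
  finally show ?case
    by (simp add: algebra_simps)
qed simp

text \<open>The binomial theorem expands ((exp (h x) - 1) / h)^i into exponentials with frequencies
  0, h, ..., i h. These are shared by all \<open>i\<close>, so p + 1 neurons yield all monomials and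
  the size stays linear in \<open>p\<close>. The coefficients are of order h^(-i), which does no
  harm because the accuracy of the neurons is fixed only afterwards.\<close>

lemma monomials_by_exponentials:
  assumes \<delta>: "0 < \<delta>"
  obtains h c where "0 < (h :: real)"
    "\<And>i x. i \<le> p \<Longrightarrow> x \<in> {-1..1} \<Longrightarrow>
       \<bar>(\<Sum>j\<le>p. c i j * exp (real j * h * x)) - x ^ i\<bar> \<le> \<delta> \<and>
       \<bar>(\<Sum>j\<le>p. c i j * (real j * h * exp (real j * h * x))) - real i * x ^ (i - 1)\<bar> \<le> \<delta>"
proof -
  \<comment> \<open>The derivative error is at most (p + 1) (2^p 3h + p 2^p 3h) = K h, and the error
    of the values is smaller. The condition h \<le> 1/3 below keeps |y x| \<le> 2.\<close>
  define K where "K = 3 * (real p + 1)\<^sup>2 * 2 ^ p"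
  have K: "0 < K"
    by (simp add: K_def add_pos_nonneg)
  define h where "h = min (1/3) (\<delta> / K)"
  have h: "0 < h" "h \<le> 1/3" "K * h \<le> \<delta>"
    using \<delta> K by (auto simp: h_def min_def field_simps)
  define c where "c i j = (if j \<le> i then real (i choose j) * (-1) ^ (i - j) / h ^ i else 0)" for i j
  define y where "y x = (exp (h * x) - 1) / h" for x
  have sum_c: "(\<Sum>j\<le>p. c i j * exp (real j * h * x)) = y x ^ i" if "i \<le> p" for i x
  proof -
    have "(exp (h * x) + (-1)) ^ i = (\<Sum>j\<le>i. real (i choose j) * exp (h * x) ^ j * (-1) ^ (i - j))"
      by (rule binomial_ring)
    then have "y x ^ i = (\<Sum>j\<le>i. c i j * exp (real j * h * x))"
      by (simp add: y_def power_divide c_def sum_divide_distrib mult_ac flip: exp_of_nat_mult)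
    also have "\<dots> = (\<Sum>j\<le>p. c i j * exp (real j * h * x))"
      using that by (intro sum.mono_neutral_left) (auto simp: c_def)
    finally show ?thesis ..
  qed
  have dy: "(y has_real_derivative exp (h * x)) (at x)" for x
    unfolding y_def using h by (auto intro!: derivative_eq_intros)
  have dsum: "(\<Sum>j\<le>p. c i j * (real j * h * exp (real j * h * x))) = real i * (y x ^ (i - 1) * exp (h * x))"
    if "i \<le> p" for i x
  proof (rule DERIV_unique)
    show "((\<lambda>x. y x ^ i) has_real_derivative real i * (y x ^ (i - 1) * exp (h * x))) (at x)"
      by (auto intro!: derivative_eq_intros dy)
    have "((\<lambda>x. \<Sum>j\<le>p. c i j * exp (real j * h * x)) has_real_derivative
        (\<Sum>j\<le>p. c i j * (real j * h * exp (real j * h * x)))) (at x)"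
      by (auto intro!: derivative_eq_intros sum.cong simp: mult_ac)
    then show "((\<lambda>x. y x ^ i) has_real_derivative (\<Sum>j\<le>p. c i j * (real j * h * exp (real j * h * x)))) (at x)"
      using sum_c[OF that] by simp
  qed
  have e1: "\<bar>exp (h * x) - 1\<bar> \<le> 3 * h" if x: "x \<in> {-1..1}" for x
  proof -
    have "\<bar>exp (h * x) - exp 0\<bar> \<le> 3 * \<bar>h * x - 0\<bar>"
    proof (rule real_derivative_bound)
      show "(exp has_real_derivative exp t) (at t)" for t :: real
        by (rule DERIV_exp)
      show "\<bar>exp t\<bar> \<le> 3" if "t \<in> {-1..1::real}" for t
        using that exp_le order.trans[of "exp t" "exp 1" 3] by auto
      have "\<bar>h * x\<bar> \<le> 1 * 1"
        unfolding abs_mult using x h by (intro mult_mono) auto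
      then show "h * x \<in> {-1..1}"
        by auto
    qed auto
    also have "\<dots> \<le> 3 * (h * 1)"
      using h abs_le_iff[of x 1] x by (simp add: abs_mult)
    finally show ?thesis
      by simp
  qed
  have yx: "\<bar>y x - x\<bar> \<le> 3 * h" if x: "x \<in> {-1..1}" for x
  proof -
    have "\<bar>(y x - x) - (y 0 - 0)\<bar> \<le> 3 * h * \<bar>x - 0\<bar>"
      by (rule real_derivative_bound[where a = "-1" and b = 1 and f' = "\<lambda>x. exp (h * x) - 1"])
         (use x e1 in \<open>auto intro!: derivative_eq_intros dy\<close>)
    also have "\<dots> \<le> 3 * h * 1"
      using x h by (intro mult_left_mono) auto
    finally show ?thesis
      by (simp add: y_def)
  qed
  show ?thesis
  proof (rule that[OF h(1), of c])
    fix i x assume i: "i \<le> p" and x: "x \<in> {-1..1::real}"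
    have b: "\<bar>y x\<bar> \<le> 2" "\<bar>x\<bar> \<le> 2"
      using yx[OF x] x h by auto
    have pow: "\<bar>y x ^ k - x ^ k\<bar> \<le> real p * 2 ^ p * (3 * h)" if "k \<le> p" for k
    proof -
      have "\<bar>y x ^ k - x ^ k\<bar> \<le> real k * 2 ^ k * \<bar>y x - x\<bar>"
        by (rule power_diff_le[OF b])
      also have "\<dots> \<le> real p * 2 ^ p * (3 * h)"
        using that yx[OF x] h by (intro mult_mono) (auto intro!: power_increasing)
      finally show ?thesis .
    qed
    have "real p * 2 ^ p * (3 * h) \<le> K * h"
    proof -
      have "real p \<le> (real p + 1)\<^sup>2"
        by (simp add: power2_eq_square algebra_simps)
      then have "(3 * 2 ^ p * h) * real p \<le> (3 * 2 ^ p * h) * (real p + 1)\<^sup>2"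
        using h by (intro mult_left_mono) auto
      then show ?thesis
        by (simp add: K_def mult_ac)
    qed
    then have val: "\<bar>(\<Sum>j\<le>p. c i j * exp (real j * h * x)) - x ^ i\<bar> \<le> \<delta>"
      unfolding sum_c[OF i] using pow[OF i] h(3) by linarith
    have "y x ^ (i - 1) * exp (h * x) - x ^ (i - 1) = y x ^ (i - 1) * (exp (h * x) - 1) + (y x ^ (i - 1) - x ^ (i - 1))"
      by (simp add: algebra_simps)
    then have "\<bar>y x ^ (i - 1) * exp (h * x) - x ^ (i - 1)\<bar> \<le> \<bar>y x\<bar> ^ (i - 1) * \<bar>exp (h * x) - 1\<bar> + \<bar>y x ^ (i - 1) - x ^ (i - 1)\<bar>"
      by (metis abs_mult abs_triangle_ineq power_abs)
    also have "\<dots> \<le> 2 ^ p * (3 * h) + real p * 2 ^ p * (3 * h)"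
    proof (intro add_mono mult_mono pow e1[OF x])
      have "\<bar>y x\<bar> ^ (i - 1) \<le> 2 ^ (i - 1)"
        using b by (intro power_mono) auto
      also have "\<dots> \<le> 2 ^ p"
        using i by (intro power_increasing) auto
      finally show "\<bar>y x\<bar> ^ (i - 1) \<le> 2 ^ p" .
    qed (use i in auto)
    finally have "real i * \<bar>y x ^ (i - 1) * exp (h * x) - x ^ (i - 1)\<bar>
        \<le> (real p + 1) * (2 ^ p * (3 * h) + real p * 2 ^ p * (3 * h))"
      using i by (intro mult_mono) auto
    also have "\<dots> = K * h"
      by (simp add: K_def power2_eq_square algebra_simps)
    finally have "\<bar>(\<Sum>j\<le>p. c i j * (real j * h * exp (real j * h * x))) - real i * x ^ (i - 1)\<bar> \<le> \<delta>"
      unfolding dsum[OF i] using h(3) by (simp add: abs_mult flip: right_diff_distrib)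
    with val show "\<bar>(\<Sum>j\<le>p. c i j * exp (real j * h * x)) - x ^ i\<bar> \<le> \<delta> \<and>
       \<bar>(\<Sum>j\<le>p. c i j * (real j * h * exp (real j * h * x))) - real i * x ^ (i - 1)\<bar> \<le> \<delta>" ..
  qed
qed

text \<open>The exponentials are not normalised at the end points; the factor exp (-1/\<epsilon>) is
  put into the output weights instead.\<close>

definition layer_basis :: "nat \<Rightarrow> real \<Rightarrow> nat \<Rightarrow> real \<Rightarrow> real" where
  "layer_basis p \<epsilon> i x = (if i \<le> p then x ^ i else if i = Suc p then exp (- x / \<epsilon>) else exp (x / \<epsilon>))"

definition layer_basis_deriv :: "nat \<Rightarrow> real \<Rightarrow> nat \<Rightarrow> real \<Rightarrow> real" where
  "layer_basis_deriv p \<epsilon> i x =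
     (if i \<le> p then real i * x ^ (i - 1)
      else if i = Suc p then - exp (- x / \<epsilon>) / \<epsilon> else exp (x / \<epsilon>) / \<epsilon>)"

lemma layer_basis_by_exponentials:
  assumes "0 < \<delta>"
  obtains a :: "nat \<Rightarrow> real" and c :: "nat \<Rightarrow> nat \<Rightarrow> real" where
    "\<And>i x. i < p + 3 \<Longrightarrow> x \<in> {-1..1} \<Longrightarrow>
       \<bar>(\<Sum>j<p+3. c i j * exp (a j * x)) - layer_basis p \<epsilon> i x\<bar> \<le> \<delta> \<and>
       \<bar>(\<Sum>j<p+3. c i j * (a j * exp (a j * x))) - layer_basis_deriv p \<epsilon> i x\<bar> \<le> \<delta>"
proof -
  obtain h b where hb: "0 < (h :: real)"
    "\<And>i x. i \<le> p \<Longrightarrow> x \<in> {-1..1} \<Longrightarrow>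
       \<bar>(\<Sum>j\<le>p. b i j * exp (real j * h * x)) - x ^ i\<bar> \<le> \<delta> \<and>
       \<bar>(\<Sum>j\<le>p. b i j * (real j * h * exp (real j * h * x))) - real i * x ^ (i - 1)\<bar> \<le> \<delta>"
    using monomials_by_exponentials[OF assms, of p] by blast
  define a where "a j = (if j \<le> p then real j * h else if j = Suc p then - 1 / \<epsilon> else 1 / \<epsilon>)" for j
  define c where "c i j = (if i \<le> p then (if j \<le> p then b i j else 0) else if i = j then 1 else 0)" for i j
  have poly: "(\<Sum>j<p+3. c i j * g j) = (\<Sum>j\<le>p. b i j * g j)" if "i \<le> p" for i and g :: "nat \<Rightarrow> real"
    using that by (intro sum.mono_neutral_cong_right) (auto simp: c_def)
  have layer: "(\<Sum>j<p+3. c i j * g j) = g i" if "\<not> i \<le> p" "i < p + 3" for i and g :: "nat \<Rightarrow> real"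
  proof -
    have "(\<Sum>j<p+3. c i j * g j) = (\<Sum>j<p+3. if j = i then g j else 0)"
      using that by (intro sum.cong) (auto simp: c_def)
    then show ?thesis
      using that by simp
  qed
  show thesis
  proof (rule that[of c a])
    fix i x assume i: "i < p + 3" and x: "x \<in> {-1..1::real}"
    show "\<bar>(\<Sum>j<p+3. c i j * exp (a j * x)) - layer_basis p \<epsilon> i x\<bar> \<le> \<delta> \<and>
       \<bar>(\<Sum>j<p+3. c i j * (a j * exp (a j * x))) - layer_basis_deriv p \<epsilon> i x\<bar> \<le> \<delta>"
    proof (cases "i \<le> p")
      case True
      have "(\<Sum>j\<le>p. b i j * exp (a j * x)) = (\<Sum>j\<le>p. b i j * exp (real j * h * x))"
        "(\<Sum>j\<le>p. b i j * (a j * exp (a j * x))) = (\<Sum>j\<le>p. b i j * (real j * h * exp (real j * h * x)))"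
        by (intro sum.cong; simp add: a_def)+
      with hb(2)[OF True x] True show ?thesis
        by (simp add: poly layer_basis_def layer_basis_deriv_def)
    next
      case False
      with i assms show ?thesis
        by (auto simp: layer layer_basis_def layer_basis_deriv_def a_def)
    qed
  qed
qed

section \<open>Networks with one wide hidden layer\<close>

definition scalar_layers :: "(real \<times> real) list \<Rightarrow> nn" where
  "scalar_layers = map (\<lambda>(\<alpha>, \<gamma>). (Matrix.mat 1 1 (\<lambda>_. \<alpha>), Matrix.vec 1 (\<lambda>_. \<gamma>)))"

definition wide_layer :: "nat \<Rightarrow> (nat \<Rightarrow> real) \<Rightarrow> (nat \<Rightarrow> real) \<Rightarrow> real Matrix.mat \<times> real Matrix.vec" where
  "wide_layer n a b = (Matrix.mat n 1 (\<lambda>(j, _). a j), Matrix.vec n b)"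

definition output_layer :: "nat \<Rightarrow> (nat \<Rightarrow> real) \<Rightarrow> real Matrix.mat \<times> real Matrix.vec" where
  "output_layer n w = (Matrix.mat 1 n (\<lambda>(_, j). w j), Matrix.vec 1 (\<lambda>_. 0))"

text \<open>Bracketed so that everything before the last layer is literally the list of hidden
  layers; the output weights \<open>w\<close> occur nowhere else.\<close>

definition chain_net where
  "chain_net cs n a b w = (scalar_layers cs @ [wide_layer n a b]) @ [output_layer n w]"

lemma realization_Cons:
  "\<Phi> \<noteq> [] \<Longrightarrow> realization \<rho> ((A, b) # \<Phi>) x = realization \<rho> \<Phi> (map_vec \<rho> (A *\<^sub>v x + b))"
  by (cases \<Phi>) auto

lemma realization1_chain_net:
  "realization1 sigmoid (chain_net cs n a b w) x
     = (\<Sum>j<n. w j * sigmoid (a j * chain_eval cs x + b j))"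
proof (induction cs x rule: chain_eval.induct)
  case (1 x)
  have "vec_index (Matrix.mat n 1 (\<lambda>(j, _). a j) *\<^sub>v Matrix.vec 1 (\<lambda>_. x)) j = a j * x" if "j < n" for j
    using that by (simp add: scalar_prod_def)
  then show ?case
    by (auto simp: realization1_def chain_net_def scalar_layers_def wide_layer_def output_layer_def
          scalar_prod_def atLeast0LessThan intro!: sum.cong)
next
  case (2 \<alpha> \<gamma> cs x)
  have "map_vec sigmoid (Matrix.mat 1 1 (\<lambda>_. \<alpha>) *\<^sub>v Matrix.vec 1 (\<lambda>_. x) + Matrix.vec 1 (\<lambda>_. \<gamma>))
      = Matrix.vec 1 (\<lambda>_. sigmoid (\<alpha> * x + \<gamma>))"
    by (rule eq_vecI) (auto simp: scalar_prod_def)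
  moreover have "chain_net ((\<alpha>, \<gamma>) # cs) n a b w
      = (Matrix.mat 1 1 (\<lambda>_. \<alpha>), Matrix.vec 1 (\<lambda>_. \<gamma>)) # chain_net cs n a b w"
    by (simp add: chain_net_def scalar_layers_def)
  moreover have "chain_net cs n a b w \<noteq> []"
    by (simp add: chain_net_def)
  ultimately show ?case
    using 2 by (simp add: realization1_def realization_Cons)
qed

lemma is_nn_chain_net:
  assumes "1 \<le> n"
  shows "is_nn 1 1 (chain_net cs n a b w)"
  unfolding is_nn_def
proof (intro conjI exI[of _ "\<lambda>l. if l = Suc (length cs) then n else 1"])
  show "\<forall>l<length (chain_net cs n a b w).
      fst (chain_net cs n a b w ! l) \<in> carrier_mat (if Suc l = Suc (length cs) then n else 1) (if l = Suc (length cs) then n else 1) \<and>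
      snd (chain_net cs n a b w ! l) \<in> carrier_vec (if Suc l = Suc (length cs) then n else 1)"
    by (auto simp: chain_net_def nth_append scalar_layers_def wide_layer_def output_layer_def
          less_Suc_eq split: prod.splits)
qed (use assms in \<open>auto simp: chain_net_def scalar_layers_def\<close>)

lemma mat_nnz_le: "mat_nnz A \<le> dim_row A * dim_col A"
proof -
  have "mat_nnz A \<le> card ({..<dim_row A} \<times> {..<dim_col A})"
    unfolding mat_nnz_def by (intro card_mono) auto
  then show ?thesis
    by (simp add: card_cartesian_product)
qed

lemma vec_nnz_le: "vec_nnz b \<le> dim_vec b"
proof -
  have "vec_nnz b \<le> card {..<dim_vec b}"
    unfolding vec_nnz_def by (intro card_mono) auto
  then show ?thesis
    by simp
qed

lemma nn_size_chain_net: "nn_size (chain_net cs n a b w) \<le> 2 * length cs + 3 * n + 1"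
proof -
  have layer: "(case l of (A, b) \<Rightarrow> mat_nnz A + vec_nnz b) \<le> dim_row (fst l) * dim_col (fst l) + dim_vec (snd l)" for l
    by (cases l) (auto intro: add_mono mat_nnz_le vec_nnz_le)
  have "nn_size (scalar_layers cs) \<le> 2 * length cs"
  proof (induction cs)
    case (Cons c cs)
    then show ?case
      using layer[of "(Matrix.mat 1 1 (\<lambda>_. fst c), Matrix.vec 1 (\<lambda>_. snd c))"]
      by (auto simp: nn_size_def scalar_layers_def split: prod.splits)
  qed (simp add: nn_size_def scalar_layers_def)
  moreover have "nn_size (chain_net cs n a b w) = nn_size (scalar_layers cs)
      + (case wide_layer n a b of (A, b) \<Rightarrow> mat_nnz A + vec_nnz b)
      + (case output_layer n w of (A, b) \<Rightarrow> mat_nnz A + vec_nnz b)"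
    by (simp add: nn_size_def chain_net_def)
  ultimately show ?thesis
    using layer[of "wide_layer n a b"] layer[of "output_layer n w"]
    by (simp add: wide_layer_def output_layer_def)
qed

lemma ceiling_log2_le: "1 \<le> p \<Longrightarrow> \<lceil>log 2 (real (max p 2))\<rceil> \<le> int p"
proof -
  assume "1 \<le> p"
  then have "max p 2 \<le> 2 ^ p"
    using less_exp[of p] power_increasing[of 1 p "2::nat"] by simp
  then have "real (max p 2) \<le> 2 ^ p"
    by (metis of_nat_le_iff of_nat_numeral of_nat_power)
  then have "log 2 (real (max p 2)) \<le> log 2 (2 ^ p)"
    by (subst log_le_cancel_iff) auto
  then show ?thesis
    by (simp add: ceiling_le_iff)
qed

definition C1_close :: "(real \<Rightarrow> real) \<Rightarrow> (real \<Rightarrow> real) \<Rightarrow> (real \<Rightarrow> real) \<Rightarrow> real \<Rightarrow> bool" where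
  "C1_close R g g' \<delta> \<longleftrightarrow> (\<exists>R'. (\<forall>x. (R has_real_derivative R' x) (at x)) \<and> continuous_on UNIV R' \<and>
     (\<forall>x\<in>{-1..1}. \<bar>R x - g x\<bar> \<le> \<delta> \<and> \<bar>R' x - g' x\<bar> \<le> \<delta>))"

text \<open>The hidden layers are fixed before the output weights are quantified, and the error is
  measured relative to the absolute sum of these weights. This is how independence of the solution
  is expressed.\<close>

definition accurate_hidden_layers :: "nat \<Rightarrow> real \<Rightarrow> real \<Rightarrow> nn \<Rightarrow> bool" where
  "accurate_hidden_layers p \<epsilon> \<delta> Hd \<longleftrightarrow> (\<forall>w. \<exists>\<Phi>. is_nn 1 1 \<Phi> \<and> hidden_layers \<Phi> = Hd \<and>
     int (depth \<Phi>) = \<lceil>log 2 (real (max p 2))\<rceil> + 1 \<and> nn_size \<Phi> \<le> 15 * p \<and>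
     C1_close (realization1 sigmoid \<Phi>) (\<lambda>x. \<Sum>i<p+3. w i * layer_basis p \<epsilon> i x)
       (\<lambda>x. \<Sum>i<p+3. w i * layer_basis_deriv p \<epsilon> i x) (\<delta> * (\<Sum>i<p+3. \<bar>w i\<bar>)))"

lemma abs_weighted_sum_diff_le:
  fixes w :: "'a \<Rightarrow> real"
  assumes "\<And>i. i \<in> I \<Longrightarrow> \<bar>f i - g i\<bar> \<le> \<delta>"
  shows "\<bar>(\<Sum>i\<in>I. w i * f i) - (\<Sum>i\<in>I. w i * g i)\<bar> \<le> \<delta> * (\<Sum>i\<in>I. \<bar>w i\<bar>)"
proof -
  have "\<bar>(\<Sum>i\<in>I. w i * f i) - (\<Sum>i\<in>I. w i * g i)\<bar> = \<bar>\<Sum>i\<in>I. w i * (f i - g i)\<bar>"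
    by (simp add: sum_subtractf right_diff_distrib)
  also have "\<dots> \<le> (\<Sum>i\<in>I. \<bar>w i\<bar> * \<bar>f i - g i\<bar>)"
    using sum_abs[of "\<lambda>i. w i * (f i - g i)" I] by (simp add: abs_mult)
  also have "\<dots> \<le> (\<Sum>i\<in>I. \<bar>w i\<bar> * \<delta>)"
    by (intro sum_mono mult_left_mono assms) auto
  finally show ?thesis
    by (simp add: sum_distrib_left mult.commute)
qed

text \<open>The order of choices matters: the exponentials and their coefficients first, then the
  neuron shift \<open>T\<close> and input tolerance \<eta> in terms of the resulting sizes, and
  finally an identity chain meeting \<eta>. Half of \<delta> goes to replacing the basis by
  exponentials, half to replacing exponentials by neurons.\<close>

lemma accurate_hidden_layers_exist:
  assumes p: "1 \<le> p" and \<delta>: "0 < \<delta>"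
  shows "\<exists>Hd. accurate_hidden_layers p \<epsilon> \<delta> Hd"
proof -
  define N where "N = p + 3"
  have "0 < \<delta> / 2"
    using \<delta> by simp
  then obtain a :: "nat \<Rightarrow> real" and c :: "nat \<Rightarrow> nat \<Rightarrow> real" where ac:
    "\<And>i x. i < N \<Longrightarrow> x \<in> {-1..1} \<Longrightarrow>
       \<bar>(\<Sum>j<N. c i j * exp (a j * x)) - layer_basis p \<epsilon> i x\<bar> \<le> \<delta> / 2 \<and>
       \<bar>(\<Sum>j<N. c i j * (a j * exp (a j * x))) - layer_basis_deriv p \<epsilon> i x\<bar> \<le> \<delta> / 2"
    by (rule layer_basis_by_exponentials[of _ p \<epsilon>, folded N_def]) (rule that)
  have c: "\<bar>(\<Sum>j<N. c i j * exp (a j * x)) - layer_basis p \<epsilon> i x\<bar> \<le> \<delta> / 2"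
    "\<bar>(\<Sum>j<N. c i j * (a j * exp (a j * x))) - layer_basis_deriv p \<epsilon> i x\<bar> \<le> \<delta> / 2"
    if "i < N" "x \<in> {-1..1}" for i x
    using ac[OF that] by simp_all
  define A where "A = (\<Sum>j<N. \<bar>a j\<bar>)"
  \<comment> \<open>Passing from basis weights \<open>w\<close> to exponential weights
    \<open>v\<close> enlarges the absolute sum by at most \<open>S\<close>. The neurons are made
    accurate up to \<delta> / (2 (S + 1)), where the 1 avoids division by zero.\<close>
  define S where "S = (\<Sum>i<N. \<Sum>j<N. \<bar>c i j\<bar>)"
  have a: "\<bar>a j\<bar> \<le> A" if "j < N" for j
    using that unfolding A_def by (auto intro!: member_le_sum[of j "{..<N}" "\<lambda>j. \<bar>a j\<bar>"])
  have "0 \<le> A"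
    unfolding A_def by (simp add: sum_nonneg)
  have "0 \<le> S"
    unfolding S_def by (simp add: sum_nonneg)
  then have \<delta>S: "0 < \<delta> / (2 * (S + 1))"
    using \<delta> by simp
  obtain T \<eta> where \<eta>: "0 < \<eta>" and neuron:
    "\<And>a g g' x. \<bar>a\<bar> \<le> A \<Longrightarrow> x \<in> {-1..1} \<Longrightarrow> \<bar>g - x\<bar> \<le> \<eta> \<Longrightarrow> \<bar>g' - 1\<bar> \<le> \<eta> \<Longrightarrow>
       \<bar>exp T * sigmoid (a * g - T) - exp (a * x)\<bar> \<le> \<delta> / (2 * (S + 1)) \<and>
       \<bar>exp T * (sigmoid (a * g - T) * (1 - sigmoid (a * g - T)) * (a * g')) - a * exp (a * x)\<bar> \<le> \<delta> / (2 * (S + 1))"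
    by (rule exp_neuron[OF \<open>0 \<le> A\<close> \<delta>S]) (rule that)
  \<comment> \<open>The wide layer and the output layer account for two of the prescribed layers.
    With \<open>max p 2\<close> the logarithm is at least 1, so \<open>nat\<close> truncates
    nothing.\<close>
  define m where "m = nat (\<lceil>log 2 (real (max p 2))\<rceil> - 1)"
  have "log 2 2 \<le> log 2 (real (max p 2))"
    by (subst log_le_cancel_iff) auto
  then have "1 \<le> \<lceil>log 2 (real (max p 2))\<rceil>"
    by (simp add: one_le_ceiling)
  then have m: "int (m + 2) = \<lceil>log 2 (real (max p 2))\<rceil> + 1" "m \<le> p"
    using ceiling_log2_le[OF p] by (auto simp: m_def)
  from identity_chain[OF \<eta>, of m] obtain cs \<alpha> \<gamma> G' where cs: "length cs = m" "continuous_on UNIV G'"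
    and G0: "\<And>x. ((\<lambda>x. \<alpha> * chain_eval cs x + \<gamma>) has_real_derivative G' x) (at x)"
    and G1: "\<And>x. x \<in> {-1..1} \<Longrightarrow> \<bar>\<alpha> * chain_eval cs x + \<gamma> - x\<bar> \<le> \<eta>"
    and G2: "\<And>x. x \<in> {-1..1} \<Longrightarrow> \<bar>G' x - 1\<bar> \<le> \<eta>"
    by blast
  define G where "G x = \<alpha> * chain_eval cs x + \<gamma>" for x
  have dG: "(G has_real_derivative G' x) (at x)" for x
    using G0 unfolding G_def .
  have contG: "continuous_on UNIV G"
    by (rule DERIV_continuous_on[of _ _ G']) (simp add: dG)
  define s where "s j x = sigmoid (a j * G x - T)" for j x
  define ds where "ds j x = s j x * (1 - s j x) * (a j * G' x)" for j x
  have ds: "(s j has_real_derivative ds j x) (at x)" for j x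
    unfolding s_def ds_def by (auto intro!: derivative_eq_intros dG)
  have cont_ds: "continuous_on UNIV (ds j)" for j
    unfolding ds_def s_def by (intro continuous_intros contG cs)
  \<comment> \<open>The readout of the chain is merged into the wide layer: a j * (\<alpha> y +
    \<gamma>) - T.\<close>
  define Hd where "Hd = scalar_layers cs @ [wide_layer N (\<lambda>j. a j * \<alpha>) (\<lambda>j. a j * \<gamma> - T)]"
  have "accurate_hidden_layers p \<epsilon> \<delta> Hd"
    unfolding accurate_hidden_layers_def
  proof
    fix w :: "nat \<Rightarrow> real"
    define v where "v j = (\<Sum>i<N. w i * c i j)" for j
    define \<Phi> where "\<Phi> = chain_net cs N (\<lambda>j. a j * \<alpha>) (\<lambda>j. a j * \<gamma> - T) (\<lambda>j. v j * exp T)"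
    define R' where "R' x = (\<Sum>j<N. v j * exp T * ds j x)" for x
    let ?W = "\<Sum>i<N. \<bar>w i\<bar>"
    have R: "realization1 sigmoid \<Phi> = (\<lambda>x. \<Sum>j<N. v j * exp T * s j x)"
      by (simp add: fun_eq_iff \<Phi>_def realization1_chain_net s_def G_def algebra_simps)
    have v: "(\<Sum>j<N. \<bar>v j\<bar>) \<le> S * ?W"
    proof -
      have "(\<Sum>j<N. \<bar>v j\<bar>) \<le> (\<Sum>j<N. \<Sum>i<N. \<bar>w i\<bar> * \<bar>c i j\<bar>)"
        unfolding v_def using sum_abs[of "\<lambda>i. w i * c i _" "{..<N}"] by (intro sum_mono) (simp add: abs_mult)
      also have "\<dots> = (\<Sum>i<N. \<bar>w i\<bar> * (\<Sum>j<N. \<bar>c i j\<bar>))"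
        by (subst sum.swap) (simp add: sum_distrib_left)
      also have "\<dots> \<le> (\<Sum>i<N. \<bar>w i\<bar> * S)"
        unfolding S_def
        by (intro sum_mono mult_left_mono member_le_sum[of _ "{..<N}" "\<lambda>i. \<Sum>j<N. \<bar>c i j\<bar>"]) (auto intro: sum_nonneg)
      finally show ?thesis
        by (simp add: sum_distrib_left mult.commute)
    qed
    have swap: "(\<Sum>j<N. v j * g j) = (\<Sum>i<N. w i * (\<Sum>j<N. c i j * g j))" for g :: "nat \<Rightarrow> real"
      unfolding v_def sum_distrib_right sum_distrib_left by (subst sum.swap) (simp add: mult.assoc)
    have total: "\<delta> / (2 * (S + 1)) * (\<Sum>j<N. \<bar>v j\<bar>) + \<delta> / 2 * ?W \<le> \<delta> * ?W"
    proof -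
      have W: "0 \<le> ?W"
        by (simp add: sum_nonneg)
      have "\<delta> / (2 * (S + 1)) * (\<Sum>j<N. \<bar>v j\<bar>) \<le> \<delta> / (2 * (S + 1)) * ((S + 1) * ?W)"
      proof (rule mult_left_mono)
        show "(\<Sum>j<N. \<bar>v j\<bar>) \<le> (S + 1) * ?W"
          using v W unfolding distrib_right by linarith
      qed (use \<delta>S in simp)
      also have "\<dots> = \<delta> / 2 * ?W"
        using \<open>0 \<le> S\<close> by (simp add: field_simps)
      finally have "\<delta> / (2 * (S + 1)) * (\<Sum>j<N. \<bar>v j\<bar>) \<le> \<delta> / 2 * ?W" .
      moreover have "\<delta> / 2 * ?W + \<delta> / 2 * ?W = \<delta> * ?W"
        by simp
      ultimately show ?thesis
        by linarith
    qed
    have approx: "\<bar>realization1 sigmoid \<Phi> x - (\<Sum>i<N. w i * layer_basis p \<epsilon> i x)\<bar> \<le> \<delta> * ?W \<and>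
       \<bar>R' x - (\<Sum>i<N. w i * layer_basis_deriv p \<epsilon> i x)\<bar> \<le> \<delta> * ?W" if x: "x \<in> {-1..1}" for x
    proof -
      note n = neuron[OF a x G1[OF x] G2[OF x], folded G_def, folded s_def, folded ds_def]
      have "\<bar>(\<Sum>j<N. v j * (exp T * s j x)) - (\<Sum>j<N. v j * exp (a j * x))\<bar> \<le> \<delta> / (2 * (S + 1)) * (\<Sum>j<N. \<bar>v j\<bar>)"
        using n by (intro abs_weighted_sum_diff_le) auto
      moreover have "\<bar>(\<Sum>j<N. v j * (exp T * ds j x)) - (\<Sum>j<N. v j * (a j * exp (a j * x)))\<bar> \<le> \<delta> / (2 * (S + 1)) * (\<Sum>j<N. \<bar>v j\<bar>)"
        using n by (intro abs_weighted_sum_diff_le) auto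
      moreover have "\<bar>(\<Sum>j<N. v j * exp (a j * x)) - (\<Sum>i<N. w i * layer_basis p \<epsilon> i x)\<bar> \<le> \<delta> / 2 * ?W"
        unfolding swap using x by (intro abs_weighted_sum_diff_le c) auto
      moreover have "\<bar>(\<Sum>j<N. v j * (a j * exp (a j * x))) - (\<Sum>i<N. w i * layer_basis_deriv p \<epsilon> i x)\<bar> \<le> \<delta> / 2 * ?W"
        unfolding swap using x by (intro abs_weighted_sum_diff_le c) auto
      ultimately show ?thesis
        using total unfolding R R'_def mult.assoc by linarith
    qed
    \<comment> \<open>2 m + 3 (p + 3) + 1 \<le> 5 p + 10 \<le> 15 p, using m \<le> p and 1 \<le>
      p.\<close>
    have size: "nn_size \<Phi> \<le> 15 * p"
      using nn_size_chain_net[of cs N "\<lambda>j. a j * \<alpha>" "\<lambda>j. a j * \<gamma> - T" "\<lambda>j. v j * exp T"] m p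
      by (simp add: \<Phi>_def N_def cs(1))
    show "\<exists>\<Phi>. is_nn 1 1 \<Phi> \<and> hidden_layers \<Phi> = Hd \<and>
     int (depth \<Phi>) = \<lceil>log 2 (real (max p 2))\<rceil> + 1 \<and> nn_size \<Phi> \<le> 15 * p \<and>
     C1_close (realization1 sigmoid \<Phi>) (\<lambda>x. \<Sum>i<p+3. w i * layer_basis p \<epsilon> i x)
       (\<lambda>x. \<Sum>i<p+3. w i * layer_basis_deriv p \<epsilon> i x) (\<delta> * (\<Sum>i<p+3. \<bar>w i\<bar>))"
      unfolding C1_close_def
    proof (intro exI[of _ \<Phi>] exI[of _ R'] conjI allI ballI)
      show "is_nn 1 1 \<Phi>"
        unfolding \<Phi>_def by (rule is_nn_chain_net) (simp add: N_def)
      show "hidden_layers \<Phi> = Hd"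
        unfolding \<Phi>_def Hd_def hidden_layers_def chain_net_def by (rule butlast_snoc)
      show "int (depth \<Phi>) = \<lceil>log 2 (real (max p 2))\<rceil> + 1"
        using m by (simp add: \<Phi>_def depth_def chain_net_def scalar_layers_def cs(1))
      show "(realization1 sigmoid \<Phi> has_real_derivative R' x) (at x)" for x
        unfolding R R'_def by (intro DERIV_sum DERIV_cmult ds)
      show "continuous_on UNIV R'"
        unfolding R'_def by (intro continuous_intros cont_ds)
    qed (use size approx in \<open>auto simp: N_def\<close>)
  qed
  then show ?thesis ..
qed

section \<open>Approximation of the weak solution\<close>

text \<open>Chosen once for each \<epsilon> and \<open>k\<close>. The polynomial part of the
  solution for any \<open>f\<close> is a combination of these with the Chebyshev coefficients of
  \<open>f\<close>, so \<open>coeff_bound\<close> can be formed without knowing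
  \<open>f\<close>.\<close>

definition cheb_particular :: "real \<Rightarrow> nat \<Rightarrow> real poly" where
  "cheb_particular \<epsilon> k =
     (SOME w. degree w \<le> degree (cheb k) \<and> w - Polynomial.smult (\<epsilon>\<^sup>2) (pderiv (pderiv w)) = cheb k)"

lemma cheb_particular:
  "degree (cheb_particular \<epsilon> k) \<le> k"
  "cheb_particular \<epsilon> k - Polynomial.smult (\<epsilon>\<^sup>2) (pderiv (pderiv (cheb_particular \<epsilon> k))) = cheb k"
  using someI_ex[OF poly_particular_solution[of "cheb k" "\<epsilon>\<^sup>2"]] degree_cheb_le[of k]
  unfolding cheb_particular_def by auto

definition coeff_bound :: "nat \<Rightarrow> real \<Rightarrow> real" where
  "coeff_bound p \<epsilon> = (\<Sum>k\<le>p. \<Sum>i\<le>p. \<bar>Polynomial.coeff (cheb_particular \<epsilon> k) i\<bar>)"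

lemma coeff_bound_nonneg: "0 \<le> coeff_bound p \<epsilon>"
  by (simp add: coeff_bound_def sum_nonneg)

lemma poly_particular_sum:
  assumes "\<And>k. \<bar>c k\<bar> \<le> A"
  obtains P :: "real poly" where "degree P \<le> p"
    "\<And>x. poly P x - \<epsilon>\<^sup>2 * poly (pderiv (pderiv P)) x = (\<Sum>k\<le>p. c k * poly (cheb k) x)"
    "(\<Sum>i\<le>p. \<bar>Polynomial.coeff P i\<bar>) \<le> A * coeff_bound p \<epsilon>"
proof -
  define P where "P = (\<Sum>k\<le>p. Polynomial.smult (c k) (cheb_particular \<epsilon> k))"
  show thesis
  proof (rule that)
    show "degree P \<le> p"
      unfolding P_def
    proof (rule degree_sum_le)
      fix k assume "k \<in> {..p}"
      then show "degree (Polynomial.smult (c k) (cheb_particular \<epsilon> k)) \<le> p"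
        using cheb_particular(1)[of \<epsilon> k] Polynomial.degree_smult_le[of "c k" "cheb_particular \<epsilon> k"] by simp
    qed simp
    have dd: "pderiv (pderiv P) = (\<Sum>k\<le>p. Polynomial.smult (c k) (pderiv (pderiv (cheb_particular \<epsilon> k))))"
      using higher_pderiv_sum[of 2 "\<lambda>k. Polynomial.smult (c k) (cheb_particular \<epsilon> k)" "{..p}"]
      by (simp add: P_def numeral_2_eq_2 pderiv_smult)
    fix x
    have "poly (cheb_particular \<epsilon> k) x - \<epsilon>\<^sup>2 * poly (pderiv (pderiv (cheb_particular \<epsilon> k))) x = poly (cheb k) x" for k
      using arg_cong[OF cheb_particular(2), of "\<lambda>q. poly q x"] by simp
    then show "poly P x - \<epsilon>\<^sup>2 * poly (pderiv (pderiv P)) x = (\<Sum>k\<le>p. c k * poly (cheb k) x)"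
      unfolding dd unfolding P_def
      by (simp add: poly_sum sum_distrib_left sum_subtractf sum.distrib algebra_simps)
  next
    have "(\<Sum>i\<le>p. \<bar>Polynomial.coeff P i\<bar>) \<le> (\<Sum>i\<le>p. \<Sum>k\<le>p. \<bar>c k\<bar> * \<bar>Polynomial.coeff (cheb_particular \<epsilon> k) i\<bar>)"
      by (rule sum_mono) (auto simp: P_def coeff_sum abs_mult intro!: order.trans[OF sum_abs])
    also have "\<dots> \<le> (\<Sum>i\<le>p. \<Sum>k\<le>p. A * \<bar>Polynomial.coeff (cheb_particular \<epsilon> k) i\<bar>)"
      by (intro sum_mono mult_right_mono assms) auto
    also have "\<dots> = A * coeff_bound p \<epsilon>"
      unfolding coeff_bound_def sum_distrib_left by (rule sum.swap)
    finally show "(\<Sum>i\<le>p. \<bar>Polynomial.coeff P i\<bar>) \<le> A * coeff_bound p \<epsilon>" .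
  qed
qed

lemma poly_eq_sum_monomials:
  fixes P :: "real poly"
  assumes "degree P \<le> p"
  shows "poly P x = (\<Sum>i\<le>p. Polynomial.coeff P i * x ^ i)"
    "poly (pderiv P) x = (\<Sum>i\<le>p. Polynomial.coeff P i * (real i * x ^ (i - 1)))"
proof -
  show eq: "poly P x = (\<Sum>i\<le>p. Polynomial.coeff P i * x ^ i)" for x
    unfolding poly_altdef using assms
    by (intro sum.mono_neutral_left) (auto simp: coeff_eq_0)
  show "poly (pderiv P) x = (\<Sum>i\<le>p. Polynomial.coeff P i * (real i * x ^ (i - 1)))"
  proof (rule DERIV_unique)
    show "(poly P has_real_derivative poly (pderiv P) x) (at x)"
      by (rule poly_DERIV)
    show "(poly P has_real_derivative (\<Sum>i\<le>p. Polynomial.coeff P i * (real i * x ^ (i - 1)))) (at x)"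
      unfolding eq[abs_def] by (auto intro!: derivative_eq_intros sum.cong)
  qed
qed

text \<open>Cramer's rule for layers normalised to 1 at their own end point. Each has the value exp
  (-2/\<epsilon>) \<le> 1/2 at the other end, so the determinant is at least 1/2 for all \<epsilon>
  \<le> 1.\<close>

lemma boundary_layer_coefficients:
  fixes b1 b2 \<epsilon> :: real
  assumes \<epsilon>: "0 < \<epsilon>" "\<epsilon> \<le> 1" and B: "\<bar>b1\<bar> \<le> B" "\<bar>b2\<bar> \<le> B"
  obtains c1 c2 where "b1 + c1 + c2 * exp (- 2 / \<epsilon>) = 0" "b2 + c1 * exp (- 2 / \<epsilon>) + c2 = 0"
    "\<bar>c1\<bar> \<le> 4 * B" "\<bar>c2\<bar> \<le> 4 * B"
proof -
  define q where "q = exp (- 2 / \<epsilon>)"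
  have "- 2 / \<epsilon> \<le> -1"
    using \<epsilon> by (simp add: field_simps)
  then have "q \<le> exp (-1)"
    by (simp add: q_def)
  also have "exp (-1 :: real) \<le> 1 / 2"
    using exp_ge_add_one_self[of "1::real"] by (simp add: exp_minus field_simps)
  finally have q: "0 < q" "q \<le> 1 / 2"
    by (auto simp: q_def)
  have "q\<^sup>2 \<le> (1 / 2)\<^sup>2"
    using q by (intro power_mono) auto
  then have D: "1 / 2 \<le> 1 - q\<^sup>2"
    by (simp add: power_divide)
  have bound: "\<bar>(q * b - a) / (1 - q\<^sup>2)\<bar> \<le> 4 * B" if "\<bar>a\<bar> \<le> B" "\<bar>b\<bar> \<le> B" for a b
  proof -
    have "\<bar>q * b\<bar> \<le> 1 * B"
      unfolding abs_mult using q that by (intro mult_mono) auto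
    then have "\<bar>q * b - a\<bar> \<le> 2 * B"
      using that by linarith
    also have "\<dots> = 4 * B * (1 / 2)"
      by simp
    also have "\<dots> \<le> 4 * B * (1 - q\<^sup>2)"
      using D order.trans[OF abs_ge_zero B(1)] by (intro mult_left_mono) auto
    finally show ?thesis
      using D by (simp add: pos_divide_le_eq)
  qed
  show thesis
  proof (rule that[of "(q * b2 - b1) / (1 - q\<^sup>2)" "(q * b1 - b2) / (1 - q\<^sup>2)"], fold q_def)
    have "1 - q\<^sup>2 \<noteq> 0"
      using D by simp
    then show "b1 + (q * b2 - b1) / (1 - q\<^sup>2) + (q * b1 - b2) / (1 - q\<^sup>2) * q = 0"
      "b2 + (q * b2 - b1) / (1 - q\<^sup>2) * q + (q * b1 - b2) / (1 - q\<^sup>2) = 0"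
      by (simp_all add: field_simps power2_eq_square)
  qed (use B bound in auto)
qed

text \<open>\<open>U\<close> is the exact solution: polynomial part, particular solution
  \<open>v\<close> for the remainder of \<open>f\<close>, and two layers correcting the boundary
  values. Dropping \<open>v\<close> leaves an element of the span, and the bounds on
  \<open>v\<close> and v' are the whole error.\<close>

lemma weak_solution_approx_layer_basis:
  assumes f: "continuous_on {-1..1} f" and A: "0 < A" "\<delta> \<le> A"
    and c: "\<And>k. \<bar>c k\<bar> \<le> A"
    and bd: "\<And>x. x \<in> {-1..1} \<Longrightarrow> \<bar>f x - (\<Sum>k\<le>p. c k * poly (cheb k) x)\<bar> \<le> \<delta>"
    and lip: "\<And>x y. x \<in> {-1..1} \<Longrightarrow> y \<in> {-1..1} \<Longrightarrow>
       \<bar>(f x - (\<Sum>k\<le>p. c k * poly (cheb k) x)) - (f y - (\<Sum>k\<le>p. c k * poly (cheb k) y))\<bar> \<le> \<delta> * \<bar>x - y\<bar>"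
    and \<epsilon>: "0 < \<epsilon>" "\<epsilon> \<le> 1" and weak: "weak_solution \<epsilon> f u u'"
  obtains w where "(\<Sum>i<p+3. \<bar>w i\<bar>) \<le> 10 * A * (1 + coeff_bound p \<epsilon>)"
    "AE x in leb_I. \<bar>u x - (\<Sum>i<p+3. w i * layer_basis p \<epsilon> i x)\<bar> \<le> \<delta> \<and>
       \<bar>u' x - (\<Sum>i<p+3. w i * layer_basis_deriv p \<epsilon> i x)\<bar> \<le> \<delta>"
proof -
  let ?g = "\<lambda>x. \<Sum>k\<le>p. c k * poly (cheb k) x"
  \<comment> \<open>Nothing is known about \<open>f\<close> outside [-1,1]; clamping extends the
    remainder continuously to the real line, as the particular solution requires.\<close>
  define clamp where "clamp x = max (-1) (min 1 x)" for x :: real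
  have clamp: "clamp x \<in> {-1..1}" "x \<in> {-1..1} \<Longrightarrow> clamp x = x" for x
    by (auto simp: clamp_def)
  define r where "r x = f (clamp x) - ?g (clamp x)" for x
  have contr: "continuous_on UNIV r"
    unfolding r_def clamp_def
    by (intro continuous_intros continuous_on_compose2[OF f]) auto
  have r_eq: "r x = f x - ?g x" if "x \<in> {-1..1}" for x
    using that by (simp only: r_def clamp(2))
  have r_bd: "\<bar>r x\<bar> \<le> \<delta>" if "x \<in> {-1..1}" for x
    using bd[OF that] by (simp only: r_eq[OF that])
  have r_lip: "\<bar>r x - r y\<bar> \<le> \<delta> * \<bar>x - y\<bar>" if "x \<in> {-1..1}" "y \<in> {-1..1}" for x y
    using lip[OF that] by (simp only: r_eq[OF that(1)] r_eq[OF that(2)])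
  obtain v v' where v: "\<And>x. (v has_real_derivative v' x) (at x)"
    "\<And>x. (v' has_real_derivative (v x - r x) / \<epsilon>\<^sup>2) (at x)"
    "\<And>x. x \<in> {-1..1} \<Longrightarrow> \<bar>v x\<bar> \<le> \<delta>" "\<And>x. x \<in> {-1..1} \<Longrightarrow> \<bar>v' x\<bar> \<le> \<delta>"
    using lipschitz_particular_solution[OF contr \<epsilon>(1) r_bd r_lip] by blast
  obtain P :: "real poly" where P: "degree P \<le> p"
    "\<And>x. poly P x - \<epsilon>\<^sup>2 * poly (pderiv (pderiv P)) x = ?g x"
    "(\<Sum>i\<le>p. \<bar>Polynomial.coeff P i\<bar>) \<le> A * coeff_bound p \<epsilon>"
    using poly_particular_sum[of c A p \<epsilon>, OF c] by blast
  let ?B = "A * (1 + coeff_bound p \<epsilon>)"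
  have Pb: "\<bar>poly P x + v x\<bar> \<le> ?B" if x: "x \<in> {-1..1}" for x
  proof -
    have "\<bar>poly P x\<bar> \<le> (\<Sum>i\<le>p. \<bar>Polynomial.coeff P i\<bar> * \<bar>x\<bar> ^ i)"
      unfolding poly_eq_sum_monomials(1)[OF P(1)]
      by (rule order.trans[OF sum_abs]) (simp add: abs_mult power_abs)
    also have "\<dots> \<le> (\<Sum>i\<le>p. \<bar>Polynomial.coeff P i\<bar> * 1)"
      using x by (intro sum_mono mult_left_mono power_le_one) auto
    finally show ?thesis
      using P(3) v(3)[OF x] A by (simp add: distrib_left)
  qed
  obtain c1 c2 where c12: "(poly P (-1) + v (-1)) + c1 + c2 * exp (- 2 / \<epsilon>) = 0"
    "(poly P 1 + v 1) + c1 * exp (- 2 / \<epsilon>) + c2 = 0" "\<bar>c1\<bar> \<le> 4 * ?B" "\<bar>c2\<bar> \<le> 4 * ?B"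
  proof (rule boundary_layer_coefficients[OF \<epsilon>])
    show "\<bar>poly P (-1) + v (-1)\<bar> \<le> ?B" "\<bar>poly P 1 + v 1\<bar> \<le> ?B"
      by (intro Pb; simp)+
  qed
  \<comment> \<open>c1 and c2 belong to the normalised layers exp (-(1 + x)/\<epsilon>) and exp (-(1
    - x)/\<epsilon>); this rewrites them in terms of \<open>layer_basis\<close>.\<close>
  define e1 e2 where "e1 = c1 * exp (- 1 / \<epsilon>)" and "e2 = c2 * exp (- 1 / \<epsilon>)"
  have e12: "\<bar>e1\<bar> \<le> 4 * ?B" "\<bar>e2\<bar> \<le> 4 * ?B"
  proof -
    have "\<bar>c * exp (- 1 / \<epsilon>)\<bar> \<le> \<bar>c\<bar>" for c
      using \<epsilon> by (simp add: abs_mult mult_left_le)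
    then show "\<bar>e1\<bar> \<le> 4 * ?B" "\<bar>e2\<bar> \<le> 4 * ?B"
      unfolding e1_def e2_def using c12(3,4) order.trans by blast+
  qed
  define U where "U x = poly P x + v x + e1 * exp (- x / \<epsilon>) + e2 * exp (x / \<epsilon>)" for x
  define U1 where "U1 x = poly (pderiv P) x + v' x + e1 * (- exp (- x / \<epsilon>) / \<epsilon>) + e2 * (exp (x / \<epsilon>) / \<epsilon>)" for x
  define U2 where "U2 x = poly (pderiv (pderiv P)) x + (v x - r x) / \<epsilon>\<^sup>2
      + e1 * (exp (- x / \<epsilon>) / \<epsilon>\<^sup>2) + e2 * (exp (x / \<epsilon>) / \<epsilon>\<^sup>2)" for x
  have ex: "exp (- 1 / \<epsilon>) * exp (- 1 / \<epsilon>) = exp (- 2 / \<epsilon>)" "exp (- 1 / \<epsilon>) * exp (1 / \<epsilon>) = 1"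
    by (simp_all flip: exp_add add: divide_simps)
  have sol: "AE x in leb_I. u x = U x \<and> u' x = U1 x"
  proof (rule weak_solution_unique[OF weak \<epsilon>(1)])
    show "(U has_real_derivative U1 x) (at x)" for x
      unfolding U_def U1_def using \<epsilon> by (auto intro!: derivative_eq_intros v poly_DERIV simp: mult.commute)
    show "(U1 has_real_derivative U2 x) (at x)" for x
      unfolding U1_def U2_def using \<epsilon>
      by (auto intro!: derivative_eq_intros v poly_DERIV simp: power2_eq_square mult.commute)
    have "continuous_on UNIV v"
      by (rule DERIV_continuous_on[of _ _ v']) (simp add: v)
    then show "continuous_on UNIV U2"
      unfolding U2_def using \<epsilon> by (intro continuous_intros contr) auto
    have "U (-1) = (poly P (-1) + v (-1)) + c1 * (exp (- 1 / \<epsilon>) * exp (1 / \<epsilon>)) + c2 * (exp (- 1 / \<epsilon>) * exp (- 1 / \<epsilon>))"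
      by (simp add: U_def e1_def e2_def)
    then show "U (-1) = 0"
      unfolding ex using c12(1) by simp
    have "U 1 = (poly P 1 + v 1) + c1 * (exp (- 1 / \<epsilon>) * exp (- 1 / \<epsilon>)) + c2 * (exp (- 1 / \<epsilon>) * exp (1 / \<epsilon>))"
      by (simp add: U_def e1_def e2_def)
    then show "U 1 = 0"
      unfolding ex using c12(2) by simp
    fix x :: real assume "x \<in> {-1<..<1}"
    then have "r x = f x - ?g x"
      by (intro r_eq) auto
    moreover have "\<epsilon>\<^sup>2 * U2 x = \<epsilon>\<^sup>2 * poly (pderiv (pderiv P)) x + (v x - r x)
        + e1 * exp (- x / \<epsilon>) + e2 * exp (x / \<epsilon>)"
      using \<epsilon> by (simp add: U2_def distrib_left)
    ultimately show "- (\<epsilon>\<^sup>2 * U2 x) + U x = f x"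
      using P(2)[of x] unfolding U_def by linarith
  qed
  define w where "w i = (if i \<le> p then Polynomial.coeff P i else if i = Suc p then e1 else e2)" for i
  have split: "(\<Sum>i<p+3. g i) = (\<Sum>i\<le>p. g i) + g (Suc p) + g (Suc (Suc p))" for g :: "nat \<Rightarrow> real"
    by (simp add: numeral_3_eq_3 lessThan_Suc_atMost)
  show thesis
  proof (rule that[of w])
    have "(\<Sum>i<p+3. \<bar>w i\<bar>) \<le> ?B + 4 * ?B + 4 * ?B"
      unfolding split using P(3) e12 A by (intro add_mono) (auto simp: w_def distrib_left)
    also have "\<dots> \<le> 10 * A * (1 + coeff_bound p \<epsilon>)"
      using A coeff_bound_nonneg[of p \<epsilon>] mult_nonneg_nonneg[of A "1 + coeff_bound p \<epsilon>"] by simp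
    finally show "(\<Sum>i<p+3. \<bar>w i\<bar>) \<le> 10 * A * (1 + coeff_bound p \<epsilon>)" .
    have eq: "(\<Sum>i<p+3. w i * layer_basis p \<epsilon> i x) = U x - v x"
      "(\<Sum>i<p+3. w i * layer_basis_deriv p \<epsilon> i x) = U1 x - v' x" for x
      unfolding split U_def U1_def poly_eq_sum_monomials[OF P(1)]
      by (simp_all add: w_def layer_basis_def layer_basis_deriv_def)
    show "AE x in leb_I. \<bar>u x - (\<Sum>i<p+3. w i * layer_basis p \<epsilon> i x)\<bar> \<le> \<delta> \<and>
       \<bar>u' x - (\<Sum>i<p+3. w i * layer_basis_deriv p \<epsilon> i x)\<bar> \<le> \<delta>"
      using sol AE_leb_I_Ioo by eventually_elim (use v(3,4) in \<open>auto simp: eq\<close>)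
  qed
qed

lemma Linf_norm_le:
  assumes "v \<in> borel_measurable leb_I" "AE x in leb_I. \<bar>v x\<bar> \<le> B"
  shows "Linf_norm v \<le> ereal B"
  unfolding Linf_norm_def using assms by (intro esssup_I) auto

lemma L2_norm_le:
  assumes meas: "v \<in> borel_measurable leb_I" and le: "AE x in leb_I. \<bar>v x\<bar> \<le> B"
  shows "L2_norm v \<le> ereal (2 * B)" "0 \<le> L2_norm v"
proof -
  have B: "0 \<le> B"
  proof (rule ccontr)
    assume "\<not> 0 \<le> B"
    then have "AE x in leb_I. False"
      using le by (auto elim!: eventually_mono)
    then have "emeasure leb_I (space leb_I) = 0"
      unfolding ae_filter_eq_bot_iff[symmetric] trivial_limit_def .
    then show False
      by (simp add: emeasure_restrict_space)
  qed
  have le2: "AE x in leb_I. (v x)\<^sup>2 \<le> B\<^sup>2"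
    using le by eventually_elim (use B in \<open>simp add: abs_le_square_iff[symmetric]\<close>)
  have int: "integrable leb_I (\<lambda>x. (v x)\<^sup>2)"
    by (rule integrable_leb_I_bounded[of _ "B\<^sup>2"]) (use meas le2 in auto)
  have "(\<integral>x. (v x)\<^sup>2 \<partial>leb_I) \<le> (\<integral>x. B\<^sup>2 \<partial>leb_I)"
    by (rule integral_mono_AE[OF int integrable_leb_I_const le2])
  also have "\<dots> = 2 * B\<^sup>2"
    by (simp add: measure_restrict_space)
  also have "\<dots> \<le> (2 * B)\<^sup>2"
    by (simp add: power_mult_distrib)
  finally have "sqrt (\<integral>x. (v x)\<^sup>2 \<partial>leb_I) \<le> 2 * B"
    using B by (intro real_le_lsqrt) auto
  then show "L2_norm v \<le> ereal (2 * B)" "0 \<le> L2_norm v"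
    using meas int by (auto simp: L2_norm_def in_L2_def)
qed

text \<open>The accuracy is relative to \<open>coeff_bound\<close>, which depends on \<open>p\<close> and \<open>\<epsilon>\<close> only, so that one choice
  serves all right-hand sides; it exists for \<open>p \<ge> 1\<close>.\<close>

definition hidden_net :: "nat \<Rightarrow> real \<Rightarrow> real \<Rightarrow> nn" where
  "hidden_net p \<epsilon> \<beta> = (SOME Hd. accurate_hidden_layers p \<epsilon> (exp (- \<beta> * real p) / (10 * (1 + coeff_bound p \<epsilon>))) Hd)"

lemma accurate_hidden_net:
  assumes "1 \<le> p"
  shows "accurate_hidden_layers p \<epsilon> (exp (- \<beta> * real p) / (10 * (1 + coeff_bound p \<epsilon>))) (hidden_net p \<epsilon> \<beta>)"
  unfolding hidden_net_def
  by (rule someI_ex[OF accurate_hidden_layers_exist[OF assms]])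
     (use coeff_bound_nonneg[of p \<epsilon>] in simp)

text \<open>The absolute sum of the weights times the relative accuracy of \<open>hidden_net\<close>
  is at most A exp (-\<beta> p): \<open>coeff_bound\<close> cancels. Together with the error of the
  span approximation this gives the factor 2.\<close>

lemma weak_solution_nn_approx:
  assumes w: "(\<Sum>i<p+3. \<bar>w i\<bar>) \<le> 10 * A * (1 + coeff_bound p \<epsilon>)"
    and AEw: "AE x in leb_I. \<bar>u x - (\<Sum>i<p+3. w i * layer_basis p \<epsilon> i x)\<bar> \<le> A * exp (- \<beta> * real p) \<and>
       \<bar>u' x - (\<Sum>i<p+3. w i * layer_basis_deriv p \<epsilon> i x)\<bar> \<le> A * exp (- \<beta> * real p)"
    and p: "1 \<le> p" and meas: "u \<in> borel_measurable leb_I" "u' \<in> borel_measurable leb_I"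
  obtains \<Phi> where "is_nn 1 1 \<Phi>" "hidden_layers \<Phi> = hidden_net p \<epsilon> \<beta>"
    "int (depth \<Phi>) = \<lceil>log 2 (real (max p 2))\<rceil> + 1" "nn_size \<Phi> \<le> 15 * p"
    "(\<lambda>x. u x - realization1 sigmoid \<Phi> x) \<in> borel_measurable leb_I"
    "(\<lambda>x. u' x - deriv (realization1 sigmoid \<Phi>) x) \<in> borel_measurable leb_I"
    "AE x in leb_I. \<bar>u x - realization1 sigmoid \<Phi> x\<bar> \<le> 2 * A * exp (- \<beta> * real p)"
    "AE x in leb_I. \<bar>u' x - deriv (realization1 sigmoid \<Phi>) x\<bar> \<le> 2 * A * exp (- \<beta> * real p)"
proof -
  let ?\<delta> = "exp (- \<beta> * real p) / (10 * (1 + coeff_bound p \<epsilon>))"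
  let ?s = "\<lambda>x. \<Sum>i<p+3. w i * layer_basis p \<epsilon> i x" and ?s' = "\<lambda>x. \<Sum>i<p+3. w i * layer_basis_deriv p \<epsilon> i x"
  obtain \<Phi> where \<Phi>: "is_nn 1 1 \<Phi>" "hidden_layers \<Phi> = hidden_net p \<epsilon> \<beta>"
    "int (depth \<Phi>) = \<lceil>log 2 (real (max p 2))\<rceil> + 1" "nn_size \<Phi> \<le> 15 * p"
    and close: "C1_close (realization1 sigmoid \<Phi>) ?s ?s' (?\<delta> * (\<Sum>i<p+3. \<bar>w i\<bar>))"
    using spec[OF accurate_hidden_net[OF p, of \<epsilon> \<beta>, unfolded accurate_hidden_layers_def], of w]
    by (elim exE conjE) (rule that)
  obtain R' where "\<forall>x. (realization1 sigmoid \<Phi> has_real_derivative R' x) (at x)" and contR: "continuous_on UNIV R'"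
    and le: "\<forall>x\<in>{-1..1}. \<bar>realization1 sigmoid \<Phi> x - ?s x\<bar> \<le> ?\<delta> * (\<Sum>i<p+3. \<bar>w i\<bar>)
      \<and> \<bar>R' x - ?s' x\<bar> \<le> ?\<delta> * (\<Sum>i<p+3. \<bar>w i\<bar>)"
    using close[unfolded C1_close_def] by (elim exE conjE) (rule that)
  then have R: "(realization1 sigmoid \<Phi> has_real_derivative R' x) (at x)" for x
    by simp
  have R': "deriv (realization1 sigmoid \<Phi>) = R'"
    by (rule ext) (rule DERIV_imp_deriv[OF R])
  have pos: "0 < 1 + coeff_bound p \<epsilon>"
    using coeff_bound_nonneg[of p \<epsilon>] by linarith
  have "?\<delta> * (\<Sum>i<p+3. \<bar>w i\<bar>) \<le> ?\<delta> * (10 * A * (1 + coeff_bound p \<epsilon>))"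
    by (rule mult_left_mono[OF w]) (use pos in simp)
  also have "\<dots> = A * exp (- \<beta> * real p)"
  proof -
    have "e / (10 * q) * (10 * A * q) = A * e" if "0 < q" for e q :: real
      using that by simp
    from this[OF pos] show ?thesis .
  qed
  finally have net: "?\<delta> * (\<Sum>i<p+3. \<bar>w i\<bar>) \<le> A * exp (- \<beta> * real p)" .
  have err: "AE x in leb_I. \<bar>u x - realization1 sigmoid \<Phi> x\<bar> \<le> 2 * A * exp (- \<beta> * real p) \<and>
      \<bar>u' x - R' x\<bar> \<le> 2 * A * exp (- \<beta> * real p)"
    using AEw AE_leb_I_Ioo
  proof eventually_elim
    fix x assume *: "\<bar>u x - ?s x\<bar> \<le> A * exp (- \<beta> * real p) \<and> \<bar>u' x - ?s' x\<bar> \<le> A * exp (- \<beta> * real p)"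
      and "x \<in> {-1<..<1}"
    then have "x \<in> {-1..1}"
      by auto
    from bspec[OF le this] net * show "\<bar>u x - realization1 sigmoid \<Phi> x\<bar> \<le> 2 * A * exp (- \<beta> * real p) \<and>
      \<bar>u' x - R' x\<bar> \<le> 2 * A * exp (- \<beta> * real p)"
      unfolding mult.assoc[of 2 A] by linarith
  qed
  have "continuous_on {-1<..<1} (realization1 sigmoid \<Phi>)"
    by (rule DERIV_continuous_on[of _ _ R']) (blast intro: R has_field_derivative_at_within)
  then have "(\<lambda>x. u x - realization1 sigmoid \<Phi> x) \<in> borel_measurable leb_I"
    by (intro borel_measurable_diff meas measurable_leb_I_continuous)
  moreover have "(\<lambda>x. u' x - R' x) \<in> borel_measurable leb_I"
    by (intro borel_measurable_diff meas measurable_leb_I_continuous continuous_on_subset[OF contR]) auto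
  ultimately show thesis
    using err by (intro that[OF \<Phi>]) (simp_all add: R')
qed

text \<open>The choice of \<open>Ct\<close> and \<open>H\<close> precedes \<open>f\<close>, which
  expresses their independence of \<open>f\<close> and \<open>u\<close>. For p = 1 the depth formula
  is read with \<open>max p 2\<close>: depth 1 would mean an affine map, whose derivative is
  constant, while for f = 1 the values of u' at the two end points differ by 2 tanh (1/\<epsilon>) /
  \<epsilon>. No bound uniform in \<epsilon> could hold.\<close>

theorem theoremB5:
  shows "\<exists>Ct > 0. \<exists>H :: nat \<Rightarrow> real \<Rightarrow> real \<Rightarrow> nn.
    \<forall>(f :: real \<Rightarrow> real) (Cf :: real) (Kf :: real).
      real_analytic_on f {-1..1} \<and> Cf > 0 \<and> Kf > 0 \<and>
      (\<forall>n :: nat. Linf_norm ((deriv ^^ n) f) \<le> ereal (Cf * Kf ^ n * fact n)) \<longrightarrow>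
      (\<exists>C > 0. \<exists>\<beta> > 0.
        \<forall>(p :: nat) (\<epsilon> :: real) (u :: real \<Rightarrow> real) (u' :: real \<Rightarrow> real).
          p \<ge> 1 \<and> 0 < \<epsilon> \<and> \<epsilon> \<le> 1 \<and> weak_solution \<epsilon> f u u' \<longrightarrow>
          (\<exists>\<Phi> :: nn. is_nn 1 1 \<Phi> \<and>
            (let R = realization1 sigmoid \<Phi>;
                 e = (\<lambda>x. u x - R x);
                 e' = (\<lambda>x. u' x - deriv R x)
             in W1inf_norm e e' \<le> ereal (C * exp (- \<beta> * real p)) \<and>
                ereal (sqrt \<epsilon>) * L2_norm e' + L2_norm e \<le> ereal (C * exp (- \<beta> * real p)) \<and>
                Linf_norm e \<le> ereal (C * exp (- \<beta> * real p))) \<and>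
            int (depth \<Phi>) = \<lceil>log 2 (real (max p 2))\<rceil> + 1 \<and>
            real (nn_size \<Phi>) \<le> Ct * real p \<and>
            hidden_layers \<Phi> = H p \<epsilon> \<beta>))"
proof (rule exI[of _ 15], rule conjI, simp, rule exI[of _ hidden_net], intro allI impI)
  fix f :: "real \<Rightarrow> real" and Cf Kf :: real
  assume "real_analytic_on f {-1..1} \<and> Cf > 0 \<and> Kf > 0 \<and>
      (\<forall>n :: nat. Linf_norm ((deriv ^^ n) f) \<le> ereal (Cf * Kf ^ n * fact n))"
  then have an: "real_analytic_on f {-1..1}" and pos: "0 < Kf" "0 < Cf"
    and bound: "\<And>n. Linf_norm ((deriv ^^ n) f) \<le> ereal (Cf * Kf ^ n * fact n)"
    by auto
  obtain A \<beta> where A: "0 < A" "0 < \<beta>" "\<And>k. \<bar>cheb_coeff f k\<bar> \<le> A"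
    "\<And>p x. x \<in> {-1..1} \<Longrightarrow>
       \<bar>f x - (\<Sum>k\<le>p. cheb_coeff f k * poly (cheb k) x)\<bar> \<le> A * exp (- \<beta> * real p)"
    "\<And>p x y. x \<in> {-1..1} \<Longrightarrow> y \<in> {-1..1} \<Longrightarrow>
       \<bar>(f x - (\<Sum>k\<le>p. cheb_coeff f k * poly (cheb k) x)) -
        (f y - (\<Sum>k\<le>p. cheb_coeff f k * poly (cheb k) y))\<bar> \<le> A * exp (- \<beta> * real p) * \<bar>x - y\<bar>"
    by (rule analytic_cheb_approx[OF an pos bound]) (rule that)
  show "\<exists>C > 0. \<exists>\<beta> > 0.
        \<forall>(p :: nat) (\<epsilon> :: real) (u :: real \<Rightarrow> real) (u' :: real \<Rightarrow> real).
          p \<ge> 1 \<and> 0 < \<epsilon> \<and> \<epsilon> \<le> 1 \<and> weak_solution \<epsilon> f u u' \<longrightarrow>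
          (\<exists>\<Phi> :: nn. is_nn 1 1 \<Phi> \<and>
            (let R = realization1 sigmoid \<Phi>;
                 e = (\<lambda>x. u x - R x);
                 e' = (\<lambda>x. u' x - deriv R x)
             in W1inf_norm e e' \<le> ereal (C * exp (- \<beta> * real p)) \<and>
                ereal (sqrt \<epsilon>) * L2_norm e' + L2_norm e \<le> ereal (C * exp (- \<beta> * real p)) \<and>
                Linf_norm e \<le> ereal (C * exp (- \<beta> * real p))) \<and>
            int (depth \<Phi>) = \<lceil>log 2 (real (max p 2))\<rceil> + 1 \<and>
            real (nn_size \<Phi>) \<le> 15 * real p \<and>
            hidden_layers \<Phi> = hidden_net p \<epsilon> \<beta>)"
  \<comment> \<open>Pointwise errors are at most 2 A exp (-\<beta> p). Each L^2 norm is at most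
    twice that (the factor sqrt 2 from the length of the interval is rounded up), and two such norms
    are added.\<close>
  proof (rule exI[of _ "8 * A"], rule conjI, use A(1) in simp, rule exI[of _ \<beta>], rule conjI, rule A(2), intro allI impI)
    fix p :: nat and \<epsilon> :: real and u u' :: "real \<Rightarrow> real"
    assume "p \<ge> 1 \<and> 0 < \<epsilon> \<and> \<epsilon> \<le> 1 \<and> weak_solution \<epsilon> f u u'"
    then have p: "1 \<le> p" and \<epsilon>: "0 < \<epsilon>" "\<epsilon> \<le> 1" and weak: "weak_solution \<epsilon> f u u'"
      by auto
    have le_A: "A * exp (- \<beta> * real p) \<le> A"
      using A(1,2) by simp
    obtain w where w: "(\<Sum>i<p+3. \<bar>w i\<bar>) \<le> 10 * A * (1 + coeff_bound p \<epsilon>)"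
      "AE x in leb_I. \<bar>u x - (\<Sum>i<p+3. w i * layer_basis p \<epsilon> i x)\<bar> \<le> A * exp (- \<beta> * real p) \<and>
       \<bar>u' x - (\<Sum>i<p+3. w i * layer_basis_deriv p \<epsilon> i x)\<bar> \<le> A * exp (- \<beta> * real p)"
      by (rule weak_solution_approx_layer_basis[OF real_analytic_on_imp_continuous_on[OF an] A(1) le_A A(3,4,5) \<epsilon> weak])
    have meas: "u \<in> borel_measurable leb_I" "u' \<in> borel_measurable leb_I"
      using weak by (auto simp: weak_solution_def in_H10_def in_H1_def in_L2_def)
    let ?B = "2 * A * exp (- \<beta> * real p)"
    obtain \<Phi> where \<Phi>: "is_nn 1 1 \<Phi>" "hidden_layers \<Phi> = hidden_net p \<epsilon> \<beta>"
      "int (depth \<Phi>) = \<lceil>log 2 (real (max p 2))\<rceil> + 1" "nn_size \<Phi> \<le> 15 * p"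
      and m: "(\<lambda>x. u x - realization1 sigmoid \<Phi> x) \<in> borel_measurable leb_I"
      "(\<lambda>x. u' x - deriv (realization1 sigmoid \<Phi>) x) \<in> borel_measurable leb_I"
      and ae: "AE x in leb_I. \<bar>u x - realization1 sigmoid \<Phi> x\<bar> \<le> ?B"
      "AE x in leb_I. \<bar>u' x - deriv (realization1 sigmoid \<Phi>) x\<bar> \<le> ?B"
      by (rule weak_solution_nn_approx[OF w p meas])
    define e e' where "e = (\<lambda>x. u x - realization1 sigmoid \<Phi> x)"
      and "e' = (\<lambda>x. u' x - deriv (realization1 sigmoid \<Phi>) x)"
    have C: "?B \<le> 8 * A * exp (- \<beta> * real p)"
      using A(1) by simp
    have Linf: "Linf_norm e \<le> ereal (8 * A * exp (- \<beta> * real p))"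
        "Linf_norm e' \<le> ereal (8 * A * exp (- \<beta> * real p))"
      unfolding e_def e'_def
      by (rule order.trans[OF Linf_norm_le[OF m(1) ae(1)]], use C in simp,
          rule order.trans[OF Linf_norm_le[OF m(2) ae(2)]], use C in simp)
    have "ereal (sqrt \<epsilon>) * L2_norm e' \<le> ereal 1 * ereal (2 * ?B)"
      using L2_norm_le[OF m(2) ae(2)] \<epsilon> unfolding e'_def by (intro ereal_mult_mono) auto
    moreover have "L2_norm e \<le> ereal (2 * ?B)"
      using L2_norm_le[OF m(1) ae(1)] unfolding e_def by simp
    ultimately have "ereal (sqrt \<epsilon>) * L2_norm e' + L2_norm e \<le> ereal 1 * ereal (2 * ?B) + ereal (2 * ?B)"
      by (rule add_mono)
    also have "\<dots> = ereal (8 * A * exp (- \<beta> * real p))"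
      by simp
    finally have L2: "ereal (sqrt \<epsilon>) * L2_norm e' + L2_norm e \<le> ereal (8 * A * exp (- \<beta> * real p))" .
    have size: "real (nn_size \<Phi>) \<le> 15 * real p"
      using \<Phi>(4) of_nat_mono[of "nn_size \<Phi>" "15 * p", where 'a = real] by simp
    show "\<exists>\<Phi> :: nn. is_nn 1 1 \<Phi> \<and>
            (let R = realization1 sigmoid \<Phi>;
                 e = (\<lambda>x. u x - R x);
                 e' = (\<lambda>x. u' x - deriv R x)
             in W1inf_norm e e' \<le> ereal (8 * A * exp (- \<beta> * real p)) \<and>
                ereal (sqrt \<epsilon>) * L2_norm e' + L2_norm e \<le> ereal (8 * A * exp (- \<beta> * real p)) \<and>
                Linf_norm e \<le> ereal (8 * A * exp (- \<beta> * real p))) \<and>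
            int (depth \<Phi>) = \<lceil>log 2 (real (max p 2))\<rceil> + 1 \<and>
            real (nn_size \<Phi>) \<le> 15 * real p \<and>
            hidden_layers \<Phi> = hidden_net p \<epsilon> \<beta>"
      using \<Phi>(1-3) size Linf L2 unfolding Let_def e_def[symmetric] e'_def[symmetric] W1inf_norm_def
      by (intro exI[of _ \<Phi>]) (simp add: e_def e'_def)
  qed
qed

end
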